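(* Let $k$ be a field, let $R$ be a $k$-algebra such that GK dimension (over $k$) of right $R$-modules is exact, and let $M$ be a right $R$-module. Let $k \subseteq K$ be a field extension, and let $R_K = R \otimes_k K$ and $M_K = M \otimes_k K$. If $M$ is a $d$-homogeneous $R$-module with respect to GK dimension over $k$, then $M_K$ is a $d$-homogeneous right $R_K$-module with respect to GK dimension over $K$.
   Context: Algebras are unital, associative, not necessarily commutative. For a right module $M$ over a $k$-algebra $R$, $\operatorname{GKdim}_k(M) = \sup_{W,V} \limsup_{n \to \infty} \log_n(\dim_k W V^n)$, with $W$ ranging over finite-dimensional $k$-subspaces of $M$ and $V$ over finite-dimensional $k$-subspaces of $R$; $\operatorname{GKdim}_k(0) = -1$ by convention. GK dimension of right $R$-modules is exact if $\operatorname{GKdim}(N) = \max(\operatorname{GKdim}(M), \operatorname{GKdim}(P))$ for every short exact sequence $0 \to M \to N \to P \to 0$ of right $R$-modules. A right module $M$ with $\operatorname{GKdim}(M) = d < \infty$ is $d$-homogeneous if $\operatorname{GKdim}(N) = d$ for all nonzero submodules $N$ of $M$. *)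

theory Defs
  imports Complex_Main "HOL-Library.Extended_Real" "HOL-Library.Liminf_Limsup"
    "HOL-Algebra.Module" "HOL-Algebra.QuotRing" "HOL-Algebra.Free_Abelian_Groups"
begin

section \<open>Algebras and right modules\<close>

text \<open>The library locale \<^locale>\<open>algebra\<close> describes commutative algebras only.\<close>

locale nc_algebra = module k R + ring R
  for k :: "('k, 'a) ring_scheme" (structure) and R :: "('k, 'r, 'b) module_scheme" (structure) +
  assumes smult_mult_left:
    "\<lbrakk>c \<in> carrier k; x \<in> carrier R; y \<in> carrier R\<rbrakk>
      \<Longrightarrow> (c \<odot>\<^bsub>R\<^esub> x) \<otimes>\<^bsub>R\<^esub> y = c \<odot>\<^bsub>R\<^esub> (x \<otimes>\<^bsub>R\<^esub> y)"
  and smult_mult_right: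
    "\<lbrakk>c \<in> carrier k; x \<in> carrier R; y \<in> carrier R\<rbrakk>
      \<Longrightarrow> x \<otimes>\<^bsub>R\<^esub> (c \<odot>\<^bsub>R\<^esub> y) = c \<odot>\<^bsub>R\<^esub> (x \<otimes>\<^bsub>R\<^esub> y)"

text \<open>
  Right modules use the record type of the library's (commutative) modules, whose components
  \<open>mult\<close> and \<open>one\<close> are irrelevant. For a right module \<open>M\<close>, the term \<open>r \<odot>\<^bsub>M\<^esub> x\<close> stands for
  \<open>x \<cdot> r\<close>, hence the reversed order in \<open>ract_assoc\<close>. The library's \<^const>\<open>submodule\<close>
  refers to neither side and applies to right modules as it is.
\<close>

locale right_module = A?: nc_algebra k R + M?: abelian_group M
  for k :: "('k, 'a) ring_scheme" (structure) and R :: "('k, 'r, 'b) module_scheme" (structure)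
    and M :: "('r, 'm, 'c) module_scheme" (structure) +
  assumes ract_closed:
    "\<lbrakk>r \<in> carrier R; x \<in> carrier M\<rbrakk> \<Longrightarrow> r \<odot>\<^bsub>M\<^esub> x \<in> carrier M"
  and ract_add_scalar:
    "\<lbrakk>r \<in> carrier R; s \<in> carrier R; x \<in> carrier M\<rbrakk>
      \<Longrightarrow> (r \<oplus>\<^bsub>R\<^esub> s) \<odot>\<^bsub>M\<^esub> x = r \<odot>\<^bsub>M\<^esub> x \<oplus>\<^bsub>M\<^esub> s \<odot>\<^bsub>M\<^esub> x"
  and ract_add:
    "\<lbrakk>r \<in> carrier R; x \<in> carrier M; y \<in> carrier M\<rbrakk>
      \<Longrightarrow> r \<odot>\<^bsub>M\<^esub> (x \<oplus>\<^bsub>M\<^esub> y) = r \<odot>\<^bsub>M\<^esub> x \<oplus>\<^bsub>M\<^esub> r \<odot>\<^bsub>M\<^esub> y"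
  and ract_assoc:
    "\<lbrakk>r \<in> carrier R; s \<in> carrier R; x \<in> carrier M\<rbrakk>
      \<Longrightarrow> (r \<otimes>\<^bsub>R\<^esub> s) \<odot>\<^bsub>M\<^esub> x = s \<odot>\<^bsub>M\<^esub> (r \<odot>\<^bsub>M\<^esub> x)"
  and ract_one:
    "x \<in> carrier M \<Longrightarrow> \<one>\<^bsub>R\<^esub> \<odot>\<^bsub>M\<^esub> x = x"

text \<open>The \<open>k\<close>-vector space underlying a right module over a \<open>k\<close>-algebra: \<open>c x = x \<cdot> (c 1)\<close>.\<close>

definition restrict_scalars :: "('k, 'r) module \<Rightarrow> ('r, 'm) module \<Rightarrow> ('k, 'm) module" where
  "restrict_scalars R M =
    \<lparr>carrier = carrier M, monoid.mult = monoid.mult M, monoid.one = monoid.one M,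
     ring.zero = ring.zero M, ring.add = ring.add M,
     smult = (\<lambda>c x. (c \<odot>\<^bsub>R\<^esub> \<one>\<^bsub>R\<^esub>) \<odot>\<^bsub>M\<^esub> x)\<rparr>"

definition right_module_hom ::
  "('k, 'r) module \<Rightarrow> ('r, 'm) module \<Rightarrow> ('r, 'n) module \<Rightarrow> ('m \<Rightarrow> 'n) set" where
  "right_module_hom R M N =
    {f \<in> hom (add_monoid M) (add_monoid N).
      \<forall>r\<in>carrier R. \<forall>x\<in>carrier M. f (r \<odot>\<^bsub>M\<^esub> x) = r \<odot>\<^bsub>N\<^esub> f x}"

definition short_exact ::
  "('k, 'r) module \<Rightarrow> ('r, 'l) module \<Rightarrow> ('l \<Rightarrow> 'm) \<Rightarrow> ('r, 'm) module \<Rightarrow> ('m \<Rightarrow> 'n)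
    \<Rightarrow> ('r, 'n) module \<Rightarrow> bool" where
  "short_exact R L f M g N \<longleftrightarrow>
    f \<in> right_module_hom R L M \<and> g \<in> right_module_hom R M N \<and>
    inj_on f (carrier L) \<and>
    f ` carrier L = {x \<in> carrier M. g x = \<zero>\<^bsub>N\<^esub>} \<and>
    g ` carrier M = carrier N"


section \<open>Subspaces and dimension\<close>

definition lin_span :: "'k ring \<Rightarrow> ('k, 'v) module \<Rightarrow> 'v set \<Rightarrow> 'v set" where
  "lin_span k X S = \<Inter>{H. submodule H k X \<and> S \<subseteq> H}"

definition is_basis :: "'k ring \<Rightarrow> ('k, 'v) module \<Rightarrow> 'v set \<Rightarrow> 'v set \<Rightarrow> bool" where
  "is_basis k X U B \<longleftrightarrow>
    B \<subseteq> U \<and> lin_span k X B = U \<and> (\<forall>b\<in>B. b \<notin> lin_span k X (B - {b}))"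

definition subspace_dim :: "'k ring \<Rightarrow> ('k, 'v) module \<Rightarrow> 'v set \<Rightarrow> nat" where
  "subspace_dim k X U = card (SOME B. is_basis k X U B)"

definition fin_dim_subspace :: "'k ring \<Rightarrow> ('k, 'v) module \<Rightarrow> 'v set \<Rightarrow> bool" where
  "fin_dim_subspace k X U \<longleftrightarrow>
    submodule U k X \<and> (\<exists>B. finite B \<and> is_basis k X U B)"


section \<open>Gelfand-Kirillov dimension\<close>

fun subspace_power :: "'k ring \<Rightarrow> ('k, 'r) module \<Rightarrow> 'r set \<Rightarrow> nat \<Rightarrow> 'r set" where
  "subspace_power k R V 0 = lin_span k R {\<one>\<^bsub>R\<^esub>}"
| "subspace_power k R V (Suc n) =
    lin_span k R {x \<otimes>\<^bsub>R\<^esub> v | x v. x \<in> subspace_power k R V n \<and> v \<in> V}"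

definition subspace_act ::
  "'k ring \<Rightarrow> ('k, 'r) module \<Rightarrow> ('r, 'm) module \<Rightarrow> 'm set \<Rightarrow> 'r set \<Rightarrow> 'm set" where
  "subspace_act k R M W U =
    lin_span k (restrict_scalars R M) {u \<odot>\<^bsub>M\<^esub> w | u w. u \<in> U \<and> w \<in> W}"

text \<open>In HOL \<open>ln 0 = 0\<close>, whereas here \<open>log\<^sub>n 0 = -\<infinity>\<close> is needed.\<close>

definition ext_log :: "nat \<Rightarrow> nat \<Rightarrow> ereal" where
  "ext_log n m = (if m = 0 then - \<infinity> else ereal (log (real n) (real m)))"

definition gkdim :: "'k ring \<Rightarrow> ('k, 'r) module \<Rightarrow> ('r, 'm) module \<Rightarrow> ereal" where
  "gkdim k R M =
    (if carrier M = {\<zero>\<^bsub>M\<^esub>} then - 1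
     else SUP (W, V) \<in> {(W, V). fin_dim_subspace k (restrict_scalars R M) W \<and>
                                fin_dim_subspace k R V}.
       limsup (\<lambda>n. ext_log n (subspace_dim k (restrict_scalars R M)
                               (subspace_act k R M W (subspace_power k R V n)))))"

text \<open>
  HOL cannot quantify over modules of all types inside a formula, so the modules range over
  those with carrier in \<open>'r list\<close>. This imposes exactness for all modules: every finitely
  generated module has an isomorphic copy there (send an element to a list of coefficients
  with respect to the generators), as do its submodules and quotients; and
  \<open>GKdim(M) \<le> max (GKdim(L)) (GKdim(N))\<close>, the only inequality that can fail, needs to be
  checked only for finitely generated \<open>M\<close>, because \<open>GKdim(M)\<close> is the supremum of the
  dimensions of the finitely generated submodules of \<open>M\<close>.
\<close>

definition gkdim_exact :: "'k ring \<Rightarrow> ('k, 'r) module \<Rightarrow> bool" where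
  "gkdim_exact k R \<longleftrightarrow>
    (\<forall>(L :: ('r, 'r list) module) (M :: ('r, 'r list) module) (N :: ('r, 'r list) module) f g.
      right_module k R L \<and> right_module k R M \<and> right_module k R N \<and> short_exact R L f M g N
      \<longrightarrow> gkdim k R M = max (gkdim k R L) (gkdim k R N))"

definition gk_homogeneous ::
  "'k ring \<Rightarrow> ('k, 'r) module \<Rightarrow> ('r, 'm) module \<Rightarrow> real \<Rightarrow> bool" where
  "gk_homogeneous k R M d \<longleftrightarrow>
    right_module k R M \<and> gkdim k R M = ereal d \<and>
    (\<forall>N. submodule N R M \<and> N \<noteq> {\<zero>\<^bsub>M\<^esub>} \<longrightarrow> gkdim k R (M\<lparr>carrier := N\<rparr>) = ereal d)"


section \<open>Tensor products and base change\<close>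

text \<open>
  \<open>X \<otimes>\<^sub>k Y\<close> is the free abelian group on \<open>X \<times> Y\<close> modulo the subgroup generated by the
  bilinearity relations.
\<close>

abbreviation tensor_free :: "('k, 'x) module \<Rightarrow> ('k, 'y) module \<Rightarrow> ('x \<times> 'y \<Rightarrow>\<^sub>0 int) monoid" where
  "tensor_free X Y \<equiv> free_Abelian_group (carrier X \<times> carrier Y)"

definition tensor_rel ::
  "'k ring \<Rightarrow> ('k, 'x) module \<Rightarrow> ('k, 'y) module \<Rightarrow> ('x \<times> 'y \<Rightarrow>\<^sub>0 int) set" where
  "tensor_rel k X Y = generate (tensor_free X Y)
    ({frag_of (x \<oplus>\<^bsub>X\<^esub> x', y) - frag_of (x, y) - frag_of (x', y) | x x' y.
        x \<in> carrier X \<and> x' \<in> carrier X \<and> y \<in> carrier Y} \<union>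
     {frag_of (x, y \<oplus>\<^bsub>Y\<^esub> y') - frag_of (x, y) - frag_of (x, y') | x y y'.
        x \<in> carrier X \<and> y \<in> carrier Y \<and> y' \<in> carrier Y} \<union>
     {frag_of (c \<odot>\<^bsub>X\<^esub> x, y) - frag_of (x, c \<odot>\<^bsub>Y\<^esub> y) | c x y.
        c \<in> carrier k \<and> x \<in> carrier X \<and> y \<in> carrier Y})"

definition tensor_group ::
  "'k ring \<Rightarrow> ('k, 'x) module \<Rightarrow> ('k, 'y) module \<Rightarrow> ('x \<times> 'y \<Rightarrow>\<^sub>0 int) set monoid" where
  "tensor_group k X Y = tensor_free X Y Mod tensor_rel k X Y"

definition tensor_class ::
  "'k ring \<Rightarrow> ('k, 'x) module \<Rightarrow> ('k, 'y) module
    \<Rightarrow> ('x \<times> 'y \<Rightarrow>\<^sub>0 int) \<Rightarrow> ('x \<times> 'y \<Rightarrow>\<^sub>0 int) set" where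
  "tensor_class k X Y u = tensor_rel k X Y #>\<^bsub>tensor_free X Y\<^esub> u"

text \<open>
  The maps induced on cosets by (bi)additive extension of maps on pure tensors; the unions
  collapse to single cosets as in \<^const>\<open>rcoset_mult\<close>.
\<close>

definition tensor_lift1 ::
  "'k ring \<Rightarrow> ('k, 'x) module \<Rightarrow> ('k, 'y) module \<Rightarrow> ('p \<Rightarrow> 'x \<times> 'y)
    \<Rightarrow> ('p \<Rightarrow>\<^sub>0 int) set \<Rightarrow> ('x \<times> 'y \<Rightarrow>\<^sub>0 int) set" where
  "tensor_lift1 k X Y \<phi> A = (\<Union>u\<in>A. tensor_class k X Y (frag_extend (\<lambda>p. frag_of (\<phi> p)) u))"

definition tensor_lift2 ::
  "'k ring \<Rightarrow> ('k, 'x) module \<Rightarrow> ('k, 'y) module \<Rightarrow> ('p \<Rightarrow> 'q \<Rightarrow> 'x \<times> 'y)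
    \<Rightarrow> ('p \<Rightarrow>\<^sub>0 int) set \<Rightarrow> ('q \<Rightarrow>\<^sub>0 int) set \<Rightarrow> ('x \<times> 'y \<Rightarrow>\<^sub>0 int) set" where
  "tensor_lift2 k X Y \<phi> A B = (\<Union>u\<in>A. \<Union>v\<in>B.
     tensor_class k X Y (frag_extend (\<lambda>p. frag_extend (\<lambda>q. frag_of (\<phi> p q)) v) u))"

text \<open>
  A field extension \<open>k \<subseteq> K\<close> is given by a ring homomorphism \<open>i\<close> from \<open>k\<close> to \<open>K\<close> (the
  inclusion, if \<open>k\<close> is a subfield of \<open>K\<close>).
\<close>

definition ext_space :: "('k \<Rightarrow> 'c) \<Rightarrow> 'c ring \<Rightarrow> ('k, 'c) module" where
  "ext_space i K =
    \<lparr>carrier = carrier K, monoid.mult = monoid.mult K, monoid.one = monoid.one K,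
     ring.zero = ring.zero K, ring.add = ring.add K, smult = (\<lambda>c a. i c \<otimes>\<^bsub>K\<^esub> a)\<rparr>"

definition base_change_algebra ::
  "'k ring \<Rightarrow> ('k \<Rightarrow> 'c) \<Rightarrow> 'c ring \<Rightarrow> ('k, 'r) module \<Rightarrow> ('c, ('r \<times> 'c \<Rightarrow>\<^sub>0 int) set) module" where
  "base_change_algebra k i K R =
    \<lparr>carrier = carrier (tensor_group k R (ext_space i K)),
     monoid.mult = tensor_lift2 k R (ext_space i K)
       (\<lambda>(r, a) (s, b). (r \<otimes>\<^bsub>R\<^esub> s, a \<otimes>\<^bsub>K\<^esub> b)),
     monoid.one = tensor_class k R (ext_space i K) (frag_of (\<one>\<^bsub>R\<^esub>, \<one>\<^bsub>K\<^esub>)),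
     ring.zero = \<one>\<^bsub>tensor_group k R (ext_space i K)\<^esub>,
     ring.add = monoid.mult (tensor_group k R (ext_space i K)),
     smult = (\<lambda>c. tensor_lift1 k R (ext_space i K) (\<lambda>(r, a). (r, c \<otimes>\<^bsub>K\<^esub> a)))\<rparr>"

text \<open>The right action on \<open>M\<^sub>K\<close> is \<open>(x \<otimes> b) \<cdot> (r \<otimes> a) = x \<cdot> r \<otimes> b a\<close>.\<close>

definition base_change_module ::
  "'k ring \<Rightarrow> ('k \<Rightarrow> 'c) \<Rightarrow> 'c ring \<Rightarrow> ('k, 'r) module \<Rightarrow> ('r, 'm) module
    \<Rightarrow> (('r \<times> 'c \<Rightarrow>\<^sub>0 int) set, ('m \<times> 'c \<Rightarrow>\<^sub>0 int) set) module" where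
  "base_change_module k i K R M =
    \<lparr>carrier = carrier (tensor_group k (restrict_scalars R M) (ext_space i K)),
     monoid.mult = undefined, monoid.one = undefined,
     ring.zero = \<one>\<^bsub>tensor_group k (restrict_scalars R M) (ext_space i K)\<^esub>,
     ring.add = monoid.mult (tensor_group k (restrict_scalars R M) (ext_space i K)),
     smult = tensor_lift2 k (restrict_scalars R M) (ext_space i K)
       (\<lambda>(r, a) (x, b). (r \<odot>\<^bsub>M\<^esub> x, b \<otimes>\<^bsub>K\<^esub> a))\<rparr>"

end

theory Submission
  imports Defs
begin

text \<open>
  Upper bound: finite-dimensional subspaces \<open>W\<close> of \<open>M\<^sub>K\<close> and \<open>V\<close> of \<open>R\<^sub>K\<close> lie in the \<open>K\<close>-spans
  of finite-dimensional \<open>W\<^sub>0 \<subseteq> M\<close> and \<open>V\<^sub>0 \<subseteq> R\<close>, and then \<open>dim\<^sub>K W V\<^sup>n \<le> dim\<^sub>k W\<^sub>0 V\<^sub>0\<^sup>n\<close>.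

  Lower bound: let \<open>z \<noteq> 0\<close> lie in a submodule \<open>N\<close> of \<open>M\<^sub>K\<close>. Then \<open>z \<in> M \<otimes> A\<close> for some
  \<open>k\<close>-subspace \<open>A\<close> of \<open>K\<close> with \<open>m = dim\<^sub>k A < \<infinity>\<close>, and a functional on \<open>K\<close> induces an
  \<open>R\<close>-linear map \<open>p : M\<^sub>K \<rightarrow> M\<close> with \<open>x = p(z) \<noteq> 0\<close>. A \<open>K\<close>-subspace \<open>Y\<close> of \<open>M\<^sub>K\<close> of dimension
  \<open>e\<close> embeds into \<open>K\<^sup>e\<close> by \<open>e\<close> coordinate functionals, which map \<open>Y \<inter> (M \<otimes> A)\<close> into \<open>A\<^sup>e\<close>;
  hence \<open>dim\<^sub>k (Y \<inter> (M \<otimes> A)) \<le> m e\<close>. So the growth of \<open>z R\<^sub>K\<close> over \<open>K\<close> is, up to the constant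
  factor \<open>m\<close>, at least the growth of \<open>x R\<close> over \<open>k\<close>, and \<open>GKdim(x R) = d\<close> by homogeneity.
\<close>

text \<open>A nonzero submodule \<open>N\<close> of \<open>M_K\<close> need not contain any nonzero
  \<open>x \<otimes> 1\<close>, so a submodule of \<open>M\<close> cannot simply be extended to
  \<open>K\<close> inside \<open>N\<close>. The map \<open>p\<close> therefore runs the other way:
  it presents \<open>x R\<close> as a quotient of the \<open>R\<close>-submodule \<open>z R\<close>
  of \<open>N\<close>, and so \<open>dim_k\<close> of \<open>x U\<close> is at most
  \<open>dim_k\<close> of \<open>z U\<close> for every subspace \<open>U\<close> of
  \<open>R\<close>. What remains is to compare \<open>dim_k\<close> of \<open>z U\<close> with the
  \<open>K\<close>-dimension of its \<open>K\<close>-span. In general the ratio is unbounded when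
  \<open>K\<close> is infinite over \<open>k\<close>; here it is at most \<open>m\<close> because
  \<open>z R\<close> never leaves \<open>M \<otimes> A\<close>, and \<open>log_n m\<close> tends to
  0. The nonvanishing of \<open>p z\<close> comes from two functionals. First \<open>\<mu>\<close>
  on \<open>M\<close> is chosen so that the induced \<open>f\<close> with
  \<open>f (x \<otimes> a) = \<mu> x a\<close> does not vanish at \<open>z\<close>, then
  \<open>l\<close> on \<open>K\<close> with \<open>l (f z) = 1\<close>. Contracting coefficients
  with \<open>l\<close> gives \<open>p\<close>, and \<open>\<mu> (p z) = l (f z)\<close>.\<close>

section \<open>Subspaces and dimension\<close>

text \<open>The scalar \<open>- 1\<close> supplies negatives.\<close>

lemma (in module) submodule_iff:
  "submodule H R M \<longleftrightarrow> H \<subseteq> carrier M \<and> \<zero>\<^bsub>M\<^esub> \<in> H \<and>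
     (\<forall>x\<in>H. \<forall>y\<in>H. x \<oplus>\<^bsub>M\<^esub> y \<in> H) \<and> (\<forall>c\<in>carrier R. \<forall>x\<in>H. c \<odot>\<^bsub>M\<^esub> x \<in> H)"
    (is "_ \<longleftrightarrow> ?r")
proof
  assume "submodule H R M"
  from submoduleE[OF this] show ?r
    by (metis M.add.r_cancel_one' M.r_neg ex_in_conv subsetD)
next
  assume r: ?r
  show "submodule H R M"
  proof (rule submoduleI)
    fix x assume x: "x \<in> H"
    with r have "(\<ominus> \<one>) \<odot>\<^bsub>M\<^esub> x \<in> H" by blast
    with x r show "\<ominus>\<^bsub>M\<^esub> x \<in> H" by (metis R.one_closed smult_l_minus smult_one subsetD)
  qed (use r in auto)
qed

text \<open>
  Linear functionals are the linear maps into \<^term>\<open>ext_space (\<lambda>c. c) k\<close>, the field \<open>k\<close> as a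
  vector space over itself.
\<close>

definition semilinear ::
  "('k \<Rightarrow> 'c) \<Rightarrow> 'k ring \<Rightarrow> ('k, 'v) module \<Rightarrow> ('c, 'w) module \<Rightarrow> ('v \<Rightarrow> 'w) \<Rightarrow> bool" where
  "semilinear i k X Y g \<longleftrightarrow> g \<in> carrier X \<rightarrow> carrier Y \<and>
     (\<forall>x\<in>carrier X. \<forall>y\<in>carrier X. g (x \<oplus>\<^bsub>X\<^esub> y) = g x \<oplus>\<^bsub>Y\<^esub> g y) \<and>
     (\<forall>c\<in>carrier k. \<forall>x\<in>carrier X. g (c \<odot>\<^bsub>X\<^esub> x) = i c \<odot>\<^bsub>Y\<^esub> g x)"

abbreviation linear_map :: "'k ring \<Rightarrow> ('k, 'v) module \<Rightarrow> ('k, 'w) module \<Rightarrow> ('v \<Rightarrow> 'w) \<Rightarrow> bool" where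
  "linear_map \<equiv> semilinear (\<lambda>c. c)"

lemma semilinearI:
  assumes "\<And>x. x \<in> carrier X \<Longrightarrow> g x \<in> carrier Y"
    and "\<And>x y. \<lbrakk>x \<in> carrier X; y \<in> carrier X\<rbrakk> \<Longrightarrow> g (x \<oplus>\<^bsub>X\<^esub> y) = g x \<oplus>\<^bsub>Y\<^esub> g y"
    and "\<And>c x. \<lbrakk>c \<in> carrier k; x \<in> carrier X\<rbrakk> \<Longrightarrow> g (c \<odot>\<^bsub>X\<^esub> x) = i c \<odot>\<^bsub>Y\<^esub> g x"
  shows "semilinear i k X Y g"
  using assms by (auto simp: semilinear_def)

lemma semilinearD:
  assumes "semilinear i k X Y g"
  shows "x \<in> carrier X \<Longrightarrow> g x \<in> carrier Y"
    and "\<lbrakk>x \<in> carrier X; y \<in> carrier X\<rbrakk> \<Longrightarrow> g (x \<oplus>\<^bsub>X\<^esub> y) = g x \<oplus>\<^bsub>Y\<^esub> g y"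
    and "\<lbrakk>c \<in> carrier k; x \<in> carrier X\<rbrakk> \<Longrightarrow> g (c \<odot>\<^bsub>X\<^esub> x) = i c \<odot>\<^bsub>Y\<^esub> g x"
  using assms by (auto simp: semilinear_def)

locale vec_space = module k X + field k for k :: "'k ring" (structure) and X :: "('k, 'v) module" (structure)
begin

lemma sub_carrier: "submodule H k X \<Longrightarrow> H \<subseteq> carrier X"
  and sub_zero: "submodule H k X \<Longrightarrow> \<zero>\<^bsub>X\<^esub> \<in> H"
  and sub_add: "\<lbrakk>submodule H k X; x \<in> H; y \<in> H\<rbrakk> \<Longrightarrow> x \<oplus>\<^bsub>X\<^esub> y \<in> H"
  and sub_smult: "\<lbrakk>submodule H k X; c \<in> carrier k; x \<in> H\<rbrakk> \<Longrightarrow> c \<odot>\<^bsub>X\<^esub> x \<in> H"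
  by (auto simp: submodule_iff)

lemma sub_minus: "\<lbrakk>submodule H k X; x \<in> H\<rbrakk> \<Longrightarrow> \<ominus>\<^bsub>X\<^esub> x \<in> H"
  by (rule submoduleE)

lemma sub_diff: "\<lbrakk>submodule H k X; x \<in> H; y \<in> H\<rbrakk> \<Longrightarrow> x \<ominus>\<^bsub>X\<^esub> y \<in> H"
  by (simp add: a_minus_def sub_add sub_minus)

lemma sub_add_cancel:
  assumes "submodule H k X" "x \<in> H" "y \<in> carrier X" "x \<oplus>\<^bsub>X\<^esub> y \<in> H" shows "y \<in> H"
proof -
  have "\<ominus>\<^bsub>X\<^esub> x \<oplus>\<^bsub>X\<^esub> (x \<oplus>\<^bsub>X\<^esub> y) = y"
    using assms(3) subsetD[OF sub_carrier[OF assms(1)] assms(2)] by (rule M.r_neg1[rotated])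
  with sub_add[OF assms(1) sub_minus[OF assms(1,2)] assms(4)] show ?thesis by simp
qed

lemma sub_smult_cancel:
  assumes "submodule H k X" "c \<in> carrier k" "c \<noteq> \<zero>" "y \<in> carrier X" "c \<odot>\<^bsub>X\<^esub> y \<in> H" shows "y \<in> H"
proof -
  have c: "inv c \<in> carrier k" "inv c \<otimes> c = \<one>" using assms by (auto simp: field_Units)
  hence "y = inv c \<odot>\<^bsub>X\<^esub> (c \<odot>\<^bsub>X\<^esub> y)" using assms by (metis smult_assoc1 smult_one)
  with assms c sub_smult show ?thesis by metis
qed

section \<open>Spans and the exchange property\<close>

lemma span_superset: "S \<subseteq> lin_span k X S"
  and span_least: "\<lbrakk>submodule H k X; S \<subseteq> H\<rbrakk> \<Longrightarrow> lin_span k X S \<subseteq> H"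
  by (auto simp: lin_span_def)

lemma span_submodule: assumes "S \<subseteq> carrier X" shows "submodule (lin_span k X S) k X"
proof -
  let ?F = "{H. submodule H k X \<and> S \<subseteq> H}"
  have c: "carrier X \<in> ?F" using carrier_is_submodule assms by simp
  show ?thesis
    unfolding submodule_iff[of "lin_span k X S"] unfolding lin_span_def
  proof (intro conjI ballI)
    show "\<Inter>?F \<subseteq> carrier X" using c by (rule Inter_lower)
  qed (auto simp: sub_zero sub_add sub_smult)
qed

lemma span_carrier: "S \<subseteq> carrier X \<Longrightarrow> lin_span k X S \<subseteq> carrier X"
  using span_submodule sub_carrier by blast

lemma span_mono: "S \<subseteq> T \<Longrightarrow> lin_span k X S \<subseteq> lin_span k X T"
  by (auto simp: lin_span_def)

lemma span_subset: "\<lbrakk>T \<subseteq> carrier X; S \<subseteq> lin_span k X T\<rbrakk> \<Longrightarrow> lin_span k X S \<subseteq> lin_span k X T"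
  by (simp add: span_least span_submodule)

lemma span_sub: "submodule H k X \<Longrightarrow> lin_span k X H = H"
  by (rule subset_antisym[OF span_least[OF _ order_refl] span_superset])

lemma span_empty: "lin_span k X {} = {\<zero>\<^bsub>X\<^esub>}"
proof -
  have "submodule {\<zero>\<^bsub>X\<^esub>} k X" by (auto simp: submodule_iff)
  thus ?thesis using span_least[of _ "{}"] sub_zero[OF span_submodule[of "{}"]] by blast
qed

text \<open>The combinations \<open>c x + s\<close> already form a subspace containing
  \<open>x\<close> and \<open>S\<close>, so nothing else lies in the span.\<close>

lemma span_insertE:
  assumes "S \<subseteq> carrier X" "x \<in> carrier X" "y \<in> lin_span k X (insert x S)"
  obtains c s where "c \<in> carrier k" "s \<in> lin_span k X S" "y = c \<odot>\<^bsub>X\<^esub> x \<oplus>\<^bsub>X\<^esub> s"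
proof -
  let ?H = "{c \<odot>\<^bsub>X\<^esub> x \<oplus>\<^bsub>X\<^esub> s | c s. c \<in> carrier k \<and> s \<in> lin_span k X S}"
  note sm = span_submodule[OF assms(1)]
  note cl = subsetD[OF span_carrier[OF assms(1)]]
  have "submodule ?H k X"
    unfolding submodule_iff
  proof (intro conjI ballI)
    show "?H \<subseteq> carrier X" using cl assms(2) by auto
    have "\<zero>\<^bsub>X\<^esub> = \<zero> \<odot>\<^bsub>X\<^esub> x \<oplus>\<^bsub>X\<^esub> \<zero>\<^bsub>X\<^esub>" using assms(2) by simp
    thus "\<zero>\<^bsub>X\<^esub> \<in> ?H" using sub_zero[OF sm] by blast
  next
    fix a b assume "a \<in> ?H" "b \<in> ?H"
    then obtain c s c' s' where *: "a = c \<odot>\<^bsub>X\<^esub> x \<oplus>\<^bsub>X\<^esub> s" "b = c' \<odot>\<^bsub>X\<^esub> x \<oplus>\<^bsub>X\<^esub> s'"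
      "c \<in> carrier k" "c' \<in> carrier k" "s \<in> lin_span k X S" "s' \<in> lin_span k X S" by blast
    have "a \<oplus>\<^bsub>X\<^esub> b = (c \<oplus> c') \<odot>\<^bsub>X\<^esub> x \<oplus>\<^bsub>X\<^esub> (s \<oplus>\<^bsub>X\<^esub> s')"
      using * cl assms(2) by (simp add: smult_l_distr M.a_ac)
    thus "a \<oplus>\<^bsub>X\<^esub> b \<in> ?H" using * sub_add[OF sm] by blast
  next
    fix d a assume d: "d \<in> carrier k" and "a \<in> ?H"
    then obtain c s where *: "a = c \<odot>\<^bsub>X\<^esub> x \<oplus>\<^bsub>X\<^esub> s" "c \<in> carrier k" "s \<in> lin_span k X S" by blast
    have "d \<odot>\<^bsub>X\<^esub> a = (d \<otimes> c) \<odot>\<^bsub>X\<^esub> x \<oplus>\<^bsub>X\<^esub> d \<odot>\<^bsub>X\<^esub> s"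
      using * d cl assms(2) by (simp add: smult_r_distr smult_assoc1)
    thus "d \<odot>\<^bsub>X\<^esub> a \<in> ?H" using * d sub_smult[OF sm] by blast
  qed
  moreover have "insert x S \<subseteq> ?H"
  proof safe
    show "\<exists>c s. x = c \<odot>\<^bsub>X\<^esub> x \<oplus>\<^bsub>X\<^esub> s \<and> c \<in> carrier k \<and> s \<in> lin_span k X S"
      using sub_zero[OF sm] assms(2) by (intro exI[of _ \<one>] exI[of _ "\<zero>\<^bsub>X\<^esub>"]) auto
    fix s assume "s \<in> S"
    thus "\<exists>c s'. s = c \<odot>\<^bsub>X\<^esub> x \<oplus>\<^bsub>X\<^esub> s' \<and> c \<in> carrier k \<and> s' \<in> lin_span k X S"
      using span_superset assms by (intro exI[of _ \<zero>] exI[of _ s]) auto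
  qed
  ultimately have "y \<in> ?H" using span_least assms(3) by blast
  thus ?thesis using that by blast
qed

text \<open>\<open>y\<close> lies outside the span of \<open>S\<close>, so \<open>x\<close> occurs
  in it with an invertible coefficient and can be solved for.\<close>

lemma span_exchange:
  assumes S: "S \<subseteq> carrier X" and x: "x \<in> carrier X"
    and y: "y \<in> lin_span k X (insert x S)" "y \<notin> lin_span k X S"
  shows "x \<in> lin_span k X (insert y S)"
proof -
  obtain c s where *: "c \<in> carrier k" "s \<in> lin_span k X S" "y = c \<odot>\<^bsub>X\<^esub> x \<oplus>\<^bsub>X\<^esub> s"
    using span_insertE[OF S x y(1)] .
  have s: "s \<in> carrier X" using * span_carrier[OF S] by blast
  have c0: "c \<noteq> \<zero>" using * x y(2) s by auto
  have yc: "y \<in> carrier X" using * s x by simp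
  have sm: "submodule (lin_span k X (insert y S)) k X" using span_submodule S yc by simp
  have "s \<oplus>\<^bsub>X\<^esub> c \<odot>\<^bsub>X\<^esub> x \<in> lin_span k X (insert y S)"
    using span_superset[of "insert y S"] * s x by (simp add: M.a_comm)
  moreover have "s \<in> lin_span k X (insert y S)" using * span_mono[of S "insert y S"] by blast
  ultimately have "c \<odot>\<^bsub>X\<^esub> x \<in> lin_span k X (insert y S)"
    using sub_add_cancel[OF sm] * x by blast
  thus ?thesis using sub_smult_cancel[OF sm] * c0 x by blast
qed

section \<open>Linear independence, bases and dimension\<close>

definition indep :: "'v set \<Rightarrow> bool" where
  "indep B \<longleftrightarrow> B \<subseteq> carrier X \<and> (\<forall>b\<in>B. b \<notin> lin_span k X (B - {b}))"

lemma indep_subset: assumes "indep B" "C \<subseteq> B" shows "indep C"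
proof -
  have "C - {b} \<subseteq> B - {b}" for b using assms by blast
  from span_mono[OF this] show ?thesis using assms unfolding indep_def by blast
qed

text \<open>If some old \<open>b\<close> fell into the span of \<open>y\<close> and the other
  elements, exchanging \<open>b\<close> for \<open>y\<close> would put \<open>y\<close> into the
  span of \<open>B\<close>.\<close>

lemma indep_insert:
  assumes B: "indep B" and y: "y \<in> carrier X" "y \<notin> lin_span k X B"
  shows "indep (insert y B)"
  unfolding indep_def
proof (intro conjI ballI)
  show "insert y B \<subseteq> carrier X" using B y by (auto simp: indep_def)
  fix b assume b: "b \<in> insert y B"
  have yB: "y \<notin> B" using y span_superset[of B] by blast
  show "b \<notin> lin_span k X (insert y B - {b})"
  proof (cases "b = y")
    case True thus ?thesis using y yB by simp
  next
    case False
    hence eq: "insert y B - {b} = insert y (B - {b})" "insert b (B - {b}) = B" using b by auto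
    have bB: "b \<in> B" using b False by simp
    show ?thesis
    proof
      assume "b \<in> lin_span k X (insert y B - {b})"
      hence "y \<in> lin_span k X (insert b (B - {b}))"
        using span_exchange[of "B - {b}" y b] B bB y unfolding eq indep_def by auto
      thus False using y eq by simp
    qed
  qed
qed

text \<open>Steinitz exchange with \<open>S\<close> kept fixed: an element of \<open>B\<close>
  outside \<open>S\<close> is traded for an element of \<open>S\<close>, which keeps the size and
  the independence of \<open>B\<close> and shrinks \<open>B - S\<close>.\<close>

lemma indep_card_le_finite:
  assumes "finite B" "indep B" "finite S" "S \<subseteq> carrier X" "B \<subseteq> lin_span k X S"
  shows "card B \<le> card S"
  using assms
proof (induction "card (B - S)" arbitrary: B rule: less_induct)
  case less
  show ?case
  proof (cases "B \<subseteq> S")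
    case True thus ?thesis using less.prems card_mono by blast
  next
    case False
    then obtain b where b: "b \<in> B" "b \<notin> S" by blast
    let ?B = "B - {b}"
    have B: "B \<subseteq> carrier X" "b \<notin> lin_span k X ?B" using less.prems b by (auto simp: indep_def)
    \<comment> \<open>Otherwise the span of \<open>S\<close>, and with it \<open>b\<close>, would
      lie in the span of the remaining elements.\<close>
    have "\<not> S \<subseteq> lin_span k X ?B"
      using span_subset[of ?B S] less.prems B b by blast
    then obtain s where s: "s \<in> S" "s \<notin> lin_span k X ?B" by blast
    have sB: "s \<notin> ?B" using s span_superset[of ?B] by blast
    have "indep (insert s ?B)"
      using indep_insert[OF indep_subset[OF less.prems(2)]] less.prems(4) s by blast
    moreover have "card (insert s ?B - S) < card (B - S)"
      using b s less.prems by (intro psubset_card_mono) auto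
    moreover have "insert s ?B \<subseteq> lin_span k X S" using less.prems s(1) span_superset[of S] by blast
    ultimately have "card (insert s ?B) \<le> card S"
      using less.hyps[of "insert s ?B"] less.prems by blast
    moreover have "card (insert s ?B) = card B"
      using sB b less.prems by (metis card.remove card_insert_disjoint finite_Diff)
    ultimately show ?thesis by simp
  qed
qed

lemma indep_card_le:
  assumes "indep B" "finite S" "S \<subseteq> carrier X" "B \<subseteq> lin_span k X S"
  shows "finite B" "card B \<le> card S"
proof -
  show "finite B"
  proof (rule ccontr)
    assume "infinite B"
    then obtain C where C: "C \<subseteq> B" "finite C" "card C = Suc (card S)"
      using infinite_arbitrarily_large by metis
    have "card C \<le> card S"
      using indep_card_le_finite[OF C(2) indep_subset[OF assms(1) C(1)] assms(2,3)] C(1) assms(4) by blast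
    thus False using C by simp
  qed
  thus "card B \<le> card S" by (rule indep_card_le_finite[OF _ assms])
qed

text \<open>An independent subset of \<open>U\<close> of maximal size exists because
  \<open>card S\<close> bounds all of them; it spans, since any missed vector could be
  adjoined.\<close>

lemma basis_exists:
  assumes U: "submodule U k X" and S: "finite S" "S \<subseteq> carrier X" "U \<subseteq> lin_span k X S"
  obtains B where "finite B" "is_basis k X U B" "card B \<le> card S"
proof -
  let ?P = "\<lambda>B. B \<subseteq> U \<and> indep B"
  have fin: "finite B" "card B < Suc (card S)" if "?P B" for B
    using indep_card_le[of B S] subset_trans[OF _ S(3)] that S(1,2) by (auto simp: less_Suc_eq_le)
  have "?P {}" by (simp add: indep_def)
  then obtain B where B: "?P B" and max: "\<And>C. ?P C \<Longrightarrow> card C \<le> card B"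
    using ex_has_greatest_nat[of ?P "{}" card "Suc (card S)"] fin(2) by blast
  have "U \<subseteq> lin_span k X B"
  proof
    fix u assume u: "u \<in> U"
    show "u \<in> lin_span k X B"
    proof (rule ccontr)
      assume n: "u \<notin> lin_span k X B"
      hence "?P (insert u B)" using indep_insert[of B u] B u sub_carrier[OF U] by blast
      from max[OF this] n show False using fin[OF B] span_superset[of B] by (metis card_insert_disjoint lessI not_less subsetD)
    qed
  qed
  moreover have "lin_span k X B \<subseteq> U" using span_least U B by blast
  ultimately have "is_basis k X U B" using B by (auto simp: is_basis_def indep_def)
  thus ?thesis using that fin[OF B] by simp
qed

lemma is_basis_indep: "\<lbrakk>submodule U k X; is_basis k X U B\<rbrakk> \<Longrightarrow> indep B"
  using sub_carrier[of U] by (auto simp: is_basis_def indep_def)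

text \<open>\<open>subspace_dim\<close> measures a basis picked by \<open>SOME\<close>. The finite
  spanning set guarantees that a basis exists and that the one picked is finite, so its
  \<open>card\<close> is not a default value.\<close>

lemma subspace_dim_basis:
  assumes "submodule U k X" "finite S" "S \<subseteq> carrier X" "U \<subseteq> lin_span k X S"
  obtains B where "finite B" "is_basis k X U B" "card B = subspace_dim k X U" "card B \<le> card S"
proof -
  have "\<exists>B. is_basis k X U B" using basis_exists[OF assms] by blast
  hence b: "is_basis k X U (SOME B. is_basis k X U B)" (is "is_basis k X U ?B") by (rule someI_ex)
  have "?B \<subseteq> lin_span k X S" using b assms(4) by (auto simp: is_basis_def)
  note indep_card_le[OF is_basis_indep[OF assms(1) b] assms(2,3) this]
  thus ?thesis using that b by (simp add: subspace_dim_def)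
qed

lemma subspace_dim_le:
  assumes "submodule U k X" "finite S" "S \<subseteq> carrier X" "U \<subseteq> lin_span k X S"
  shows "subspace_dim k X U \<le> card S"
  using subspace_dim_basis[OF assms] by metis

lemma fin_dim_span:
  assumes "finite S" "S \<subseteq> carrier X" shows "fin_dim_subspace k X (lin_span k X S)"
  using basis_exists[OF span_submodule[OF assms(2)] assms subset_refl] span_submodule[OF assms(2)]
  unfolding fin_dim_subspace_def by blast

lemma fin_dimE:
  assumes "fin_dim_subspace k X U"
  obtains S where "finite S" "S \<subseteq> carrier X" "U = lin_span k X S"
  using assms sub_carrier unfolding fin_dim_subspace_def is_basis_def by (metis subset_trans)

text \<open>Among the subspaces that contain \<open>H\<close> and avoid \<open>x\<close>, a maximal
  one \<open>L\<close> is a complement of the line through \<open>x\<close>; the functional reads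
  off the coefficient of \<open>x\<close>. Zorn's lemma enters because the space may be
  infinite-dimensional.\<close>

lemma separating_functional:
  assumes H: "submodule H k X" and x: "x \<in> carrier X" "x \<notin> H"
  obtains \<mu> where "linear_map k X (ext_space (\<lambda>c. c) k) \<mu>"
    "\<mu> x = \<one>" "\<And>h. h \<in> H \<Longrightarrow> \<mu> h = \<zero>"
proof -
  let ?A = "{L. submodule L k X \<and> H \<subseteq> L \<and> x \<notin> L}"
  have "\<exists>L\<in>?A. \<forall>L'\<in>?A. L \<subseteq> L' \<longrightarrow> L' = L"
  proof (rule subset_Zorn)
    fix C assume C: "subset.chain ?A C"
    show "\<exists>U\<in>?A. \<forall>L\<in>C. L \<subseteq> U"
    proof (cases "C = {}")
      case True thus ?thesis using H x by blast
    next
      case False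
      have CA: "\<And>L. L \<in> C \<Longrightarrow> submodule L k X \<and> H \<subseteq> L \<and> x \<notin> L"
        using C by (auto simp: subset_chain_def)
      have "submodule (\<Union>C) k X"
        unfolding submodule_iff
      proof (intro conjI ballI)
        fix a b assume "a \<in> \<Union>C" "b \<in> \<Union>C"
        then obtain L L' where L: "L \<in> C" "L' \<in> C" "a \<in> L" "b \<in> L'" by blast
        have "L \<subseteq> L' \<or> L' \<subseteq> L" using C L by (auto simp: subset_chain_def)
        then obtain L'' where "L'' \<in> C" "a \<in> L''" "b \<in> L''" using L by blast
        thus "a \<oplus>\<^bsub>X\<^esub> b \<in> \<Union>C" using CA sub_add[of L'' a b] by blast
      next
        show "\<Union>C \<subseteq> carrier X" using CA sub_carrier by (meson Sup_least)
        show "\<zero>\<^bsub>X\<^esub> \<in> \<Union>C" using CA sub_zero False by (meson UnionI ex_in_conv)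
        fix c a assume "c \<in> carrier k" "a \<in> \<Union>C"
        thus "c \<odot>\<^bsub>X\<^esub> a \<in> \<Union>C" using CA sub_smult by (meson UnionE UnionI)
      qed
      moreover obtain L where "L \<in> C" using False by blast
      ultimately have "\<Union>C \<in> ?A" using CA by (simp add: Sup_upper2)
      thus ?thesis by blast
    qed
  qed
  then obtain L where LA: "L \<in> ?A" and LM: "\<forall>L'\<in>?A. L \<subseteq> L' \<longrightarrow> L' = L" by (rule bexE)
  from LA have L: "submodule L k X" "H \<subseteq> L" "x \<notin> L" by simp_all
  have max: "L' = L" if "submodule L' k X" "L \<subseteq> L'" "x \<notin> L'" for L'
    using LM that subset_trans[OF L(2)] by simp
  note Lc = subsetD[OF sub_carrier[OF L(1)]]
  \<comment> \<open>Adjoining to \<open>L\<close> any \<open>y\<close> outside it captures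
    \<open>x\<close> by maximality, and exchange then expresses \<open>y\<close> through
    \<open>x\<close> and \<open>L\<close>.\<close>
  have decomp: "\<exists>c\<in>carrier k. \<exists>s\<in>L. y = c \<odot>\<^bsub>X\<^esub> x \<oplus>\<^bsub>X\<^esub> s" if y: "y \<in> carrier X" for y
  proof -
    have "y \<in> lin_span k X (insert x L)"
    proof (cases "y \<in> L")
      case True thus ?thesis using span_superset[of "insert x L"] by blast
    next
      case False
      have yL: "insert y L \<subseteq> carrier X" using y Lc by blast
      have "lin_span k X (insert y L) \<noteq> L" using False span_superset[of "insert y L"] by blast
      hence "x \<in> lin_span k X (insert y L)"
        using max[OF span_submodule[OF yL]] span_superset[of "insert y L"] by (meson insert_subset)
      thus ?thesis using span_exchange[OF sub_carrier[OF L(1)] y, of x] L by (simp add: span_sub)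
    qed
    from span_insertE[OF sub_carrier[OF L(1)] x(1) this] show ?thesis
      unfolding span_sub[OF L(1)] by metis
  qed
  \<comment> \<open>Two different coefficients would leave a nonzero multiple of \<open>x\<close> in
    \<open>L\<close>.\<close>
  have uniq: "c = c'" if "c \<in> carrier k" "c' \<in> carrier k" "s \<in> L" "s' \<in> L"
    "c \<odot>\<^bsub>X\<^esub> x \<oplus>\<^bsub>X\<^esub> s = c' \<odot>\<^bsub>X\<^esub> x \<oplus>\<^bsub>X\<^esub> s'" for c c' s s'
  proof (rule ccontr)
    assume "c \<noteq> c'"
    have ne: "c \<ominus> c' \<noteq> \<zero>"
      using \<open>c \<noteq> c'\<close> that(1,2) R.minus_equality[of c "\<ominus> c'"] by (auto simp: a_minus_def)
    have "(c \<ominus> c') \<odot>\<^bsub>X\<^esub> x \<oplus>\<^bsub>X\<^esub> s = s' "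
    proof -
      have "(c \<ominus> c') \<odot>\<^bsub>X\<^esub> x \<oplus>\<^bsub>X\<^esub> s = (\<ominus>c') \<odot>\<^bsub>X\<^esub> x \<oplus>\<^bsub>X\<^esub> (c \<odot>\<^bsub>X\<^esub> x \<oplus>\<^bsub>X\<^esub> s)"
        using that(1-4) Lc x by (simp add: a_minus_def smult_l_distr M.a_ac)
      also have "\<dots> = s'" unfolding that(5) using that(1-4) Lc x by (simp add: smult_l_minus M.r_neg1)
      finally show ?thesis .
    qed
    hence "(c \<ominus> c') \<odot>\<^bsub>X\<^esub> x \<in> L"
      using sub_add_cancel[OF L(1), of s "(c \<ominus> c') \<odot>\<^bsub>X\<^esub> x"] that(1-4) Lc x by (simp add: M.a_comm)
    with sub_smult_cancel[OF L(1) _ ne x(1)] that(1,2) L show False by simp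
  qed
  define \<mu> where "\<mu> y = (THE c. c \<in> carrier k \<and> (\<exists>s\<in>L. y = c \<odot>\<^bsub>X\<^esub> x \<oplus>\<^bsub>X\<^esub> s))" for y
  have mu: "\<mu> (c \<odot>\<^bsub>X\<^esub> x \<oplus>\<^bsub>X\<^esub> s) = c" if "c \<in> carrier k" "s \<in> L" for c s
    unfolding \<mu>_def
  proof (rule the_equality)
    show "c \<in> carrier k \<and> (\<exists>s'\<in>L. c \<odot>\<^bsub>X\<^esub> x \<oplus>\<^bsub>X\<^esub> s = c \<odot>\<^bsub>X\<^esub> x \<oplus>\<^bsub>X\<^esub> s')" using that by auto
  qed (use that uniq in metis)
  have 1: "\<mu> \<in> carrier X \<rightarrow> carrier k"
  proof
    fix y assume "y \<in> carrier X"
    from decomp[OF this] mu show "\<mu> y \<in> carrier k" by auto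
  qed
  have 2: "\<mu> (y \<oplus>\<^bsub>X\<^esub> z) = \<mu> y \<oplus> \<mu> z" if yz: "y \<in> carrier X" "z \<in> carrier X" for y z
  proof -
    obtain c s c' s' where *: "y = c \<odot>\<^bsub>X\<^esub> x \<oplus>\<^bsub>X\<^esub> s" "z = c' \<odot>\<^bsub>X\<^esub> x \<oplus>\<^bsub>X\<^esub> s'"
      "c \<in> carrier k" "c' \<in> carrier k" "s \<in> L" "s' \<in> L" using decomp yz by metis
    have "y \<oplus>\<^bsub>X\<^esub> z = (c \<oplus> c') \<odot>\<^bsub>X\<^esub> x \<oplus>\<^bsub>X\<^esub> (s \<oplus>\<^bsub>X\<^esub> s')"
      using * Lc x by (simp add: smult_l_distr M.a_ac)
    thus ?thesis using * mu sub_add[OF L(1)] by simp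
  qed
  have 3: "\<mu> (d \<odot>\<^bsub>X\<^esub> y) = d \<otimes> \<mu> y" if y: "d \<in> carrier k" "y \<in> carrier X" for d y
  proof -
    obtain c s where *: "y = c \<odot>\<^bsub>X\<^esub> x \<oplus>\<^bsub>X\<^esub> s" "c \<in> carrier k" "s \<in> L" using decomp y by metis
    have "d \<odot>\<^bsub>X\<^esub> y = (d \<otimes> c) \<odot>\<^bsub>X\<^esub> x \<oplus>\<^bsub>X\<^esub> d \<odot>\<^bsub>X\<^esub> s"
      using * Lc x y by (simp add: smult_r_distr smult_assoc1)
    thus ?thesis using * mu y sub_smult[OF L(1)] by simp
  qed
  have 4: "\<mu> x = \<one>" using mu[of \<one> "\<zero>\<^bsub>X\<^esub>"] sub_zero[OF L(1)] x by simp
  have 5: "\<mu> h = \<zero>" if "h \<in> H" for h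
    using mu[of \<zero> h] that L(2) Lc x by auto
  have "linear_map k X (ext_space (\<lambda>c. c) k) \<mu>"
    using 1 2 3 by (auto simp: semilinear_def ext_space_def)
  thus ?thesis using that 4 5 by blast
qed

end

section \<open>Semilinear maps\<close>

lemma ext_space_simps [simp]:
  "carrier (ext_space i K) = carrier K" "ring.add (ext_space i K) = ring.add K"
  "ring.zero (ext_space i K) = ring.zero K" "smult (ext_space i K) = (\<lambda>c a. i c \<otimes>\<^bsub>K\<^esub> a)"
  by (simp_all add: ext_space_def)

lemma restrict_scalars_simps [simp]:
  "carrier (restrict_scalars R M) = carrier M" "ring.add (restrict_scalars R M) = ring.add M"
  "ring.zero (restrict_scalars R M) = ring.zero M"
  "smult (restrict_scalars R M) = (\<lambda>c x. (c \<odot>\<^bsub>R\<^esub> \<one>\<^bsub>R\<^esub>) \<odot>\<^bsub>M\<^esub> x)"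
  by (simp_all add: restrict_scalars_def)

lemma vec_space_ext:
  assumes k: "field k" and K: "field K" and i: "i \<in> ring_hom k K"
  shows "vec_space k (ext_space i K)"
proof -
  interpret k: field k by fact
  interpret K: field K by fact
  have "module k (ext_space i K)"
  proof (rule moduleI)
    show "abelian_group (ext_space i K)"
      by (rule abelian_groupI) (auto simp: K.a_ac intro: K.l_neg bexI[of _ "\<ominus>\<^bsub>K\<^esub> _"])
  qed (use ring_hom_closed[OF i] ring_hom_mult[OF i] ring_hom_add[OF i] ring_hom_one[OF i] in
       \<open>auto simp: K.l_distr K.r_distr K.m_assoc k.is_cring\<close>)
  thus ?thesis using k by (simp add: vec_space_def)
qed

lemma vec_space_ext_self: "field k \<Longrightarrow> vec_space k (ext_space (\<lambda>c. c) k)"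
  by (rule vec_space_ext) (auto simp: ring_hom_def)

section \<open>Right modules as vector spaces over the base field\<close>

context right_module
begin

text \<open>\<open>c \<odot> 1\<close> is central in \<open>R\<close>: its product with
  \<open>r\<close> is \<open>c \<odot> r\<close> on either side.\<close>

lemma restrict_scalars_act:
  assumes "c \<in> carrier k" "r \<in> carrier R" "x \<in> carrier M"
  shows "r \<odot>\<^bsub>M\<^esub> ((c \<odot>\<^bsub>R\<^esub> \<one>\<^bsub>R\<^esub>) \<odot>\<^bsub>M\<^esub> x) = (c \<odot>\<^bsub>R\<^esub> \<one>\<^bsub>R\<^esub>) \<odot>\<^bsub>M\<^esub> (r \<odot>\<^bsub>M\<^esub> x)"
    and "(c \<odot>\<^bsub>R\<^esub> r) \<odot>\<^bsub>M\<^esub> x = (c \<odot>\<^bsub>R\<^esub> \<one>\<^bsub>R\<^esub>) \<odot>\<^bsub>M\<^esub> (r \<odot>\<^bsub>M\<^esub> x)"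
proof -
  have 1: "(c \<odot>\<^bsub>R\<^esub> \<one>\<^bsub>R\<^esub>) \<otimes>\<^bsub>R\<^esub> r = c \<odot>\<^bsub>R\<^esub> r" "r \<otimes>\<^bsub>R\<^esub> (c \<odot>\<^bsub>R\<^esub> \<one>\<^bsub>R\<^esub>) = c \<odot>\<^bsub>R\<^esub> r"
    using assms by (simp_all add: smult_mult_left smult_mult_right)
  from assms show 2: "(c \<odot>\<^bsub>R\<^esub> r) \<odot>\<^bsub>M\<^esub> x = (c \<odot>\<^bsub>R\<^esub> \<one>\<^bsub>R\<^esub>) \<odot>\<^bsub>M\<^esub> (r \<odot>\<^bsub>M\<^esub> x)"
    by (simp flip: ract_assoc add: 1)
  from assms have "r \<odot>\<^bsub>M\<^esub> ((c \<odot>\<^bsub>R\<^esub> \<one>\<^bsub>R\<^esub>) \<odot>\<^bsub>M\<^esub> x) = (c \<odot>\<^bsub>R\<^esub> r) \<odot>\<^bsub>M\<^esub> x"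
    by (simp flip: ract_assoc add: 1)
  with 2 show "r \<odot>\<^bsub>M\<^esub> ((c \<odot>\<^bsub>R\<^esub> \<one>\<^bsub>R\<^esub>) \<odot>\<^bsub>M\<^esub> x) = (c \<odot>\<^bsub>R\<^esub> \<one>\<^bsub>R\<^esub>) \<odot>\<^bsub>M\<^esub> (r \<odot>\<^bsub>M\<^esub> x)" by simp
qed

end

lemma vec_space_algebra: "\<lbrakk>field k; nc_algebra k R\<rbrakk> \<Longrightarrow> vec_space k R"
  by (simp add: vec_space_def nc_algebra_def)

lemma vec_space_restrict_scalars:
  assumes "field k" "right_module k R M" shows "vec_space k (restrict_scalars R M)"
proof -
  interpret right_module k R M by fact
  have "module k (restrict_scalars R M)"
  proof (rule moduleI)
    show "abelian_group (restrict_scalars R M)"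
      by (rule abelian_groupI) (auto simp: M.a_ac intro: M.l_neg bexI[of _ "\<ominus>\<^bsub>M\<^esub> _"])
    show "cring k" using assms(1) fieldE(1) by blast
  qed (auto simp: ract_closed ract_add ract_one restrict_scalars_act(2)[symmetric]
        smult_l_distr ract_add_scalar smult_assoc1)
  thus ?thesis using assms(1) by (simp add: vec_space_def)
qed

section \<open>Images and preimages of subspaces\<close>

lemma semilinear_zero:
  assumes "vec_space k X" "vec_space K Y" "semilinear i k X Y g"
  shows "g \<zero>\<^bsub>X\<^esub> = \<zero>\<^bsub>Y\<^esub>"
proof -
  interpret X: vec_space k X by fact
  interpret Y: vec_space K Y by fact
  have z: "g \<zero>\<^bsub>X\<^esub> \<in> carrier Y" "g \<zero>\<^bsub>X\<^esub> \<oplus>\<^bsub>Y\<^esub> g \<zero>\<^bsub>X\<^esub> = g \<zero>\<^bsub>X\<^esub>"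
    using semilinearD(1)[OF assms(3), of "\<zero>\<^bsub>X\<^esub>"] semilinearD(2)[OF assms(3), of "\<zero>\<^bsub>X\<^esub>" "\<zero>\<^bsub>X\<^esub>"] by simp_all
  thus ?thesis using Y.M.add.r_cancel_one' by metis
qed

lemma semilinear_diff:
  assumes "vec_space k X" "vec_space K Y" "semilinear i k X Y g" "x \<in> carrier X" "y \<in> carrier X"
  shows "g (x \<ominus>\<^bsub>X\<^esub> y) = g x \<ominus>\<^bsub>Y\<^esub> g y"
proof -
  interpret X: vec_space k X by fact
  interpret Y: vec_space K Y by fact
  note D = semilinearD[OF assms(3)]
  have "g (\<ominus>\<^bsub>X\<^esub> y) \<oplus>\<^bsub>Y\<^esub> g y = \<zero>\<^bsub>Y\<^esub>"
    using D(2)[of "\<ominus>\<^bsub>X\<^esub> y" y] assms semilinear_zero[OF assms(1-3)] by (simp add: X.M.l_neg)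
  hence "g (\<ominus>\<^bsub>X\<^esub> y) = \<ominus>\<^bsub>Y\<^esub> g y"
    using Y.M.minus_equality D(1) assms by (metis X.M.a_inv_closed)
  thus ?thesis using D(2)[of x "\<ominus>\<^bsub>X\<^esub> y"] assms by (simp add: a_minus_def)
qed

lemma submodule_preimage:
  assumes "vec_space k X" "vec_space K Y" "i \<in> carrier k \<rightarrow> carrier K" "semilinear i k X Y g"
    and T: "submodule T k X" and H: "submodule H K Y"
  shows "submodule {x \<in> T. g x \<in> H} k X"
proof -
  interpret X: vec_space k X by fact
  interpret Y: vec_space K Y by fact
  note D = semilinearD[OF assms(4)]
  note c = subsetD[OF X.sub_carrier[OF T]]
  show ?thesis
    unfolding X.submodule_iff
    using assms(3) X.sub_zero[OF T] Y.sub_zero[OF H]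
    by (auto simp: semilinear_zero[OF assms(1,2,4)] D(2,3) c X.sub_add[OF T] Y.sub_add[OF H]
         X.sub_smult[OF T] Y.sub_smult[OF H] Pi_iff)
qed

text \<open>The preimage of \<open>H\<close> is a \<open>k\<close>-subspace containing
  \<open>S\<close>.\<close>

lemma semilinear_span:
  assumes "vec_space k X" "vec_space K Y" "i \<in> carrier k \<rightarrow> carrier K" "semilinear i k X Y g"
    and S: "S \<subseteq> carrier X" "g ` S \<subseteq> H" and H: "submodule H K Y"
  shows "g ` lin_span k X S \<subseteq> H"
proof -
  interpret X: vec_space k X by fact
  have "lin_span k X S \<subseteq> {x \<in> carrier X. g x \<in> H}"
    using S by (intro X.span_least submodule_preimage[OF assms(1-4) _ H] X.carrier_is_submodule) auto
  thus ?thesis by blast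
qed

lemma submodule_image:
  assumes "vec_space k X" "vec_space k Y" "linear_map k X Y g" and T: "submodule T k X"
  shows "submodule (g ` T) k Y"
proof -
  interpret X: vec_space k X by fact
  interpret Y: vec_space k Y by fact
  note D = semilinearD[OF assms(3)]
  note c = subsetD[OF X.sub_carrier[OF T]]
  show ?thesis
    unfolding Y.submodule_iff
  proof (intro conjI ballI)
    show "g ` T \<subseteq> carrier Y" using D(1) c by blast
    show "\<zero>\<^bsub>Y\<^esub> \<in> g ` T" using X.sub_zero[OF T] semilinear_zero[OF assms(1-3)] by (metis imageI)
    fix x assume "x \<in> g ` T"
    then obtain x' where x: "x = g x'" "x' \<in> T" by blast
    { fix y assume "y \<in> g ` T"
      then obtain y' where "y = g y'" "y' \<in> T" by blast
      with x show "x \<oplus>\<^bsub>Y\<^esub> y \<in> g ` T" using D(2)[of x' y'] c X.sub_add[OF T, of x' y'] by (metis imageI) }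
    fix d assume "d \<in> carrier k"
    with x show "d \<odot>\<^bsub>Y\<^esub> x \<in> g ` T" using D(3)[of d x'] c X.sub_smult[OF T, of d x'] by (metis imageI)
  qed
qed

text \<open>Apply \<open>semilinear_span\<close> twice: first in \<open>y\<close> with a generator
  \<open>p\<close> fixed, then in \<open>x\<close> with the given \<open>y\<close> fixed.\<close>

lemma bilinear_span:
  assumes vs: "vec_space k X" "vec_space k Y" "vec_space k Z"
    and l: "\<And>y. y \<in> carrier Y \<Longrightarrow> linear_map k X Z (\<lambda>x. \<beta> x y)"
    and r: "\<And>x. x \<in> carrier X \<Longrightarrow> linear_map k Y Z (\<lambda>y. \<beta> x y)"
    and P: "P \<subseteq> carrier X" and Q: "Q \<subseteq> carrier Y"
    and H: "submodule H k Z" "\<And>p q. \<lbrakk>p \<in> P; q \<in> Q\<rbrakk> \<Longrightarrow> \<beta> p q \<in> H"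
    and xy: "x \<in> lin_span k X P" "y \<in> lin_span k Y Q"
  shows "\<beta> x y \<in> H"
proof -
  interpret Y: vec_space k Y by fact
  have 1: "\<beta> p y \<in> H" if "p \<in> P" for p
    using semilinear_span[OF vs(2,3) _ r[of p] Q _ H(1)] that P H(2) xy(2) by blast
  have "y \<in> carrier Y" using Y.span_carrier[OF Q] xy(2) by blast
  thus ?thesis using semilinear_span[OF vs(1,3) _ l[of y] P _ H(1)] 1 xy(1) by blast
qed

text \<open>
  The \<open>f \<in> F\<close> are the coordinate functionals of \<open>Y\<close>. On the span of at most \<open>e\<close> vectors, at
  most \<open>e\<close> of them suffice to separate points, and each takes values in the span of \<open>A\<close> on \<open>g ` T\<close>;
  the induction splits off one functional at a time.
\<close>

lemma span_dimension_transfer: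
  assumes X: "vec_space k X" and Z: "vec_space k Z" and Y: "vec_space K Y"
    and i: "i \<in> ring_hom k K"
    and g: "semilinear i k X Y g" and h: "linear_map k X Z h"
    and gh: "\<And>x. \<lbrakk>x \<in> carrier X; g x = \<zero>\<^bsub>Y\<^esub>\<rbrakk> \<Longrightarrow> h x = \<zero>\<^bsub>Z\<^esub>"
    and F: "\<And>f. f \<in> F \<Longrightarrow> linear_map K Y (ext_space (\<lambda>c. c) K) f"
    and sep: "\<And>y. \<lbrakk>y \<in> carrier Y; y \<noteq> \<zero>\<^bsub>Y\<^esub>\<rbrakk> \<Longrightarrow> \<exists>f\<in>F. f y \<noteq> \<zero>\<^bsub>K\<^esub>"
    and A: "finite A" "A \<subseteq> carrier K"
    and FA: "\<And>f x. \<lbrakk>f \<in> F; x \<in> carrier X\<rbrakk> \<Longrightarrow> f (g x) \<in> lin_span k (ext_space i K) A"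
    and T: "submodule T k X" and S: "finite S" "S \<subseteq> carrier Y" "g ` T \<subseteq> lin_span K Y S"
  shows "\<exists>D. finite D \<and> D \<subseteq> carrier Z \<and> card D \<le> card A * card S \<and> h ` T \<subseteq> lin_span k Z D"
  using T S
proof (induction "card S" arbitrary: T S rule: less_induct)
  case less
  note T = less.prems(1) and S = less.prems(2-4)
  interpret X: vec_space k X by fact
  interpret Z: vec_space k Z by fact
  interpret Y: vec_space K Y by fact
  have kK: "field k" "field K" using X Y by (simp_all add: vec_space_def)
  have E: "vec_space k (ext_space i K)" by (rule vec_space_ext[OF kK i])
  have KK: "vec_space K (ext_space (\<lambda>c. c) K)" by (rule vec_space_ext_self[OF kK(2)])
  interpret E: vec_space k "ext_space i K" by (rule E)
  interpret KK: vec_space K "ext_space (\<lambda>c. c) K" by (rule KK)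
  have ic: "i \<in> carrier k \<rightarrow> carrier K" using i by (auto simp: ring_hom_def)
  note Tc = subsetD[OF X.sub_carrier[OF T]]
  note Dg = semilinearD[OF g] and Dh = semilinearD[OF h]
  show ?case
  proof (cases "\<forall>x\<in>T. g x = \<zero>\<^bsub>Y\<^esub>")
    case True
    hence "h ` T \<subseteq> lin_span k Z {}" using gh Tc by (auto simp: Z.span_empty)
    thus ?thesis by (intro exI[of _ "{}"]) auto
  next
    case False
    then obtain x0 where x0: "x0 \<in> T" "g x0 \<noteq> \<zero>\<^bsub>Y\<^esub>" by blast
    with sep Dg(1) Tc obtain f where f: "f \<in> F" "f (g x0) \<noteq> \<zero>\<^bsub>K\<^esub>" by meson
    note Df = semilinearD[OF F[OF f(1)]]
    have z1: "submodule {\<zero>\<^bsub>K\<^esub>} K (ext_space (\<lambda>c. c) K)" "submodule {\<zero>\<^bsub>K\<^esub>} k (ext_space i K)"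
      using KK.span_empty KK.span_submodule[of "{}"] E.span_empty E.span_submodule[of "{}"] by simp_all
    \<comment> \<open>The hyperplane \<open>f = 0\<close> in the span of \<open>S\<close>. It misses
      \<open>g x0\<close>, so a basis of it has fewer than \<open>card S\<close> elements, and the
      induction hypothesis covers the part of \<open>T\<close> lying over it.\<close>
    let ?Y = "{y \<in> lin_span K Y S. f y \<in> {\<zero>\<^bsub>K\<^esub>}}"
    have sS: "submodule (lin_span K Y S) K Y" using Y.span_submodule S by blast
    have sY: "submodule ?Y K Y"
      using submodule_preimage[OF Y KK _ F[OF f(1)] sS z1(1)] by simp
    have "?Y \<subseteq> lin_span K Y S" by blast
    from Y.basis_exists[OF sY S(1,2) this] obtain B where B: "finite B" "is_basis K Y ?Y B" by metis
    have BY: "lin_span K Y B = ?Y" "Y.indep B" using B(2) Y.is_basis_indep[OF sY] by (auto simp: is_basis_def)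
    have gx0: "g x0 \<in> lin_span K Y S" using x0 S by blast
    have nB: "g x0 \<notin> lin_span K Y B" using f(2) by (simp add: BY)
    have iB: "Y.indep (insert (g x0) B)" using Y.indep_insert[OF BY(2) _ nB] Dg(1) Tc x0 by blast
    have "B \<subseteq> ?Y" using B by (simp add: is_basis_def)
    hence "insert (g x0) B \<subseteq> lin_span K Y S" using gx0 by blast
    from Y.indep_card_le(2)[OF iB S(1,2) this] B(1) nB
    have cB: "card B < card S" using Y.span_superset[of B] by (subst (asm) card_insert_disjoint) auto
    let ?fg = "\<lambda>x. f (g x)"
    have fg: "linear_map k X (ext_space i K) ?fg"
    proof (rule semilinearI)
      fix c x assume "c \<in> carrier k" "x \<in> carrier X"
      thus "f (g (c \<odot>\<^bsub>X\<^esub> x)) = c \<odot>\<^bsub>ext_space i K\<^esub> f (g x)"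
        using Dg(1,3) Df(3) ic by (simp add: Pi_iff)
    qed (use Dg(1,2) Df(1,2) in simp_all)
    let ?T = "{x \<in> T. ?fg x \<in> {\<zero>\<^bsub>K\<^esub>}}"
    have sT: "submodule ?T k X" using submodule_preimage[OF X E _ fg T z1(2)] by simp
    have "g ` ?T \<subseteq> lin_span K Y B" using S(3) unfolding BY by auto
    with less.hyps[OF cB sT B(1)] BY(2) obtain D where D: "finite D" "D \<subseteq> carrier Z"
      "card D \<le> card A * card B" "h ` ?T \<subseteq> lin_span k Z D" unfolding Y.indep_def by blast
    have sI: "submodule (?fg ` T) k (ext_space i K)" by (rule submodule_image[OF X E fg T])
    have "?fg ` T \<subseteq> lin_span k (ext_space i K) A" using FA[OF f(1)] Tc by blast
    from E.basis_exists[OF sI A(1) _ this] A(2) obtain C where C: "finite C"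
      "is_basis k (ext_space i K) (?fg ` T) C" "card C \<le> card A" by auto
    hence "C \<subseteq> ?fg ` T" by (simp add: is_basis_def)
    \<comment> \<open>Lift a \<open>k\<close>-basis of the values taken by \<open>f\<close> on the
      image of \<open>T\<close>. These values lie in the span of \<open>A\<close>, so at most
      \<open>card A\<close> vectors are needed.\<close>
    then obtain L where L: "L \<subseteq> T" "inj_on ?fg L" "?fg ` L = C"
      by (metis subset_image_inj)
    have Lc: "card L = card C" "finite L" using L C(1) card_image finite_imageD by metis+
    let ?D = "D \<union> h ` L"
    have Dc: "?D \<subseteq> carrier Z" using D L Dh(1) Tc by blast
    note sD = Z.span_submodule[OF Dc]
    have "card ?D \<le> card D + card L"
      using card_Un_le[of D "h ` L"] card_image_le[OF Lc(2), of h] by linarith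
    \<comment> \<open>Each of the \<open>card B\<close> directions of the hyperplane costs
      \<open>card A\<close>, and splitting off \<open>f\<close> costs \<open>card A\<close> once
      more.\<close>
    also have "\<dots> \<le> card A * Suc (card B)" using D C Lc by simp
    also have "\<dots> \<le> card A * card S" using cB by (intro mult_le_mono2) simp
    finally have "card ?D \<le> card A * card S" .
    moreover have "h ` T \<subseteq> lin_span k Z ?D"
    proof
      fix z assume "z \<in> h ` T"
      then obtain x where x: "x \<in> T" "z = h x" by blast
      \<comment> \<open>\<open>?U\<close> is a subspace whose values under \<open>f\<close> contain
        the basis \<open>C\<close>, hence all values on \<open>T\<close>. So \<open>x\<close> agrees
        with some \<open>u\<close> in \<open>?U\<close> up to an element of \<open>?T\<close>, which
        \<open>D\<close> already handles.\<close>
      let ?U = "{x \<in> T. h x \<in> lin_span k Z ?D}"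
      have sU: "submodule ?U k X" using submodule_preimage[OF X Z _ h T sD] by simp
      have "C \<subseteq> ?fg ` ?U"
        using L Z.span_superset[of ?D] by blast
      hence "lin_span k (ext_space i K) C \<subseteq> ?fg ` ?U"
        by (rule E.span_least[OF submodule_image[OF X E fg sU]])
      hence "?fg x \<in> ?fg ` ?U" using C(2) x(1) unfolding is_basis_def by blast
      then obtain u where u: "u \<in> T" "h u \<in> lin_span k Z ?D" "?fg x = ?fg u" by blast
      have xu: "x \<in> carrier X" "u \<in> carrier X" using x u Tc by auto
      have "?fg (x \<ominus>\<^bsub>X\<^esub> u) = ?fg u \<ominus>\<^bsub>ext_space i K\<^esub> ?fg u"
        using semilinear_diff[OF X E fg xu] u(3) by simp
      also have "\<dots> = \<zero>\<^bsub>ext_space i K\<^esub>"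
        using semilinearD(1)[OF fg xu(2)] E.M.r_neg by (simp only: a_minus_def)
      finally have "x \<ominus>\<^bsub>X\<^esub> u \<in> ?T" using X.sub_diff[OF T x(1) u(1)] by simp
      hence "h (x \<ominus>\<^bsub>X\<^esub> u) \<in> lin_span k Z ?D" using D(4) Z.span_mono[of D ?D] by blast
      hence "h x \<ominus>\<^bsub>Z\<^esub> h u \<in> lin_span k Z ?D" using semilinear_diff[OF X Z h xu] by simp
      from Z.sub_add[OF sD this u(2)] have "h x \<in> lin_span k Z ?D"
        using Dh(1) xu by (simp add: a_minus_def Z.M.a_assoc Z.M.l_neg)
      thus "z \<in> lin_span k Z ?D" using x by simp
    qed
    ultimately show ?thesis using D(1) Lc(2) Dc by (intro exI[of _ ?D]) simp
  qed
qed

section \<open>Growth and submodules\<close>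

text \<open>The spans of finite subsets of \<open>S\<close> form a directed union, which is
  therefore a subspace containing \<open>S\<close>.\<close>

lemma (in vec_space) span_finite_subset:
  assumes S: "S \<subseteq> carrier X" and W: "finite W" "W \<subseteq> lin_span k X S"
  obtains T where "finite T" "T \<subseteq> S" "W \<subseteq> lin_span k X T"
proof -
  let ?H = "{y. \<exists>T. finite T \<and> T \<subseteq> S \<and> y \<in> lin_span k X T}"
  have sm: "submodule (lin_span k X T) k X" if "T \<subseteq> S" for T using span_submodule that S by blast
  have "submodule ?H k X"
    unfolding submodule_iff
  proof (intro conjI ballI)
    show "?H \<subseteq> carrier X" using sub_carrier[OF sm] by blast
    show "\<zero>\<^bsub>X\<^esub> \<in> ?H" using sub_zero[OF sm, of "{}"] by blast
    fix x assume "x \<in> ?H"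
    then obtain T where T: "finite T" "T \<subseteq> S" "x \<in> lin_span k X T" by blast
    { fix y assume "y \<in> ?H"
      then obtain T' where T': "finite T'" "T' \<subseteq> S" "y \<in> lin_span k X T'" by blast
      have "x \<oplus>\<^bsub>X\<^esub> y \<in> lin_span k X (T \<union> T')"
        using T T' span_mono[of T "T \<union> T'"] span_mono[of T' "T \<union> T'"] by (intro sub_add[OF sm]) auto
      thus "x \<oplus>\<^bsub>X\<^esub> y \<in> ?H" using T T' by (auto intro!: exI[of _ "T \<union> T'"]) }
    fix c assume "c \<in> carrier k"
    thus "c \<odot>\<^bsub>X\<^esub> x \<in> ?H" using T sub_smult[OF sm[OF T(2)]] by blast
  qed
  moreover have "S \<subseteq> ?H"
  proof
    fix s assume "s \<in> S"
    thus "s \<in> ?H" using span_superset[of "{s}"] by (auto intro!: exI[of _ "{s}"])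
  qed
  ultimately have "lin_span k X S \<subseteq> ?H" by (rule span_least)
  hence "\<forall>y\<in>W. \<exists>T. finite T \<and> T \<subseteq> S \<and> y \<in> lin_span k X T" using W(2) by blast
  from bchoice[OF this] obtain T where
    T: "\<And>y. y \<in> W \<Longrightarrow> finite (T y) \<and> T y \<subseteq> S \<and> y \<in> lin_span k X (T y)" by blast
  show ?thesis
  proof (rule that)
    show "finite (\<Union>(T ` W))" "\<Union>(T ` W) \<subseteq> S" using T W(1) by blast+
    show "W \<subseteq> lin_span k X (\<Union>(T ` W))"
    proof
      fix y assume y: "y \<in> W"
      hence "T y \<subseteq> \<Union>(T ` W)" by blast
      from span_mono[OF this] T[OF y] show "y \<in> lin_span k X (\<Union>(T ` W))" by blast
    qed
  qed
qed

lemma (in vec_space) submodule_carrier_update: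
  assumes N: "submodule N k X"
  shows "vec_space k (X\<lparr>carrier := N\<rparr>)"
    and "submodule H k (X\<lparr>carrier := N\<rparr>) \<longleftrightarrow> submodule H k X \<and> H \<subseteq> N"
proof -
  have m: "module k (X\<lparr>carrier := N\<rparr>)" by (rule submodule.submodule_is_module[OF N]) unfold_locales
  thus "vec_space k (X\<lparr>carrier := N\<rparr>)" by (simp add: vec_space_def field_axioms)
  show "submodule H k (X\<lparr>carrier := N\<rparr>) \<longleftrightarrow> submodule H k X \<and> H \<subseteq> N"
    unfolding module.submodule_iff[OF m] submodule_iff using sub_carrier[OF N] by auto
qed

text \<open>\<open>gkdim\<close> of a submodule is taken on a record with replaced carrier. This and
  the next lemma return its spans and bases to the ambient space.\<close>

lemma (in vec_space) span_carrier_update: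
  assumes N: "submodule N k X" and S: "S \<subseteq> N"
  shows "lin_span k (X\<lparr>carrier := N\<rparr>) S = lin_span k X S"
proof
  interpret N: vec_space k "X\<lparr>carrier := N\<rparr>" by (rule submodule_carrier_update[OF N])
  have Sc: "S \<subseteq> carrier X" using S sub_carrier[OF N] by blast
  have "submodule (lin_span k X S) k (X\<lparr>carrier := N\<rparr>)"
    using span_submodule[OF Sc] span_least[OF N S] submodule_carrier_update(2)[OF N] by blast
  thus "lin_span k (X\<lparr>carrier := N\<rparr>) S \<subseteq> lin_span k X S" by (rule N.span_least[OF _ span_superset])
  have "submodule (lin_span k (X\<lparr>carrier := N\<rparr>) S) k X"
    using N.span_submodule[of S] S submodule_carrier_update(2)[OF N] by simp
  thus "lin_span k X S \<subseteq> lin_span k (X\<lparr>carrier := N\<rparr>) S" by (rule span_least[OF _ N.span_superset])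
qed

lemma (in vec_space) is_basis_carrier_update:
  assumes N: "submodule N k X" and U: "U \<subseteq> N"
  shows "is_basis k (X\<lparr>carrier := N\<rparr>) U = is_basis k X U"
proof
  fix B
  have "lin_span k (X\<lparr>carrier := N\<rparr>) C = lin_span k X C" if "B \<subseteq> U" "C \<subseteq> B" for C
    using span_carrier_update[OF N, of C] that U by blast
  thus "is_basis k (X\<lparr>carrier := N\<rparr>) U B = is_basis k X U B"
    unfolding is_basis_def by (metis Diff_subset order_refl)
qed

text \<open>
  The locale \<^locale>\<open>module\<close> requires a commutative ring of scalars, so \<open>module.submodule_iff\<close> does
  not apply to right modules.
\<close>

lemma submodule_facts:
  assumes "submodule N R M"
  shows "N \<subseteq> carrier M" "\<zero>\<^bsub>M\<^esub> \<in> N" "\<lbrakk>x \<in> N; y \<in> N\<rbrakk> \<Longrightarrow> x \<oplus>\<^bsub>M\<^esub> y \<in> N"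
    "x \<in> N \<Longrightarrow> \<ominus>\<^bsub>M\<^esub> x \<in> N" "\<lbrakk>r \<in> carrier R; x \<in> N\<rbrakk> \<Longrightarrow> r \<odot>\<^bsub>M\<^esub> x \<in> N"
proof -
  interpret submodule N R M by fact
  show "N \<subseteq> carrier M" "\<zero>\<^bsub>M\<^esub> \<in> N" "\<lbrakk>x \<in> N; y \<in> N\<rbrakk> \<Longrightarrow> x \<oplus>\<^bsub>M\<^esub> y \<in> N"
    "x \<in> N \<Longrightarrow> \<ominus>\<^bsub>M\<^esub> x \<in> N" "\<lbrakk>r \<in> carrier R; x \<in> N\<rbrakk> \<Longrightarrow> r \<odot>\<^bsub>M\<^esub> x \<in> N"
    using subset one_closed m_closed m_inv_closed smult_closed by (auto simp: a_inv_def)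
qed

text \<open>The action of \<open>- 1\<close> supplies negatives, once additivity has shown that
  \<open>0\<close> annihilates \<open>M\<close>.\<close>

lemma (in right_module) submoduleI:
  assumes "H \<subseteq> carrier M" "\<zero>\<^bsub>M\<^esub> \<in> H"
    and "\<And>x y. \<lbrakk>x \<in> H; y \<in> H\<rbrakk> \<Longrightarrow> x \<oplus>\<^bsub>M\<^esub> y \<in> H"
    and "\<And>r x. \<lbrakk>r \<in> carrier R; x \<in> H\<rbrakk> \<Longrightarrow> r \<odot>\<^bsub>M\<^esub> x \<in> H"
  shows "submodule H R M"
proof (intro submodule.intro subgroup.intro submodule_axioms.intro)
  fix x assume x: "x \<in> H"
  hence xc: "x \<in> carrier M" using assms(1) by blast
  have "(\<ominus>\<^bsub>R\<^esub> \<one>\<^bsub>R\<^esub>) \<odot>\<^bsub>M\<^esub> x \<oplus>\<^bsub>M\<^esub> x = ((\<ominus>\<^bsub>R\<^esub> \<one>\<^bsub>R\<^esub>) \<oplus>\<^bsub>R\<^esub> \<one>\<^bsub>R\<^esub>) \<odot>\<^bsub>M\<^esub> x"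
    using xc by (simp add: ract_add_scalar ract_one)
  also have "\<dots> = \<zero>\<^bsub>R\<^esub> \<odot>\<^bsub>M\<^esub> x" by (simp add: A.M.l_neg)
  also have "\<zero>\<^bsub>R\<^esub> \<odot>\<^bsub>M\<^esub> x = \<zero>\<^bsub>M\<^esub>"
    using ract_add_scalar[of "\<zero>\<^bsub>R\<^esub>" "\<zero>\<^bsub>R\<^esub>" x] ract_closed[of "\<zero>\<^bsub>R\<^esub>" x] xc
    by (metis A.M.zero_closed A.M.l_zero M.add.r_cancel_one')
  finally have "(\<ominus>\<^bsub>R\<^esub> \<one>\<^bsub>R\<^esub>) \<odot>\<^bsub>M\<^esub> x = \<ominus>\<^bsub>M\<^esub> x"
    using xc ract_closed by (metis A.M.a_inv_closed A.one_closed M.minus_equality)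
  moreover have "(\<ominus>\<^bsub>R\<^esub> \<one>\<^bsub>R\<^esub>) \<odot>\<^bsub>M\<^esub> x \<in> H" by (rule assms(4)) (use x in auto)
  ultimately show "inv\<^bsub>add_monoid M\<^esub> x \<in> H" by (simp add: a_inv_def)
qed (use assms in auto)

lemma submodule_restrict_scalars:
  fixes k :: "'k ring" and R :: "('k, 'r) module" and M :: "('r, 'm) module"
  assumes "field k" "right_module k R M" "submodule N R M"
  shows "submodule N k (restrict_scalars R M)"
    and "restrict_scalars R (M\<lparr>carrier := N\<rparr>) = (restrict_scalars R M)\<lparr>carrier := N\<rparr>"
proof -
  interpret right_module k R M by fact
  interpret X: vec_space k "restrict_scalars R M" by (rule vec_space_restrict_scalars[OF assms(1,2)])
  show "submodule N k (restrict_scalars R M)"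
    unfolding X.submodule_iff using submodule_facts[OF assms(3)] by auto
qed (simp add: restrict_scalars_def)

section \<open>Finite-dimensionality of \<open>V^n\<close> and \<open>W V^n\<close>\<close>

lemma mult_linear:
  assumes "nc_algebra k R" "x \<in> carrier R"
  shows "linear_map k R R (\<lambda>y. y \<otimes>\<^bsub>R\<^esub> x)" "linear_map k R R (\<lambda>y. x \<otimes>\<^bsub>R\<^esub> y)"
proof -
  interpret nc_algebra k R by fact
  show "linear_map k R R (\<lambda>y. y \<otimes>\<^bsub>R\<^esub> x)" "linear_map k R R (\<lambda>y. x \<otimes>\<^bsub>R\<^esub> y)"
    using assms(2) by (auto intro!: semilinearI simp: l_distr r_distr smult_mult_left smult_mult_right)
qed

lemma act_linear:
  assumes "right_module k R M"
  shows "x \<in> carrier M \<Longrightarrow> linear_map k R (restrict_scalars R M) (\<lambda>r. r \<odot>\<^bsub>M\<^esub> x)"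
    and "r \<in> carrier R \<Longrightarrow> linear_map k (restrict_scalars R M) (restrict_scalars R M) (\<lambda>x. r \<odot>\<^bsub>M\<^esub> x)"
proof -
  interpret right_module k R M by fact
  show "x \<in> carrier M \<Longrightarrow> linear_map k R (restrict_scalars R M) (\<lambda>r. r \<odot>\<^bsub>M\<^esub> x)"
    by (auto intro!: semilinearI simp: ract_closed ract_add_scalar restrict_scalars_act(2))
  show "r \<in> carrier R \<Longrightarrow> linear_map k (restrict_scalars R M) (restrict_scalars R M) (\<lambda>x. r \<odot>\<^bsub>M\<^esub> x)"
    by (auto intro!: semilinearI simp: ract_closed ract_add restrict_scalars_act(1))
qed

text \<open>The products of finitely many generators span all products. This serves both the powers
  of \<open>V\<close> and their action on \<open>W\<close>.\<close>

lemma fin_dim_bilinear: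
  assumes vs: "vec_space k X" "vec_space k Y" "vec_space k Z"
    and l: "\<And>y. y \<in> carrier Y \<Longrightarrow> linear_map k X Z (\<lambda>x. \<beta> x y)"
    and r: "\<And>x. x \<in> carrier X \<Longrightarrow> linear_map k Y Z (\<lambda>y. \<beta> x y)"
    and U: "fin_dim_subspace k X U" and V: "fin_dim_subspace k Y V"
  shows "fin_dim_subspace k Z (lin_span k Z {\<beta> u v | u v. u \<in> U \<and> v \<in> V})"
proof -
  interpret X: vec_space k X by fact
  interpret Y: vec_space k Y by fact
  interpret Z: vec_space k Z by fact
  obtain P where P: "finite P" "P \<subseteq> carrier X" "U = lin_span k X P" using X.fin_dimE[OF U] .
  obtain Q where Q: "finite Q" "Q \<subseteq> carrier Y" "V = lin_span k Y Q" using Y.fin_dimE[OF V] .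
  let ?S = "{\<beta> u v | u v. u \<in> U \<and> v \<in> V}" and ?T = "(\<lambda>(p, q). \<beta> p q) ` (P \<times> Q)"
  have "\<beta> p q \<in> carrier Z" if "p \<in> P" "q \<in> Q" for p q
    using semilinearD(1)[OF l[of q], of p] that P(2) Q(2) by blast
  hence T: "?T \<subseteq> carrier Z" by auto
  have "?S \<subseteq> lin_span k Z ?T"
  proof clarify
    fix u v assume "u \<in> U" "v \<in> V"
    moreover have "\<beta> p q \<in> lin_span k Z ?T" if "p \<in> P" "q \<in> Q" for p q
      using Z.span_superset[of ?T] that by auto
    ultimately show "\<beta> u v \<in> lin_span k Z ?T"
      using bilinear_span[OF vs l r P(2) Q(2) Z.span_submodule[OF T]] unfolding P(3) Q(3) by simp
  qed
  moreover have "?T \<subseteq> ?S" unfolding P(3) Q(3) using X.span_superset[of P] Y.span_superset[of Q] by fast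
  ultimately have "lin_span k Z ?S = lin_span k Z ?T"
    by (intro equalityI Z.span_subset[OF T] Z.span_mono)
  thus ?thesis using Z.fin_dim_span[OF _ T] P Q by simp
qed

lemma subspace_power_fin_dim:
  assumes "field k" "nc_algebra k R" "fin_dim_subspace k R V"
  shows "fin_dim_subspace k R (subspace_power k R V n)"
proof (induction n)
  interpret nc_algebra k R by fact
  interpret vec_space k R by (rule vec_space_algebra[OF assms(1,2)])
  note vs = vec_space_algebra[OF assms(1,2)]
  case 0 show ?case using fin_dim_span[of "{\<one>\<^bsub>R\<^esub>}"] by simp
  case (Suc n) thus ?case
    using fin_dim_bilinear[OF vs vs vs mult_linear[OF assms(2)] Suc assms(3)] by simp
qed

lemma subspace_act_fin_dim:
  assumes "field k" "right_module k R M" "fin_dim_subspace k (restrict_scalars R M) W" "fin_dim_subspace k R U"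
  shows "fin_dim_subspace k (restrict_scalars R M) (subspace_act k R M W U)"
proof -
  interpret right_module k R M by fact
  note vs = vec_space_algebra[OF assms(1) A.nc_algebra_axioms] vec_space_restrict_scalars[OF assms(1,2)]
  show ?thesis unfolding subspace_act_def
    using fin_dim_bilinear[OF vs(1,2,2) act_linear(1,2)[OF assms(2)] assms(4,3)] by simp
qed

lemma fin_dim_subspaceD: "fin_dim_subspace k X U \<Longrightarrow> submodule U k X"
  by (simp add: fin_dim_subspace_def)

section \<open>Growth functions and their logarithmic order\<close>

definition growth ::
  "'k ring \<Rightarrow> ('k, 'r) module \<Rightarrow> ('r, 'm) module \<Rightarrow> 'm set \<Rightarrow> 'r set \<Rightarrow> nat \<Rightarrow> nat" where
  "growth k R M W V n =
     subspace_dim k (restrict_scalars R M) (subspace_act k R M W (subspace_power k R V n))"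

text \<open>\<open>N\<close> is stable under the action, so \<open>W V^n\<close> stays inside
  \<open>N\<close> and has the same dimension in \<open>N\<close> and in \<open>M\<close>. All
  growth functions are thereby taken in one ambient module.\<close>

lemma gkdim_submodule:
  assumes "field k" "right_module k R M" "submodule N R M" "N \<noteq> {\<zero>\<^bsub>M\<^esub>}"
  shows "gkdim k R (M\<lparr>carrier := N\<rparr>) =
    (SUP (W, V) \<in> {(W, V). fin_dim_subspace k (restrict_scalars R M) W \<and> W \<subseteq> N \<and> fin_dim_subspace k R V}.
       limsup (\<lambda>n. ext_log n (growth k R M W V n)))"
proof -
  interpret right_module k R M by fact
  interpret X: vec_space k "restrict_scalars R M" by (rule vec_space_restrict_scalars[OF assms(1,2)])
  note N = submodule_restrict_scalars(1)[OF assms(1-3)] and eq = submodule_restrict_scalars(2)[OF assms(1-3)]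
  note facts = submodule_facts[OF assms(3)]
  have fd: "fin_dim_subspace k (restrict_scalars R (M\<lparr>carrier := N\<rparr>)) W \<longleftrightarrow>
      fin_dim_subspace k (restrict_scalars R M) W \<and> W \<subseteq> N" for W
    unfolding fin_dim_subspace_def eq X.submodule_carrier_update(2)[OF N]
    using X.is_basis_carrier_update[OF N] by auto
  have gr: "growth k R (M\<lparr>carrier := N\<rparr>) W V n = growth k R M W V n"
    if "W \<subseteq> N" "fin_dim_subspace k R V" for W V n
  proof -
    have U: "subspace_power k R V n \<subseteq> carrier R"
      using subspace_power_fin_dim[OF assms(1) A.nc_algebra_axioms that(2)] submodule_facts(1) fin_dim_subspaceD by blast
    let ?S = "{u \<odot>\<^bsub>M\<^esub> w |u w. u \<in> subspace_power k R V n \<and> w \<in> W}"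
    have S: "?S \<subseteq> N" using that U facts(5) by blast
    have "subspace_act k R (M\<lparr>carrier := N\<rparr>) W (subspace_power k R V n)
        = subspace_act k R M W (subspace_power k R V n)"
      unfolding subspace_act_def eq using X.span_carrier_update[OF N S] by simp
    moreover have "subspace_act k R M W (subspace_power k R V n) \<subseteq> N"
      unfolding subspace_act_def by (rule X.span_least[OF N S])
    ultimately show ?thesis
      unfolding growth_def subspace_dim_def eq using X.is_basis_carrier_update[OF N] by simp
  qed
  show ?thesis
    unfolding gkdim_def growth_def[symmetric] fd
    by (simp add: assms(4), rule SUP_cong[OF refl]) (clarsimp simp: gr)
qed

text \<open>A constant factor adds \<open>log_n m\<close> to the logarithm, and this tends to
  0.\<close>

lemma limsup_ext_log_le:
  assumes ab: "\<And>n. a n \<le> m * b n"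
  shows "limsup (\<lambda>n. ext_log n (a n)) \<le> limsup (\<lambda>n. ext_log n (b n))"
  unfolding Limsup_le_iff
proof (intro allI impI)
  fix y assume "limsup (\<lambda>n. ext_log n (b n)) < y"
  \<comment> \<open>Two reals \<open>s < t\<close> fit between the limsup and \<open>y\<close>; the
    gap \<open>t - s\<close> absorbs the contribution of the constant factor.\<close>
  then obtain s where s: "limsup (\<lambda>n. ext_log n (b n)) < ereal s" "ereal s < y"
    using ereal_dense2 by blast
  obtain t where t: "ereal s < ereal t" "ereal t < y" using ereal_dense2[OF s(2)] by blast
  \<comment> \<open>\<open>Suc m\<close> in place of \<open>m\<close> keeps the argument of the
    logarithm positive when \<open>m = 0\<close>.\<close>
  have "(\<lambda>n. ln (real (Suc m)) / ln (real n)) \<longlonglongrightarrow> 0"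
    by (intro tendsto_divide_0[OF tendsto_const] filterlim_at_top_imp_at_infinity
        filterlim_compose[OF ln_at_top] filterlim_real_sequentially)
  hence "eventually (\<lambda>n. ln (real (Suc m)) / ln (real n) < t - s) sequentially"
    using t by (intro order_tendstoD(2)) auto
  moreover have "eventually (\<lambda>n. ext_log n (b n) < ereal s) sequentially"
    by (rule Limsup_lessD[OF s(1)])
  \<comment> \<open>From \<open>n = 2\<close> on, the base exceeds 1 and the logarithm is
    increasing.\<close>
  ultimately show "eventually (\<lambda>n. ext_log n (a n) < y) sequentially"
    using eventually_ge_at_top[of 2]
  proof eventually_elim
    case (elim n)
    show ?case
    proof (cases "a n = 0")
      case True
      have "- \<infinity> < y" using t(2) by (rule less_trans[rotated]) simp
      thus ?thesis using True by (simp add: ext_log_def)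
    next
      case False
      hence b: "b n > 0" using ab[of n] by (auto intro: gr0I)
      have "a n \<le> Suc m * b n" using ab[of n] by simp
      hence m: "real (a n) \<le> real (Suc m) * real (b n)" by (metis of_nat_le_iff of_nat_mult)
      have "log n (a n) \<le> log n (real (Suc m) * real (b n))"
        using elim b m False by (subst log_le_cancel_iff) auto
      also have "\<dots> = ln (real (Suc m)) / ln (real n) + log n (b n)"
        using b by (subst log_mult) (auto simp: log_def)
      also have "\<dots> < t" using elim b by (simp add: ext_log_def)
      finally have "ereal (log n (a n)) < ereal t" by simp
      from less_trans[OF this t(2)] show ?thesis using False by (simp add: ext_log_def)
    qed
  qed
qed

section \<open>Bounds under extension of scalars\<close>

text \<open>Separates the growth estimates from the tensor construction: the locale fixes only a
  homomorphism \<open>j\<close> of algebras over \<open>i\<close>, and the relation between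
  \<open>M\<close> and \<open>M'\<close> enters through the hypotheses of \<open>gkdim_le\<close>
  and \<open>le_gkdim\<close>.\<close>

locale scalar_extension = k: field k + K: field K + M: right_module k R M + M': right_module K R' M'
  for k :: "'k ring" and K :: "'c ring" and R :: "('k, 'r) module" and M :: "('r, 'm) module"
    and R' :: "('c, 's) module" and M' :: "('s, 'n) module" +
  fixes i :: "'k \<Rightarrow> 'c" and j :: "'r \<Rightarrow> 's"
  assumes i: "i \<in> ring_hom k K"
    and j: "semilinear i k R R' j"
    and j_mult: "\<lbrakk>r \<in> carrier R; s \<in> carrier R\<rbrakk> \<Longrightarrow> j (r \<otimes>\<^bsub>R\<^esub> s) = j r \<otimes>\<^bsub>R'\<^esub> j s"
    and j_one: "j \<one>\<^bsub>R\<^esub> = \<one>\<^bsub>R'\<^esub>"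
begin

abbreviation "Mk \<equiv> restrict_scalars R M"
abbreviation "MK \<equiv> restrict_scalars R' M'"

sublocale Rk: vec_space k R
  by (rule vec_space_algebra[OF k.field_axioms M.A.nc_algebra_axioms])
sublocale RK: vec_space K R'
  by (rule vec_space_algebra[OF K.field_axioms M'.A.nc_algebra_axioms])
sublocale Mk: vec_space k Mk
  by (rule vec_space_restrict_scalars[OF k.field_axioms M.right_module_axioms])
sublocale MK: vec_space K MK
  by (rule vec_space_restrict_scalars[OF K.field_axioms M'.right_module_axioms])

lemma ic: "i \<in> carrier k \<rightarrow> carrier K"
  using i by (auto simp: ring_hom_def)

lemma power_fin: "fin_dim_subspace k R V \<Longrightarrow> fin_dim_subspace k R (subspace_power k R V n)"
  by (rule subspace_power_fin_dim[OF k.field_axioms M.A.nc_algebra_axioms])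

lemma power_fin': "fin_dim_subspace K R' V' \<Longrightarrow> fin_dim_subspace K R' (subspace_power K R' V' n)"
  by (rule subspace_power_fin_dim[OF K.field_axioms M'.A.nc_algebra_axioms])

section \<open>Powers of a subspace under scalar extension\<close>

lemma image_power_subset:
  assumes V: "fin_dim_subspace k R V" and V': "fin_dim_subspace K R' V'" and VV: "j ` V \<subseteq> V'"
  shows "j ` subspace_power k R V n \<subseteq> subspace_power K R' V' n"
proof (induction n)
  case 0
  show ?case
    using semilinear_span[OF Rk.vec_space_axioms RK.vec_space_axioms ic j, of "{\<one>\<^bsub>R\<^esub>}" "subspace_power K R' V' 0"]
      RK.span_superset[of "{\<one>\<^bsub>R'\<^esub>}"] RK.span_submodule[of "{\<one>\<^bsub>R'\<^esub>}"] j_one by simp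
next
  case (Suc n)
  have c: "subspace_power k R V n \<subseteq> carrier R" "V \<subseteq> carrier R"
    using Rk.sub_carrier fin_dim_subspaceD power_fin[OF V] V by blast+
  show ?case
    unfolding subspace_power.simps(2)[of k]
  proof (rule semilinear_span[OF Rk.vec_space_axioms RK.vec_space_axioms ic j])
    show "{x \<otimes>\<^bsub>R\<^esub> v |x v. x \<in> subspace_power k R V n \<and> v \<in> V} \<subseteq> carrier R" using c by auto
    show "submodule (subspace_power K R' V' (Suc n)) K R'" by (rule fin_dim_subspaceD[OF power_fin'[OF V']])
    show "j ` {x \<otimes>\<^bsub>R\<^esub> v |x v. x \<in> subspace_power k R V n \<and> v \<in> V} \<subseteq> subspace_power K R' V' (Suc n)"
    proof clarify
      fix x v assume xv: "x \<in> subspace_power k R V n" "v \<in> V"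
      hence "j (x \<otimes>\<^bsub>R\<^esub> v) = j x \<otimes>\<^bsub>R'\<^esub> j v" using c by (intro j_mult) auto
      moreover have "j x \<in> subspace_power K R' V' n" "j v \<in> V'" using Suc xv VV by auto
      ultimately show "j (x \<otimes>\<^bsub>R\<^esub> v) \<in> subspace_power K R' V' (Suc n)"
        unfolding subspace_power.simps using RK.span_superset by fastforce
    qed
  qed
qed

text \<open>Products of generators generate the products of their spans, and \<open>j\<close> is
  multiplicative; so the inclusion passes from \<open>n\<close> to \<open>n + 1\<close>.\<close>

lemma power_subset_span_image:
  assumes V: "fin_dim_subspace k R V" and V': "V' \<subseteq> lin_span K R' (j ` V)"
  shows "subspace_power K R' V' n \<subseteq> lin_span K R' (j ` subspace_power k R V n)"
proof -
  have jc: "j ` U \<subseteq> carrier R'" if "U \<subseteq> carrier R" for U using that semilinearD(1)[OF j] by blast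
  have c: "subspace_power k R V n \<subseteq> carrier R" "V \<subseteq> carrier R" for n
    using Rk.sub_carrier fin_dim_subspaceD power_fin[OF V] V by blast+
  show ?thesis
  proof (induction n)
    case 0
    have "\<one>\<^bsub>R'\<^esub> \<in> j ` subspace_power k R V 0"
      using Rk.span_superset[of "{\<one>\<^bsub>R\<^esub>}"] j_one by (auto intro: image_eqI[of _ _ "\<one>\<^bsub>R\<^esub>"])
    hence "{\<one>\<^bsub>R'\<^esub>} \<subseteq> lin_span K R' (j ` subspace_power k R V 0)" using RK.span_superset by blast
    from RK.span_subset[OF jc[OF c(1)] this] show ?case by (simp only: subspace_power.simps(1)[of K])
  next
    case (Suc n)
    let ?H = "lin_span K R' (j ` subspace_power k R V (Suc n))"
    note H = RK.span_submodule[OF jc[OF c(1)], of "Suc n"]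
    have "j p \<otimes>\<^bsub>R'\<^esub> j q \<in> ?H" if "p \<in> subspace_power k R V n" "q \<in> V" for p q
    proof -
      have "p \<otimes>\<^bsub>R\<^esub> q \<in> subspace_power k R V (Suc n)"
        unfolding subspace_power.simps using Rk.span_superset that by fastforce
      hence "j (p \<otimes>\<^bsub>R\<^esub> q) \<in> ?H" using RK.span_superset by blast
      moreover have "j (p \<otimes>\<^bsub>R\<^esub> q) = j p \<otimes>\<^bsub>R'\<^esub> j q" using that c by (intro j_mult) auto
      ultimately show ?thesis by simp
    qed
    hence 1: "p' \<otimes>\<^bsub>R'\<^esub> q' \<in> ?H" if "p' \<in> j ` subspace_power k R V n" "q' \<in> j ` V" for p' q'
      using that by blast
    note vs = RK.vec_space_axioms
    have "{x \<otimes>\<^bsub>R'\<^esub> v |x v. x \<in> subspace_power K R' V' n \<and> v \<in> V'} \<subseteq> ?H"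
    proof clarify
      fix x v assume "x \<in> subspace_power K R' V' n" "v \<in> V'"
      with Suc V' have "x \<in> lin_span K R' (j ` subspace_power k R V n)" "v \<in> lin_span K R' (j ` V)" by auto
      from bilinear_span[OF vs vs vs mult_linear[OF M'.A.nc_algebra_axioms] jc[OF c(1)] jc[OF c(2)] H 1 this]
      show "x \<otimes>\<^bsub>R'\<^esub> v \<in> ?H" .
    qed
    from RK.span_least[OF H this] show ?case by (simp only: subspace_power.simps(2)[of K])
  qed
qed

text \<open>\<open>t\<close> plays the role of the map from \<open>x\<close> to
  \<open>x \<otimes> 1\<close>. Stating the bound for every submodule \<open>N\<close> builds in
  monotonicity under inclusion.\<close>

lemma gkdim_le:
  assumes t: "semilinear i k Mk MK t"
    and t_act: "\<And>r x. \<lbrakk>r \<in> carrier R; x \<in> carrier M\<rbrakk> \<Longrightarrow> t (r \<odot>\<^bsub>M\<^esub> x) = j r \<odot>\<^bsub>M'\<^esub> t x"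
    and gen: "carrier R' \<subseteq> lin_span K R' (j ` carrier R)" "carrier M' \<subseteq> lin_span K MK (t ` carrier M)"
    and N: "submodule N R' M'" "N \<noteq> {\<zero>\<^bsub>M'\<^esub>}" and M0: "carrier M \<noteq> {\<zero>\<^bsub>M\<^esub>}"
  shows "gkdim K R' (M'\<lparr>carrier := N\<rparr>) \<le> gkdim k R M"
proof -
  have jc: "j ` U \<subseteq> carrier R'" if "U \<subseteq> carrier R" for U using that semilinearD(1)[OF j] by blast
  have tc: "t ` U \<subseteq> carrier M'" if "U \<subseteq> carrier M" for U using that semilinearD(1)[OF t] by auto
  show ?thesis
    unfolding gkdim_submodule[OF K.field_axioms M'.right_module_axioms N]
  proof (rule SUP_least, clarify)
    fix W V assume W: "fin_dim_subspace K MK W" and V: "fin_dim_subspace K R' V"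
    obtain P where P: "finite P" "P \<subseteq> carrier MK" "W = lin_span K MK P" using MK.fin_dimE[OF W] .
    obtain Q where Q: "finite Q" "Q \<subseteq> carrier R'" "V = lin_span K R' Q" using RK.fin_dimE[OF V] .
    have "P \<subseteq> lin_span K MK (t ` carrier M)" using P gen by auto
    from MK.span_finite_subset[OF _ P(1) this] tc[of "carrier M"] obtain P1 where
      P1: "finite P1" "P1 \<subseteq> t ` carrier M" "P \<subseteq> lin_span K MK P1" by auto
    then obtain P0 where P0: "P0 \<subseteq> carrier M" "finite P0" "P1 = t ` P0" using finite_subset_image by meson
    have "Q \<subseteq> lin_span K R' (j ` carrier R)" using Q gen by auto
    from RK.span_finite_subset[OF _ Q(1) this] jc[of "carrier R"] obtain Q1 where
      Q1: "finite Q1" "Q1 \<subseteq> j ` carrier R" "Q \<subseteq> lin_span K R' Q1" by auto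
    then obtain Q0 where Q0: "Q0 \<subseteq> carrier R" "finite Q0" "Q1 = j ` Q0" using finite_subset_image by meson
    \<comment> \<open>Finitely many generators involve only finitely many elements coming from
      \<open>M\<close> and \<open>R\<close>; these span \<open>W0\<close> and
      \<open>V0\<close>.\<close>
    define W0 where "W0 = lin_span k Mk P0"
    define V0 where "V0 = lin_span k R Q0"
    have W0: "fin_dim_subspace k Mk W0" unfolding W0_def using P0 by (intro Mk.fin_dim_span) auto
    have V0: "fin_dim_subspace k R V0" unfolding V0_def using Q0 by (intro Rk.fin_dim_span) auto
    have W0c: "W0 \<subseteq> carrier M" using Mk.sub_carrier[OF fin_dim_subspaceD[OF W0]] by simp
    have V0c: "V0 \<subseteq> carrier R" using Rk.sub_carrier[OF fin_dim_subspaceD[OF V0]] .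
    have "P \<subseteq> lin_span K MK (t ` W0)"
      using P1(3) MK.span_mono[OF image_mono, of P0 W0 t] Mk.span_superset[of P0] unfolding P0 W0_def by blast
    hence WW: "W \<subseteq> lin_span K MK (t ` W0)" unfolding P(3) using tc[OF W0c] by (intro MK.span_subset) auto
    have "Q \<subseteq> lin_span K R' (j ` V0)"
      using Q1(3) RK.span_mono[OF image_mono, of Q0 V0 j] Rk.span_superset[of Q0] unfolding Q0 V0_def by blast
    hence VV: "V \<subseteq> lin_span K R' (j ` V0)" unfolding Q(3) using jc[OF V0c] by (intro RK.span_subset) auto
    have "growth K R' M' W V n \<le> 1 * growth k R M W0 V0 n" for n
    proof -
      let ?U = "subspace_power k R V0 n" and ?U' = "subspace_power K R' V n"
      let ?A = "subspace_act k R M W0 ?U"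
      have Uc: "?U \<subseteq> carrier R" using Rk.sub_carrier[OF fin_dim_subspaceD[OF power_fin[OF V0]]] .
      note A = subspace_act_fin_dim[OF k.field_axioms M.right_module_axioms W0 power_fin[OF V0], of n]
      note A' = subspace_act_fin_dim[OF K.field_axioms M'.right_module_axioms W power_fin'[OF V], of n]
      have Ac: "?A \<subseteq> carrier M" using Mk.sub_carrier[OF fin_dim_subspaceD[OF A]] by simp
      obtain S where S: "finite S" "S \<subseteq> carrier Mk" "?A = lin_span k Mk S" using Mk.fin_dimE[OF A] .
      \<comment> \<open>The image under \<open>t\<close> of a \<open>k\<close>-basis of
        \<open>W0 V0^n\<close> spans over \<open>K\<close> a space that contains
        \<open>W V^n\<close>.\<close>
      obtain B where B: "finite B" "is_basis k Mk ?A B" "card B = growth k R M W0 V0 n"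
        using Mk.subspace_dim_basis[OF fin_dim_subspaceD[OF A] S(1,2)] S(3) unfolding growth_def by blast
      have BA: "B \<subseteq> ?A" "lin_span k Mk B = ?A" using B by (auto simp: is_basis_def)
      have tB: "t ` B \<subseteq> carrier MK" using tc[of B] BA Ac by auto
      note sm = MK.span_submodule[OF tB]
      have tA: "t ` ?A \<subseteq> lin_span K MK (t ` B)"
        using semilinear_span[OF Mk.vec_space_axioms MK.vec_space_axioms ic t _ MK.span_superset sm] BA Ac by auto
      have 1: "p \<odot>\<^bsub>M'\<^esub> q \<in> lin_span K MK (t ` B)" if pq: "p \<in> j ` ?U" "q \<in> t ` W0" for p q
      proof -
        obtain u w where uw: "p = j u" "q = t w" "u \<in> ?U" "w \<in> W0" using pq by blast
        have "u \<odot>\<^bsub>M\<^esub> w \<in> ?A" unfolding subspace_act_def using Mk.span_superset uw by fastforce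
        hence "t (u \<odot>\<^bsub>M\<^esub> w) \<in> lin_span K MK (t ` B)" using tA by blast
        moreover have "t (u \<odot>\<^bsub>M\<^esub> w) = j u \<odot>\<^bsub>M'\<^esub> t w" using uw Uc W0c by (intro t_act) auto
        ultimately show ?thesis using uw by simp
      qed
      have UU: "?U' \<subseteq> lin_span K R' (j ` ?U)" by (rule power_subset_span_image[OF V0 VV])
      have "{u \<odot>\<^bsub>M'\<^esub> w |u w. u \<in> ?U' \<and> w \<in> W} \<subseteq> lin_span K MK (t ` B)"
      proof clarify
        fix u w assume "u \<in> ?U'" "w \<in> W"
        hence uw: "u \<in> lin_span K R' (j ` ?U)" "w \<in> lin_span K MK (t ` W0)" using UU WW by auto
        have tW0: "t ` W0 \<subseteq> carrier MK" using tc[OF W0c] by simp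
        have l: "linear_map K R' MK (\<lambda>x. x \<odot>\<^bsub>M'\<^esub> y)" if "y \<in> carrier MK" for y
          using act_linear(1)[OF M'.right_module_axioms] that by simp
        show "u \<odot>\<^bsub>M'\<^esub> w \<in> lin_span K MK (t ` B)"
          by (rule bilinear_span[OF RK.vec_space_axioms MK.vec_space_axioms MK.vec_space_axioms l
                act_linear(2)[OF M'.right_module_axioms] jc[OF Uc] tW0 sm 1 uw])
      qed
      from MK.span_least[OF sm this] have "subspace_act K R' M' W ?U' \<subseteq> lin_span K MK (t ` B)"
        unfolding subspace_act_def .
      from MK.subspace_dim_le[OF fin_dim_subspaceD[OF A'] _ tB this]
      have "growth K R' M' W V n \<le> card (t ` B)" using B(1) unfolding growth_def by simp
      also have "\<dots> \<le> card B" using B(1) by (rule card_image_le)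
      finally show ?thesis using B(3) by simp
    qed
    from limsup_ext_log_le[OF this]
    have "limsup (\<lambda>n. ext_log n (growth K R' M' W V n)) \<le> limsup (\<lambda>n. ext_log n (growth k R M W0 V0 n))" .
    \<comment> \<open>\<open>M0\<close> excludes the conventional value \<open>- 1\<close>, so
      \<open>gkdim\<close> is the supremum here.\<close>
    also have "\<dots> \<le> gkdim k R M"
      unfolding gkdim_def growth_def[symmetric] using M0 W0 V0 by (auto intro!: SUP_upper2[of "(W0, V0)"])
    finally show "limsup (\<lambda>n. ext_log n (growth K R' M' W V n)) \<le> gkdim k R M" .
  qed
qed

text \<open>\<open>N0\<close> is the cyclic module generated by \<open>x = p z\<close>. A subspace
  of \<open>N0\<close> is lifted along \<open>r \<mapsto> x r\<close> to a subspace of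
  \<open>R\<close> and then carried into \<open>N\<close> along \<open>r \<mapsto> z r\<close>;
  \<open>span_dimension_transfer\<close>, with these two maps as \<open>h\<close> and
  \<open>g\<close>, compares the dimensions.\<close>

lemma le_gkdim:
  assumes N: "submodule N R' M'" and z: "z \<in> N"
    and p: "p \<in> carrier M' \<rightarrow> carrier M" "p \<zero>\<^bsub>M'\<^esub> = \<zero>\<^bsub>M\<^esub>" "p z \<noteq> \<zero>\<^bsub>M\<^esub>"
      "\<And>r y. \<lbrakk>r \<in> carrier R; y \<in> carrier M'\<rbrakk> \<Longrightarrow> p (j r \<odot>\<^bsub>M'\<^esub> y) = r \<odot>\<^bsub>M\<^esub> p y"
    and F: "\<And>f. f \<in> F \<Longrightarrow> linear_map K MK (ext_space (\<lambda>c. c) K) f"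
    and sep: "\<And>y. \<lbrakk>y \<in> carrier M'; y \<noteq> \<zero>\<^bsub>M'\<^esub>\<rbrakk> \<Longrightarrow> \<exists>f\<in>F. f y \<noteq> \<zero>\<^bsub>K\<^esub>"
    and A: "finite A" "A \<subseteq> carrier K"
    and FA: "\<And>f r. \<lbrakk>f \<in> F; r \<in> carrier R\<rbrakk> \<Longrightarrow> f (j r \<odot>\<^bsub>M'\<^esub> z) \<in> lin_span k (ext_space i K) A"
  obtains N0 where "submodule N0 R M" "N0 \<noteq> {\<zero>\<^bsub>M\<^esub>}"
    "gkdim k R (M\<lparr>carrier := N0\<rparr>) \<le> gkdim K R' (M'\<lparr>carrier := N\<rparr>)"
proof -
  define x where "x = p z"
  note Nf = submodule_facts[OF N]
  have zc: "z \<in> carrier M'" using z Nf by blast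
  have xc: "x \<in> carrier M" using p zc x_def by blast
  have x0: "x \<noteq> \<zero>\<^bsub>M\<^esub>" using p x_def by simp
  let ?h = "\<lambda>r. r \<odot>\<^bsub>M\<^esub> x" and ?g = "\<lambda>r. j r \<odot>\<^bsub>M'\<^esub> z"
  define N0 where "N0 = ?h ` carrier R"
  have h: "linear_map k R Mk ?h" by (rule act_linear(1)[OF M.right_module_axioms xc])
  have az: "linear_map K R' MK (\<lambda>r. r \<odot>\<^bsub>M'\<^esub> z)" by (rule act_linear(1)[OF M'.right_module_axioms zc])
  have g: "semilinear i k R MK ?g"
  proof (rule semilinearI)
    fix c r assume "c \<in> carrier k" "r \<in> carrier R"
    thus "j (c \<odot>\<^bsub>R\<^esub> r) \<odot>\<^bsub>M'\<^esub> z = i c \<odot>\<^bsub>MK\<^esub> (j r \<odot>\<^bsub>M'\<^esub> z)"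
      using semilinearD(1,3)[OF j] semilinearD(3)[OF az] ic by (simp add: Pi_iff)
  qed (use semilinearD(1,2)[OF j] semilinearD(1,2)[OF az] in simp_all)
  have jr: "j r \<in> carrier R'" if "r \<in> carrier R" for r using semilinearD(1)[OF j that] .
  \<comment> \<open>\<open>p\<close> is \<open>R\<close>-linear, so whatever annihilates
    \<open>z\<close> annihilates \<open>x\<close>.\<close>
  have gh: "?h r = \<zero>\<^bsub>Mk\<^esub>" if "r \<in> carrier R" "?g r = \<zero>\<^bsub>MK\<^esub>" for r
    using p(4)[OF that(1) zc] that(2) p(2) x_def by simp
  have N0: "submodule N0 R M"
  proof (rule M.submoduleI)
    have s: "submodule N0 k Mk"
      unfolding N0_def by (rule submodule_image[OF Rk.vec_space_axioms Mk.vec_space_axioms h M.A.carrier_is_submodule])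
    show "N0 \<subseteq> carrier M" "\<zero>\<^bsub>M\<^esub> \<in> N0" using Mk.sub_carrier[OF s] Mk.sub_zero[OF s] by simp_all
    show "a \<oplus>\<^bsub>M\<^esub> b \<in> N0" if "a \<in> N0" "b \<in> N0" for a b using Mk.sub_add[OF s that] by simp
    show "r \<odot>\<^bsub>M\<^esub> a \<in> N0" if r: "r \<in> carrier R" "a \<in> N0" for r a
    proof -
      obtain s where s: "s \<in> carrier R" "a = ?h s" using r unfolding N0_def by blast
      \<comment> \<open>\<open>r \<odot> x\<close> means \<open>x\<close> times \<open>r\<close>,
        hence \<open>s\<close> precedes \<open>r\<close> in the product.\<close>
      hence "r \<odot>\<^bsub>M\<^esub> a = ?h (s \<otimes>\<^bsub>R\<^esub> r)" using M.ract_assoc[of s r x] r xc by simp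
      moreover have "s \<otimes>\<^bsub>R\<^esub> r \<in> carrier R" using s(1) r(1) by (rule M.A.m_closed)
      ultimately show ?thesis unfolding N0_def by (rule image_eqI)
    qed
  qed
  have N00: "N0 \<noteq> {\<zero>\<^bsub>M\<^esub>}"
  proof -
    have "x \<in> N0" unfolding N0_def using M.ract_one[OF xc] M.A.one_closed by (metis image_eqI)
    thus ?thesis using x0 by blast
  qed
  have Nn: "N \<noteq> {\<zero>\<^bsub>M'\<^esub>}" using z p(2,3) by auto
  have "gkdim k R (M\<lparr>carrier := N0\<rparr>) \<le> gkdim K R' (M'\<lparr>carrier := N\<rparr>)"
    unfolding gkdim_submodule[OF k.field_axioms M.right_module_axioms N0 N00]
  proof (rule SUP_least, clarify)
    fix W V assume W: "fin_dim_subspace k Mk W" and WN: "W \<subseteq> N0" and V: "fin_dim_subspace k R V"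
    obtain P where P: "finite P" "P \<subseteq> carrier Mk" "W = lin_span k Mk P" using Mk.fin_dimE[OF W] .
    have "P \<subseteq> ?h ` carrier R" using WN Mk.span_superset[of P] unfolding P N0_def by blast
    \<comment> \<open>Preimages in \<open>R\<close> of finitely many generators of \<open>W\<close>.
      With \<open>Q'\<close> their span, \<open>W\<close> is contained in \<open>x Q'\<close>, and
      \<open>W'\<close> below is the \<open>K\<close>-span of \<open>z Q'\<close>.\<close>
    then obtain Q where Q: "Q \<subseteq> carrier R" "finite Q" "P = ?h ` Q" using P(1) finite_subset_image by meson
    obtain QV where QV: "finite QV" "QV \<subseteq> carrier R" "V = lin_span k R QV" using Rk.fin_dimE[OF V] .
    define Q' where "Q' = lin_span k R Q"
    define W' where "W' = lin_span K MK (?g ` Q)"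
    define V' where "V' = lin_span K R' (j ` QV)"
    have Q'c: "Q' \<subseteq> carrier R" unfolding Q'_def by (rule Rk.span_carrier[OF Q(1)])
    have gQ: "?g ` Q \<subseteq> carrier MK" using semilinearD(1)[OF g] Q by blast
    have jQ: "j ` QV \<subseteq> carrier R'" using jr QV by blast
    have W': "fin_dim_subspace K MK W'" unfolding W'_def using Q gQ by (intro MK.fin_dim_span) auto
    have V': "fin_dim_subspace K R' V'" unfolding V'_def using QV jQ by (intro RK.fin_dim_span) auto
    have gN: "?g r \<in> N" if "r \<in> carrier R" for r using Nf(5) jr that z by blast
    have W'N: "W' \<subseteq> N"
      unfolding W'_def
      using gN Q(1) by (intro MK.span_least submodule_restrict_scalars(1)[OF K.field_axioms M'.right_module_axioms N]) auto
    have gQ': "?g ` Q' \<subseteq> W'"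
      unfolding Q'_def W'_def
      by (rule semilinear_span[OF Rk.vec_space_axioms MK.vec_space_axioms ic g Q(1) MK.span_superset
            MK.span_submodule[OF gQ]])
    have jV: "j ` V \<subseteq> V'"
      unfolding QV(3) V'_def
      by (rule semilinear_span[OF Rk.vec_space_axioms RK.vec_space_axioms ic j QV(2) RK.span_superset
            RK.span_submodule[OF jQ]])
    have "growth k R M W V n \<le> card A * growth K R' M' W' V' n" for n
    proof -
      let ?U = "subspace_power k R V n" and ?U' = "subspace_power K R' V' n"
      let ?Y = "subspace_act K R' M' W' ?U'"
      have Uc: "?U \<subseteq> carrier R" using Rk.sub_carrier[OF fin_dim_subspaceD[OF power_fin[OF V]]] .
      have jU: "j ` ?U \<subseteq> ?U'" by (rule image_power_subset[OF V V' jV])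
      note D = subspace_act_fin_dim[OF k.field_axioms M.right_module_axioms W power_fin[OF V], of n]
      note Y = subspace_act_fin_dim[OF K.field_axioms M'.right_module_axioms W' power_fin'[OF V'], of n]
      \<comment> \<open>\<open>T\<close> is \<open>Q' V^n\<close>, formed in \<open>R\<close>: its
        image under \<open>h\<close> contains \<open>W V^n\<close>, and its image under
        \<open>g\<close> lies in \<open>W' V'^n\<close>.\<close>
      define T where "T = lin_span k R {s \<otimes>\<^bsub>R\<^esub> u |s u. s \<in> Q' \<and> u \<in> ?U}"
      have Tg: "{s \<otimes>\<^bsub>R\<^esub> u |s u. s \<in> Q' \<and> u \<in> ?U} \<subseteq> carrier R" using Q'c Uc by auto
      have T: "submodule T k R" unfolding T_def by (rule Rk.span_submodule[OF Tg])
      have "?g ` {s \<otimes>\<^bsub>R\<^esub> u |s u. s \<in> Q' \<and> u \<in> ?U} \<subseteq> ?Y"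
      proof clarify
        fix s u assume su: "s \<in> Q'" "u \<in> ?U"
        hence c: "s \<in> carrier R" "u \<in> carrier R" using Q'c Uc by auto
        have "j (s \<otimes>\<^bsub>R\<^esub> u) \<odot>\<^bsub>M'\<^esub> z = j u \<odot>\<^bsub>M'\<^esub> (?g s)"
          using c jr zc by (simp add: j_mult M'.ract_assoc)
        moreover have "j u \<in> ?U'" "?g s \<in> W'" using su jU gQ' by auto
        ultimately show "j (s \<otimes>\<^bsub>R\<^esub> u) \<odot>\<^bsub>M'\<^esub> z \<in> ?Y"
          unfolding subspace_act_def using MK.span_superset by fastforce
      qed
      hence gT: "?g ` T \<subseteq> ?Y" unfolding T_def
        by (rule semilinear_span[OF Rk.vec_space_axioms MK.vec_space_axioms ic g Tg _ fin_dim_subspaceD[OF Y]])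
      note hT = submodule_image[OF Rk.vec_space_axioms Mk.vec_space_axioms h T]
      note hQ = submodule_image[OF Rk.vec_space_axioms Mk.vec_space_axioms h Rk.span_submodule[OF Q(1)]]
      have "?h ` Q \<subseteq> ?h ` lin_span k R Q" using Rk.span_superset[of Q] by blast
      from Mk.span_least[OF hQ this] have WQ: "W \<subseteq> ?h ` Q'" unfolding P(3) Q(3) Q'_def .
      have "{u \<odot>\<^bsub>M\<^esub> w |u w. u \<in> ?U \<and> w \<in> W} \<subseteq> ?h ` T"
      proof clarify
        fix u w assume u: "u \<in> ?U" and "w \<in> W"
        then obtain s where s: "s \<in> Q'" "w = ?h s" using WQ by blast
        have c: "s \<in> carrier R" "u \<in> carrier R" using s u Q'c Uc by auto
        have "s \<otimes>\<^bsub>R\<^esub> u \<in> T" unfolding T_def using Rk.span_superset s u by fastforce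
        moreover have "u \<odot>\<^bsub>M\<^esub> w = ?h (s \<otimes>\<^bsub>R\<^esub> u)" using c xc s by (simp add: M.ract_assoc)
        ultimately show "u \<odot>\<^bsub>M\<^esub> w \<in> ?h ` T" by blast
      qed
      from Mk.span_least[OF hT this] have DT: "subspace_act k R M W ?U \<subseteq> ?h ` T"
        unfolding subspace_act_def .
      obtain S where S: "finite S" "S \<subseteq> carrier MK" "?Y = lin_span K MK S" using MK.fin_dimE[OF Y] .
      obtain B where B: "finite B" "is_basis K MK ?Y B" "card B = growth K R' M' W' V' n"
        using MK.subspace_dim_basis[OF fin_dim_subspaceD[OF Y] S(1,2)] S(3) unfolding growth_def by blast
      have BY: "B \<subseteq> ?Y" "lin_span K MK B = ?Y" using B by (auto simp: is_basis_def)
      have Bc: "B \<subseteq> carrier MK" using BY(1) MK.sub_carrier[OF fin_dim_subspaceD[OF Y]] by blast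
      have sep': "\<exists>f\<in>F. f y \<noteq> \<zero>\<^bsub>K\<^esub>" if "y \<in> carrier MK" "y \<noteq> \<zero>\<^bsub>MK\<^esub>" for y
        using sep that by simp
      have "\<exists>D. finite D \<and> D \<subseteq> carrier Mk \<and> card D \<le> card A * card B \<and> ?h ` T \<subseteq> lin_span k Mk D"
      proof (rule span_dimension_transfer[where Y = MK and g = ?g and F = F,
            OF Rk.vec_space_axioms Mk.vec_space_axioms MK.vec_space_axioms i g h])
        show "f (?g r) \<in> lin_span k (ext_space i K) A" if "f \<in> F" "r \<in> carrier R" for f r
          by (rule FA[OF that])
        show "?g ` T \<subseteq> lin_span K MK B" unfolding BY(2) by (rule gT)
      qed (rule gh F sep' A T B(1) Bc; assumption)+
      then obtain E where E: "finite E" "E \<subseteq> carrier Mk" "card E \<le> card A * card B" "?h ` T \<subseteq> lin_span k Mk E"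
        by blast
      have "subspace_act k R M W ?U \<subseteq> lin_span k Mk E" using DT E(4) by (rule subset_trans)
      from Mk.subspace_dim_le[OF fin_dim_subspaceD[OF D] E(1,2) this]
      have "growth k R M W V n \<le> card E" unfolding growth_def .
      with E(3) B(3) show ?thesis by simp
    qed
    from limsup_ext_log_le[OF this]
    have "limsup (\<lambda>n. ext_log n (growth k R M W V n)) \<le> limsup (\<lambda>n. ext_log n (growth K R' M' W' V' n))" .
    also have "\<dots> \<le> gkdim K R' (M'\<lparr>carrier := N\<rparr>)"
      unfolding gkdim_submodule[OF K.field_axioms M'.right_module_axioms N Nn]
      using W' W'N V' by (auto intro!: SUP_upper2[of "(W', V')"])
    finally show "limsup (\<lambda>n. ext_log n (growth k R M W V n)) \<le> gkdim K R' (M'\<lparr>carrier := N\<rparr>)" .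
  qed
  with that N0 N00 show ?thesis by blast
qed

end

section \<open>Tensor products\<close>

definition pure :: "'k ring \<Rightarrow> ('k, 'x) module \<Rightarrow> ('k, 'y) module \<Rightarrow> 'x \<Rightarrow> 'y \<Rightarrow> ('x \<times> 'y \<Rightarrow>\<^sub>0 int) set" where
  "pure k X Y x y = tensor_class k X Y (frag_of (x, y))"

text \<open>The target carries only a group structure, written multiplicatively, since
  \<open>tensor_group\<close> is a bare group; linearity over \<open>k\<close> thus reduces to
  moving scalars from one argument to the other.\<close>

definition balanced ::
  "'k ring \<Rightarrow> ('k, 'x) module \<Rightarrow> ('k, 'y) module \<Rightarrow> 'g monoid \<Rightarrow> ('x \<Rightarrow> 'y \<Rightarrow> 'g) \<Rightarrow> bool" where
  "balanced k X Y G f \<longleftrightarrow>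
     (\<forall>x\<in>carrier X. \<forall>y\<in>carrier Y. f x y \<in> carrier G) \<and>
     (\<forall>x\<in>carrier X. \<forall>x'\<in>carrier X. \<forall>y\<in>carrier Y. f (x \<oplus>\<^bsub>X\<^esub> x') y = f x y \<otimes>\<^bsub>G\<^esub> f x' y) \<and>
     (\<forall>x\<in>carrier X. \<forall>y\<in>carrier Y. \<forall>y'\<in>carrier Y. f x (y \<oplus>\<^bsub>Y\<^esub> y') = f x y \<otimes>\<^bsub>G\<^esub> f x y') \<and>
     (\<forall>c\<in>carrier k. \<forall>x\<in>carrier X. \<forall>y\<in>carrier Y. f (c \<odot>\<^bsub>X\<^esub> x) y = f x (c \<odot>\<^bsub>Y\<^esub> y))"

section \<open>Homomorphisms out of a free abelian group\<close>

lemma hom_free_Abelian_group_diff: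
  assumes "group G" "h \<in> hom (free_Abelian_group S) G" "Poly_Mapping.keys u \<subseteq> S" "Poly_Mapping.keys v \<subseteq> S"
  shows "h (u - v) = h u \<otimes>\<^bsub>G\<^esub> inv\<^bsub>G\<^esub> h v"
proof -
  interpret group_hom "free_Abelian_group S" G h
    using assms by (simp add: group_hom_def group_hom_axioms_def)
  have "Poly_Mapping.keys (- v) \<subseteq> S" using assms(4) by (simp add: keys_minus)
  with assms hom_mult[of u "- v"] hom_inv[of v] show ?thesis by simp
qed

lemma hom_free_Abelian_group_eqI:
  fixes S :: "'p set"
  assumes "group G" "g \<in> hom (free_Abelian_group S) G" "h \<in> hom (free_Abelian_group S) G"
    and "\<And>p. p \<in> S \<Longrightarrow> g (frag_of p) = h (frag_of p)" "Poly_Mapping.keys u \<subseteq> S"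
  shows "g u = h u"
proof (rule free_Abelian_group_induct[OF assms(5)])
  show "g 0 = h 0"
    using hom_one[OF assms(2) group_free_Abelian_group assms(1)] hom_one[OF assms(3) group_free_Abelian_group assms(1)]
    by simp
next
  fix u v :: "'p \<Rightarrow>\<^sub>0 int" assume "Poly_Mapping.keys u \<subseteq> S" "Poly_Mapping.keys v \<subseteq> S" "g u = h u" "g v = h v"
  thus "g (u - v) = h (u - v)"
    using hom_free_Abelian_group_diff[OF assms(1,2)] hom_free_Abelian_group_diff[OF assms(1,3)] by simp
qed (use assms in auto)

section \<open>The group of tensors and its universal property\<close>

locale tensor_product = X: module k X + Y: module k Y
  for k :: "'k ring" and X :: "('k, 'x) module" and Y :: "('k, 'y) module"
begin

abbreviation "S \<equiv> carrier X \<times> carrier Y"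
abbreviation "Fr \<equiv> tensor_free X Y"
abbreviation "N \<equiv> tensor_rel k X Y"
abbreviation "T \<equiv> tensor_group k X Y"
abbreviation "cls \<equiv> tensor_class k X Y"
abbreviation "pr \<equiv> pure k X Y"

sublocale Fr: comm_group Fr by (rule abelian_free_Abelian_group)

definition relators :: "('x \<times> 'y \<Rightarrow>\<^sub>0 int) set" where
  "relators =
    {frag_of (x \<oplus>\<^bsub>X\<^esub> x', y) - frag_of (x, y) - frag_of (x', y) | x x' y.
        x \<in> carrier X \<and> x' \<in> carrier X \<and> y \<in> carrier Y} \<union>
     {frag_of (x, y \<oplus>\<^bsub>Y\<^esub> y') - frag_of (x, y) - frag_of (x, y') | x y y'.
        x \<in> carrier X \<and> y \<in> carrier Y \<and> y' \<in> carrier Y} \<union>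
     {frag_of (c \<odot>\<^bsub>X\<^esub> x, y) - frag_of (x, c \<odot>\<^bsub>Y\<^esub> y) | c x y.
        c \<in> carrier k \<and> x \<in> carrier X \<and> y \<in> carrier Y}"

lemma rel_eq: "N = generate Fr relators"
  by (simp add: tensor_rel_def relators_def)

lemma relators_carrier: "relators \<subseteq> carrier Fr"
proof -
  have k: "Poly_Mapping.keys (frag_of p - frag_of q) \<subseteq> S" if "p \<in> S" "q \<in> S" for p q
    using keys_diff[of "frag_of p" "frag_of q"] that by auto
  have "Poly_Mapping.keys (frag_of p - frag_of q - frag_of r) \<subseteq> S" if "p \<in> S" "q \<in> S" "r \<in> S" for p q r
    using keys_diff[of "frag_of p - frag_of q" "frag_of r"] k[of p q] that by auto
  with k show ?thesis by (auto simp: relators_def)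
qed

lemma rel_subgroup: "subgroup N Fr"
  unfolding rel_eq by (rule Fr.generate_is_subgroup[OF relators_carrier])

lemma rel_normal: "N \<lhd> Fr"
  by (simp add: rel_subgroup Fr.normal_iff_subgroup)

sublocale T: comm_group T
  unfolding tensor_group_def by (rule Fr.abelian_FactGroup[OF rel_subgroup])

lemma cls_hom: "cls \<in> hom Fr T"
  using normal.r_coset_hom_Mod[OF rel_normal] by (simp add: tensor_group_def tensor_class_def[abs_def])

lemma carrier_T: "carrier T = cls ` carrier Fr"
  by (simp add: tensor_group_def carrier_FactGroup tensor_class_def[abs_def])

lemma cls_self: "u \<in> carrier Fr \<Longrightarrow> u \<in> cls u"
  unfolding tensor_class_def by (rule Fr.rcos_self[OF _ rel_subgroup])

lemma cls_repr: assumes "u \<in> carrier Fr" "v \<in> cls u" shows "v \<in> carrier Fr" "cls v = cls u"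
proof -
  show "v \<in> carrier Fr"
    using assms subgroup.elemrcos_carrier[OF rel_subgroup Fr.is_group] by (simp add: tensor_class_def)
  show "cls v = cls u"
    using Fr.repr_independence[OF _ assms(1) rel_subgroup, of v] assms(2) by (simp add: tensor_class_def)
qed

lemma T_repr: assumes "A \<in> carrier T" "u \<in> A" shows "u \<in> carrier Fr" "cls u = A"
  using assms cls_repr unfolding carrier_T by blast+

lemma T_nonempty: "A \<in> carrier T \<Longrightarrow> A \<noteq> {}"
  unfolding carrier_T using cls_self by blast

lemma cls_relator: "u \<in> relators \<Longrightarrow> cls u = \<one>\<^bsub>T\<^esub>"
  unfolding tensor_class_def tensor_group_def one_FactGroup
  using subgroup.rcos_const[OF rel_subgroup Fr.is_group] generate.incl[of u relators Fr]
  by (simp add: rel_eq)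

lemma cls_diff:
  "\<lbrakk>u \<in> carrier Fr; v \<in> carrier Fr\<rbrakk> \<Longrightarrow> cls (u - v) = cls u \<otimes>\<^bsub>T\<^esub> inv\<^bsub>T\<^esub> cls v"
  by (rule hom_free_Abelian_group_diff[OF T.is_group cls_hom]) auto

lemma cls_closed: "u \<in> carrier Fr \<Longrightarrow> cls u \<in> carrier T"
  by (rule hom_in_carrier[OF cls_hom])

lemma pr_closed [simp]: "\<lbrakk>x \<in> carrier X; y \<in> carrier Y\<rbrakk> \<Longrightarrow> pr x y \<in> carrier T"
  unfolding pure_def by (intro cls_closed) auto

text \<open>Each relator lies in the subgroup factored out, so its class is trivial; the auxiliary
  facts turn these differences into the three identities.\<close>

lemma balanced_pr: "balanced k X Y T pr"
  unfolding balanced_def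
proof (intro conjI ballI)
  have *: "a = b" if "a \<in> carrier T" "b \<in> carrier T" "a \<otimes>\<^bsub>T\<^esub> inv\<^bsub>T\<^esub> b = \<one>\<^bsub>T\<^esub>" for a b
    using that by (metis T.inv_closed T.inv_equality T.inv_inv)
  have **: "a = b \<otimes>\<^bsub>T\<^esub> c"
    if "a \<in> carrier T" "b \<in> carrier T" "c \<in> carrier T" "a \<otimes>\<^bsub>T\<^esub> inv\<^bsub>T\<^esub> b \<otimes>\<^bsub>T\<^esub> inv\<^bsub>T\<^esub> c = \<one>\<^bsub>T\<^esub>" for a b c
    using *[of a "b \<otimes>\<^bsub>T\<^esub> c"] that by (simp add: T.inv_mult T.m_assoc)
  have d: "cls (frag_of p - frag_of q) = cls (frag_of p) \<otimes>\<^bsub>T\<^esub> inv\<^bsub>T\<^esub> cls (frag_of q)" if "p \<in> S" "q \<in> S" for p q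
    using cls_diff[of "frag_of p" "frag_of q"] that by simp
  have dd: "cls (frag_of p - frag_of q - frag_of r)
      = cls (frag_of p) \<otimes>\<^bsub>T\<^esub> inv\<^bsub>T\<^esub> cls (frag_of q) \<otimes>\<^bsub>T\<^esub> inv\<^bsub>T\<^esub> cls (frag_of r)" if "p \<in> S" "q \<in> S" "r \<in> S" for p q r
  proof -
    have "frag_of p - frag_of q \<in> carrier Fr" using keys_diff[of "frag_of p" "frag_of q"] that by auto
    with cls_diff[of "frag_of p - frag_of q" "frag_of r"] d[of p q] that show ?thesis by simp
  qed
  fix x y assume x: "x \<in> carrier X" and y: "y \<in> carrier Y"
  show "pr x y \<in> carrier T" using x y by simp
  { fix x' assume x': "x' \<in> carrier X"
    have cr: "frag_of (x \<oplus>\<^bsub>X\<^esub> x', y) - frag_of (x, y) - frag_of (x', y) \<in> relators"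
      using x x' y unfolding relators_def by blast
    show "pr (x \<oplus>\<^bsub>X\<^esub> x') y = pr x y \<otimes>\<^bsub>T\<^esub> pr x' y"
    proof (rule **)
      show "pr (x \<oplus>\<^bsub>X\<^esub> x') y \<otimes>\<^bsub>T\<^esub> inv\<^bsub>T\<^esub> pr x y \<otimes>\<^bsub>T\<^esub> inv\<^bsub>T\<^esub> pr x' y = \<one>\<^bsub>T\<^esub>"
        unfolding pure_def by (subst dd[symmetric]) (use x x' y cls_relator[OF cr] in auto)
    qed (use x x' y in auto) }
  { fix y' assume y': "y' \<in> carrier Y"
    have cr: "frag_of (x, y \<oplus>\<^bsub>Y\<^esub> y') - frag_of (x, y) - frag_of (x, y') \<in> relators"
      using x y y' unfolding relators_def by blast
    show "pr x (y \<oplus>\<^bsub>Y\<^esub> y') = pr x y \<otimes>\<^bsub>T\<^esub> pr x y'"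
    proof (rule **)
      show "pr x (y \<oplus>\<^bsub>Y\<^esub> y') \<otimes>\<^bsub>T\<^esub> inv\<^bsub>T\<^esub> pr x y \<otimes>\<^bsub>T\<^esub> inv\<^bsub>T\<^esub> pr x y' = \<one>\<^bsub>T\<^esub>"
        unfolding pure_def by (subst dd[symmetric]) (use x y y' cls_relator[OF cr] in auto)
    qed (use x y y' in auto) }
  fix c assume c: "c \<in> carrier k"
  hence cr: "frag_of (c \<odot>\<^bsub>X\<^esub> x, y) - frag_of (x, c \<odot>\<^bsub>Y\<^esub> y) \<in> relators"
    using x y unfolding relators_def by blast
  show "pr (c \<odot>\<^bsub>X\<^esub> x) y = pr x (c \<odot>\<^bsub>Y\<^esub> y)"
  proof (rule *)
    show "pr (c \<odot>\<^bsub>X\<^esub> x) y \<otimes>\<^bsub>T\<^esub> inv\<^bsub>T\<^esub> pr x (c \<odot>\<^bsub>Y\<^esub> y) = \<one>\<^bsub>T\<^esub>"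
      unfolding pure_def by (subst d[symmetric]) (use x c y cls_relator[OF cr] in auto)
  qed (use x c y in auto)
qed

lemma pr_zero: "y \<in> carrier Y \<Longrightarrow> pr \<zero>\<^bsub>X\<^esub> y = \<one>\<^bsub>T\<^esub>"
  using balanced_pr unfolding balanced_def
  by (metis T.r_cancel_one' X.M.l_zero X.M.zero_closed)

text \<open>Zero and negatives are covered by the pure tensors, because \<open>0 \<otimes> 0\<close>
  is the neutral element and the inverse of \<open>x \<otimes> y\<close> is
  \<open>(- x) \<otimes> y\<close>.\<close>

lemma tensor_induct [consumes 1, case_names pure add]:
  assumes A: "A \<in> carrier T"
    and p: "\<And>x y. \<lbrakk>x \<in> carrier X; y \<in> carrier Y\<rbrakk> \<Longrightarrow> P (pr x y)"
    and a: "\<And>A B. \<lbrakk>A \<in> carrier T; B \<in> carrier T; P A; P B\<rbrakk> \<Longrightarrow> P (A \<otimes>\<^bsub>T\<^esub> B)"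
  shows "P A"
proof -
  obtain u where u: "Poly_Mapping.keys u \<subseteq> S" "A = cls u" using A unfolding carrier_T by auto
  have z: "P \<one>\<^bsub>T\<^esub>" using p[of "\<zero>\<^bsub>X\<^esub>" "\<zero>\<^bsub>Y\<^esub>"] pr_zero[of "\<zero>\<^bsub>Y\<^esub>"] by simp
  \<comment> \<open>Induction in the free group forms differences, so the property is carried for a
    class together with its inverse.\<close>
  have "P (cls u) \<and> P (inv\<^bsub>T\<^esub> cls u)"
  proof (rule free_Abelian_group_induct[OF u(1)])
    have "cls 0 = \<one>\<^bsub>T\<^esub>" using hom_one[OF cls_hom Fr.is_group T.is_group] by simp
    thus "P (cls 0) \<and> P (inv\<^bsub>T\<^esub> cls 0)" using z by simp
  next
    fix u v :: "'x \<times> 'y \<Rightarrow>\<^sub>0 int" assume uv: "Poly_Mapping.keys u \<subseteq> S" "Poly_Mapping.keys v \<subseteq> S"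
      and P: "P (cls u) \<and> P (inv\<^bsub>T\<^esub> cls u)" "P (cls v) \<and> P (inv\<^bsub>T\<^esub> cls v)"
    have c: "cls u \<in> carrier T" "cls v \<in> carrier T" using uv cls_closed by auto
    have "cls (u - v) = cls u \<otimes>\<^bsub>T\<^esub> inv\<^bsub>T\<^esub> cls v" using cls_diff uv by simp
    moreover from this c have "inv\<^bsub>T\<^esub> cls (u - v) = inv\<^bsub>T\<^esub> cls u \<otimes>\<^bsub>T\<^esub> cls v"
      by (simp add: T.inv_mult)
    ultimately show "P (cls (u - v)) \<and> P (inv\<^bsub>T\<^esub> cls (u - v))" using P c a by simp
  next
    fix p' assume "p' \<in> S"
    then obtain x y where xy: "p' = (x, y)" "x \<in> carrier X" "y \<in> carrier Y" by blast
    have "pr (\<ominus>\<^bsub>X\<^esub> x) y \<otimes>\<^bsub>T\<^esub> pr x y = pr (\<ominus>\<^bsub>X\<^esub> x \<oplus>\<^bsub>X\<^esub> x) y"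
      using balanced_pr xy unfolding balanced_def by (metis X.M.a_inv_closed)
    also have "\<dots> = \<one>\<^bsub>T\<^esub>" using xy pr_zero by (simp add: X.M.l_neg)
    finally have "inv\<^bsub>T\<^esub> pr x y = pr (\<ominus>\<^bsub>X\<^esub> x) y" using xy by (intro T.inv_equality) auto
    thus "P (cls (frag_of p')) \<and> P (inv\<^bsub>T\<^esub> cls (frag_of p'))"
      using p[of x y] p[of "\<ominus>\<^bsub>X\<^esub> x" y] xy by (simp add: pure_def)
  qed
  thus ?thesis using u by simp
qed

text \<open>The additive extension of \<open>f\<close> to the free group kills every relator, so it
  factors through the quotient.\<close>

lemma tensor_universal:
  assumes G: "comm_group G" and f: "balanced k X Y G f"
  obtains H where "H \<in> hom T G" "\<And>x y. \<lbrakk>x \<in> carrier X; y \<in> carrier Y\<rbrakk> \<Longrightarrow> H (pr x y) = f x y"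
proof -
  interpret G: comm_group G by (rule G)
  have "(\<lambda>p. f (fst p) (snd p)) ` S \<subseteq> carrier G" using f by (auto simp: balanced_def)
  then obtain h where h: "h \<in> hom Fr G" "\<And>p. p \<in> S \<Longrightarrow> h (frag_of p) = f (fst p) (snd p)"
    using G.free_Abelian_group_universal by blast
  interpret h: group_hom Fr G h using h by unfold_locales
  note hd = hom_free_Abelian_group_diff[OF G.is_group h(1)]
  have "relators \<subseteq> kernel Fr G h"
  proof
    fix u assume u: "u \<in> relators"
    have d: "h (frag_of p - frag_of q) = h (frag_of p) \<otimes>\<^bsub>G\<^esub> inv\<^bsub>G\<^esub> h (frag_of q)" if "p \<in> S" "q \<in> S" for p q
      using hd[of "frag_of p" "frag_of q"] that by simp
    have dd: "h (frag_of p - frag_of q - frag_of r)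
        = h (frag_of p) \<otimes>\<^bsub>G\<^esub> inv\<^bsub>G\<^esub> h (frag_of q) \<otimes>\<^bsub>G\<^esub> inv\<^bsub>G\<^esub> h (frag_of r)" if "p \<in> S" "q \<in> S" "r \<in> S" for p q r
    proof -
      have "Poly_Mapping.keys (frag_of p - frag_of q) \<subseteq> S" using keys_diff[of "frag_of p" "frag_of q"] that by auto
      with hd[of "frag_of p - frag_of q" "frag_of r"] d[of p q] that show ?thesis by simp
    qed
    have c: "f x y \<in> carrier G" if "x \<in> carrier X" "y \<in> carrier Y" for x y using f that by (simp add: balanced_def)
    have c1: "a \<otimes>\<^bsub>G\<^esub> b \<otimes>\<^bsub>G\<^esub> inv\<^bsub>G\<^esub> a \<otimes>\<^bsub>G\<^esub> inv\<^bsub>G\<^esub> b = \<one>\<^bsub>G\<^esub>" if "a \<in> carrier G" "b \<in> carrier G" for a b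
    proof -
      have "a \<otimes>\<^bsub>G\<^esub> b \<otimes>\<^bsub>G\<^esub> inv\<^bsub>G\<^esub> a \<otimes>\<^bsub>G\<^esub> inv\<^bsub>G\<^esub> b = (a \<otimes>\<^bsub>G\<^esub> b) \<otimes>\<^bsub>G\<^esub> inv\<^bsub>G\<^esub> (a \<otimes>\<^bsub>G\<^esub> b)"
        using that by (simp add: G.inv_mult G.m_assoc)
      thus ?thesis using that by simp
    qed
    from u consider
        (1) x x' y where "u = frag_of (x \<oplus>\<^bsub>X\<^esub> x', y) - frag_of (x, y) - frag_of (x', y)"
          "x \<in> carrier X" "x' \<in> carrier X" "y \<in> carrier Y"
      | (2) x y y' where "u = frag_of (x, y \<oplus>\<^bsub>Y\<^esub> y') - frag_of (x, y) - frag_of (x, y')"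
          "x \<in> carrier X" "y \<in> carrier Y" "y' \<in> carrier Y"
      | (3) a x y where "u = frag_of (a \<odot>\<^bsub>X\<^esub> x, y) - frag_of (x, a \<odot>\<^bsub>Y\<^esub> y)"
          "a \<in> carrier k" "x \<in> carrier X" "y \<in> carrier Y"
      unfolding relators_def by blast
    hence "h u = \<one>\<^bsub>G\<^esub>"
    proof cases
      case 1
      hence "f (x \<oplus>\<^bsub>X\<^esub> x') y = f x y \<otimes>\<^bsub>G\<^esub> f x' y" using f by (simp add: balanced_def)
      thus ?thesis using 1 c c1 by (simp add: dd h(2))
    next
      case 2
      hence "f x (y \<oplus>\<^bsub>Y\<^esub> y') = f x y \<otimes>\<^bsub>G\<^esub> f x y'" using f by (simp add: balanced_def)
      thus ?thesis using 2 c c1 by (simp add: dd h(2))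
    next
      case 3
      hence "f (a \<odot>\<^bsub>X\<^esub> x) y = f x (a \<odot>\<^bsub>Y\<^esub> y)" using f by (simp add: balanced_def)
      thus ?thesis using 3 c by (simp add: d h(2))
    qed
    thus "u \<in> kernel Fr G h" using subsetD[OF relators_carrier u] by (simp add: kernel_def)
  qed
  hence N: "N \<subseteq> kernel Fr G h"
    unfolding rel_eq by (rule Fr.generate_subgroup_incl[OF _ h.subgroup_kernel])
  have "h u = h v" if uv: "u \<in> carrier Fr" "v \<in> carrier Fr" "N #>\<^bsub>Fr\<^esub> u = N #>\<^bsub>Fr\<^esub> v" for u v
  proof -
    have "u \<in> N #>\<^bsub>Fr\<^esub> v" using Fr.rcos_self[OF uv(1) rel_subgroup] uv(3) by simp
    then obtain n where n: "n \<in> N" "u = n \<otimes>\<^bsub>Fr\<^esub> v" unfolding r_coset_def by blast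
    hence "n \<in> carrier Fr" "h n = \<one>\<^bsub>G\<^esub>" using N by (auto simp: kernel_def)
    thus ?thesis using h.hom_mult[of n v] uv(2) h.hom_closed[of v] unfolding n(2) by simp
  qed
  then obtain H where H: "H \<in> hom (Fr Mod N) G" "\<And>u. u \<in> carrier Fr \<Longrightarrow> H (N #>\<^bsub>Fr\<^esub> u) = h u"
    using FactGroup_universal[OF h(1) rel_normal] by blast
  show ?thesis
  proof (rule that)
    show "H \<in> hom T G" using H(1) by (simp add: tensor_group_def)
    fix x y assume "x \<in> carrier X" "y \<in> carrier Y"
    thus "H (pr x y) = f x y" using H(2)[of "frag_of (x, y)"] h(2) by (simp add: pure_def tensor_class_def)
  qed
qed

end

section \<open>Maps induced on tensor products\<close>

lemma frag_extend_add_fun: "frag_extend (\<lambda>p. f p + g p) u = frag_extend f u + frag_extend g u"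
  by (simp add: frag_extend_def frag_cmul_distrib2 sum.distrib)

lemma keys_frag_extend_subset:
  assumes "Poly_Mapping.keys u \<subseteq> S" "\<And>p. p \<in> S \<Longrightarrow> Poly_Mapping.keys (f p) \<subseteq> T"
  shows "Poly_Mapping.keys (frag_extend f u) \<subseteq> T"
  using keys_frag_extend[of f u] assms by blast

lemma hom_cls_extend:
  assumes "tensor_product k X' Y'" "\<And>p. p \<in> S \<Longrightarrow> Poly_Mapping.keys (f p) \<subseteq> carrier X' \<times> carrier Y'"
  shows "(\<lambda>u. tensor_class k X' Y' (frag_extend f u)) \<in> hom (free_Abelian_group S) (tensor_group k X' Y')"
proof -
  interpret tensor_product k X' Y' by fact
  show ?thesis
  proof (rule homI)
    fix u assume "u \<in> carrier (free_Abelian_group S)"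
    thus "cls (frag_extend f u) \<in> carrier T"
      using keys_frag_extend_subset[of u S f, OF _ assms(2)] by (intro cls_closed) simp
    fix v assume v: "v \<in> carrier (free_Abelian_group S)"
    with \<open>u \<in> _\<close> show "cls (frag_extend f (u \<otimes>\<^bsub>free_Abelian_group S\<^esub> v))
        = cls (frag_extend f u) \<otimes>\<^bsub>T\<^esub> cls (frag_extend f v)"
      using hom_mult[OF cls_hom, of "frag_extend f u" "frag_extend f v"]
        keys_frag_extend_subset[of _ S f, OF _ assms(2)] by (simp add: frag_extend_add)
  qed
qed

lemma balanced_comp:
  assumes "tensor_product k X' Y'" "linear_map k X X' \<mu>" "linear_map k Y Y' \<nu>"
  shows "balanced k X Y (tensor_group k X' Y') (\<lambda>x y. pure k X' Y' (\<mu> x) (\<nu> y))"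
proof -
  interpret tensor_product k X' Y' by fact
  show ?thesis
    using balanced_pr semilinearD[OF assms(2)] semilinearD[OF assms(3)] by (simp add: balanced_def)
qed

text \<open>The last conclusion concerns the formula inside \<open>tensor_lift1\<close>. Both sides
  are homomorphisms in \<open>u\<close> that agree on generators; as a consequence the value of that
  formula depends only on the class of \<open>u\<close>.\<close>

lemma hom_tensor_map:
  assumes "tensor_product k X Y" "tensor_product k X' Y'" "linear_map k X X' \<mu>" "linear_map k Y Y' \<nu>"
  obtains H where "H \<in> hom (tensor_group k X Y) (tensor_group k X' Y')"
    "\<And>x y. \<lbrakk>x \<in> carrier X; y \<in> carrier Y\<rbrakk> \<Longrightarrow> H (pure k X Y x y) = pure k X' Y' (\<mu> x) (\<nu> y)"
    "\<And>u. Poly_Mapping.keys u \<subseteq> carrier X \<times> carrier Y \<Longrightarrow>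
      tensor_class k X' Y' (frag_extend (\<lambda>p. frag_of ((\<lambda>(x, y). (\<mu> x, \<nu> y)) p)) u) = H (tensor_class k X Y u)"
proof -
  interpret A: tensor_product k X Y by fact
  interpret B: tensor_product k X' Y' by fact
  obtain H where H: "H \<in> hom A.T B.T"
    "\<And>x y. \<lbrakk>x \<in> carrier X; y \<in> carrier Y\<rbrakk> \<Longrightarrow> H (A.pr x y) = B.pr (\<mu> x) (\<nu> y)"
    using A.tensor_universal[OF B.T.comm_group_axioms balanced_comp[OF assms(2-4)]] by blast
  have "B.cls (frag_extend (\<lambda>p. frag_of ((\<lambda>(x, y). (\<mu> x, \<nu> y)) p)) u) = H (A.cls u)"
    if "Poly_Mapping.keys u \<subseteq> A.S" for u
  proof (rule hom_free_Abelian_group_eqI[OF B.T.is_group _ _ _ that])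
    show "(\<lambda>u. B.cls (frag_extend (\<lambda>p. frag_of ((\<lambda>(x, y). (\<mu> x, \<nu> y)) p)) u)) \<in> hom A.Fr B.T"
      by (rule hom_cls_extend[OF assms(2)]) (use semilinearD(1)[OF assms(3)] semilinearD(1)[OF assms(4)] in auto)
    show "(\<lambda>u. H (A.cls u)) \<in> hom A.Fr B.T"
      using Group.hom_compose[OF A.cls_hom H(1)] by (simp add: comp_def)
    fix p assume "p \<in> A.S"
    thus "B.cls (frag_extend (\<lambda>p. frag_of ((\<lambda>(x, y). (\<mu> x, \<nu> y)) p)) (frag_of p)) = H (A.cls (frag_of p))"
      using H(2) by (auto simp: pure_def)
  qed
  with that H show ?thesis by blast
qed

text \<open>All representatives of a class give the same value, and the class is nonempty, so the
  union in \<open>tensor_lift1\<close> collapses to that value.\<close>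

lemma tensor_lift1_linear:
  assumes "tensor_product k X Y" "tensor_product k X' Y'" "linear_map k X X' \<mu>" "linear_map k Y Y' \<nu>"
  shows "tensor_lift1 k X' Y' (\<lambda>(x, y). (\<mu> x, \<nu> y)) \<in> hom (tensor_group k X Y) (tensor_group k X' Y')"
    and "\<lbrakk>x \<in> carrier X; y \<in> carrier Y\<rbrakk> \<Longrightarrow>
      tensor_lift1 k X' Y' (\<lambda>(x, y). (\<mu> x, \<nu> y)) (pure k X Y x y) = pure k X' Y' (\<mu> x) (\<nu> y)"
proof -
  interpret A: tensor_product k X Y by fact
  interpret B: tensor_product k X' Y' by fact
  obtain H where H: "H \<in> hom A.T B.T"
    "\<And>x y. \<lbrakk>x \<in> carrier X; y \<in> carrier Y\<rbrakk> \<Longrightarrow> H (A.pr x y) = B.pr (\<mu> x) (\<nu> y)"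
    "\<And>u. Poly_Mapping.keys u \<subseteq> A.S \<Longrightarrow>
      B.cls (frag_extend (\<lambda>p. frag_of ((\<lambda>(x, y). (\<mu> x, \<nu> y)) p)) u) = H (A.cls u)"
    using hom_tensor_map[OF assms] by blast
  have eq: "tensor_lift1 k X' Y' (\<lambda>(x, y). (\<mu> x, \<nu> y)) C = H C" if C: "C \<in> carrier A.T" for C
  proof -
    have "B.cls (frag_extend (\<lambda>p. frag_of ((\<lambda>(x, y). (\<mu> x, \<nu> y)) p)) u) = H C" if "u \<in> C" for u
      using H(3)[of u] A.T_repr[OF C that] by simp
    thus ?thesis unfolding tensor_lift1_def using A.T_nonempty[OF C] by simp
  qed
  show "tensor_lift1 k X' Y' (\<lambda>(x, y). (\<mu> x, \<nu> y)) \<in> hom A.T B.T"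
    using H(1) eq by (auto simp: hom_def Pi_iff)
  show "\<lbrakk>x \<in> carrier X; y \<in> carrier Y\<rbrakk> \<Longrightarrow>
      tensor_lift1 k X' Y' (\<lambda>(x, y). (\<mu> x, \<nu> y)) (A.pr x y) = B.pr (\<mu> x) (\<nu> y)"
    using eq H(2) by simp
qed

text \<open>When one argument is a single generator, the formula in the other argument is the one
  treated in \<open>hom_tensor_map\<close> and so depends only on the class. Additivity extends this
  from generators to all elements; doing so for both arguments makes the double union
  collapse.\<close>

lemma tensor_lift2_bilinear:
  assumes tp: "tensor_product k X1 Y1" "tensor_product k X2 Y2" "tensor_product k X3 Y3"
    and l: "\<And>x'. x' \<in> carrier X2 \<Longrightarrow> linear_map k X1 X3 (\<lambda>x. \<mu> x x')"
      "\<And>y'. y' \<in> carrier Y2 \<Longrightarrow> linear_map k Y1 Y3 (\<lambda>y. \<nu> y y')"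
    and r: "\<And>x. x \<in> carrier X1 \<Longrightarrow> linear_map k X2 X3 (\<mu> x)"
      "\<And>y. y \<in> carrier Y1 \<Longrightarrow> linear_map k Y2 Y3 (\<nu> y)"
  defines "L \<equiv> tensor_lift2 k X3 Y3 (\<lambda>(x, y) (x', y'). (\<mu> x x', \<nu> y y'))"
  shows "B \<in> carrier (tensor_group k X2 Y2) \<Longrightarrow> (\<lambda>A. L A B) \<in> hom (tensor_group k X1 Y1) (tensor_group k X3 Y3)"
    and "A \<in> carrier (tensor_group k X1 Y1) \<Longrightarrow> L A \<in> hom (tensor_group k X2 Y2) (tensor_group k X3 Y3)"
    and "\<lbrakk>x \<in> carrier X1; y \<in> carrier Y1; x' \<in> carrier X2; y' \<in> carrier Y2\<rbrakk> \<Longrightarrow>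
      L (pure k X1 Y1 x y) (pure k X2 Y2 x' y') = pure k X3 Y3 (\<mu> x x') (\<nu> y y')"
proof -
  interpret A: tensor_product k X1 Y1 by fact
  interpret B: tensor_product k X2 Y2 by fact
  interpret C: tensor_product k X3 Y3 by fact
  let ?\<phi> = "\<lambda>(x, y) (x', y'). (\<mu> x x', \<nu> y y')"
  define G where "G u v = C.cls (frag_extend (\<lambda>p. frag_extend (\<lambda>q. frag_of (?\<phi> p q)) v) u)" for u v
  have \<phi>: "?\<phi> p q \<in> C.S" if "p \<in> A.S" "q \<in> B.S" for p q
    using that semilinearD(1)[OF l(1)] semilinearD(1)[OF l(2)] by auto
  have kv: "Poly_Mapping.keys (frag_extend (\<lambda>q. frag_of (?\<phi> p q)) v) \<subseteq> C.S"
    if "p \<in> A.S" "Poly_Mapping.keys v \<subseteq> B.S" for p v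
    by (rule keys_frag_extend_subset[OF that(2)]) (use \<phi> that in auto)
  have Gu: "(\<lambda>u. G u v) \<in> hom A.Fr C.T" if "Poly_Mapping.keys v \<subseteq> B.S" for v
    unfolding G_def by (rule hom_cls_extend[OF tp(3)]) (use kv that in blast)
  have Gv: "G u \<in> hom B.Fr C.T" if u: "Poly_Mapping.keys u \<subseteq> A.S" for u
  proof (rule homI)
    fix v assume v: "v \<in> carrier B.Fr"
    show "G u v \<in> carrier C.T" using hom_in_carrier[OF Gu, of v u] u v by simp
    fix v' assume v': "v' \<in> carrier B.Fr"
    have "Poly_Mapping.keys (frag_extend (\<lambda>p. frag_extend (\<lambda>q. frag_of (?\<phi> p q)) w) u) \<subseteq> C.S"
      if "w \<in> carrier B.Fr" for w
      by (rule keys_frag_extend_subset[OF u]) (use kv that in simp)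
    thus "G u (v \<otimes>\<^bsub>B.Fr\<^esub> v') = G u v \<otimes>\<^bsub>C.T\<^esub> G u v'"
      unfolding G_def using hom_mult[OF C.cls_hom] v v'
      by (simp add: frag_extend_add frag_extend_add_fun)
  qed
  \<comment> \<open>Both sides are homomorphisms in \<open>v\<close>, so \<open>v\<close> may be
    taken to be a generator.\<close>
  have cong1: "G u v = G u' v" if u: "u \<in> carrier A.Fr" "u' \<in> carrier A.Fr" "A.cls u = A.cls u'"
    and v: "v \<in> carrier B.Fr" for u u' v
  proof (rule hom_free_Abelian_group_eqI[OF C.T.is_group Gv Gv])
    fix q assume "q \<in> B.S"
    then obtain x' y' where q: "q = (x', y')" "x' \<in> carrier X2" "y' \<in> carrier Y2" by blast
    have eq: "(\<lambda>p. frag_of (?\<phi> p q)) = (\<lambda>p. frag_of ((\<lambda>(x, y). (\<mu> x x', \<nu> y y')) p))"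
      by (auto simp: q split: prod.splits)
    from hom_tensor_map[OF tp(1,3) l(1)[OF q(2)] l(2)[OF q(3)]] u
    show "G u (frag_of q) = G u' (frag_of q)"
      unfolding G_def frag_extend_of eq by (metis carrier_free_Abelian_group_iff)
  qed (use u v in simp_all)
  have cong2: "G u v = G u v'" if v: "v \<in> carrier B.Fr" "v' \<in> carrier B.Fr" "B.cls v = B.cls v'"
    and u: "u \<in> carrier A.Fr" for u v v'
  proof (rule hom_free_Abelian_group_eqI[OF C.T.is_group Gu Gu])
    fix p assume "p \<in> A.S"
    then obtain x y where p: "p = (x, y)" "x \<in> carrier X1" "y \<in> carrier Y1" by blast
    have eq: "(\<lambda>q. frag_of (?\<phi> p q)) = (\<lambda>q. frag_of ((\<lambda>(x', y'). (\<mu> x x', \<nu> y y')) q))"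
      by (auto simp: p split: prod.splits)
    from hom_tensor_map[OF tp(2,3) r(1)[OF p(2)] r(2)[OF p(3)]] v
    show "G (frag_of p) v = G (frag_of p) v'"
      unfolding G_def frag_extend_of eq by (metis carrier_free_Abelian_group_iff)
  qed (use u v in simp_all)
  have L: "L (A.cls u) (B.cls v) = G u v" if uv: "u \<in> carrier A.Fr" "v \<in> carrier B.Fr" for u v
  proof -
    have "G u' v' = G u v" if "u' \<in> A.cls u" "v' \<in> B.cls v" for u' v'
      using cong1[of u' u v'] cong2[of v' v u] A.cls_repr[OF uv(1) that(1)] B.cls_repr[OF uv(2) that(2)] uv by simp
    moreover have "A.cls u \<noteq> {}" "B.cls v \<noteq> {}" using A.cls_self B.cls_self uv by blast+
    ultimately show ?thesis unfolding L_def tensor_lift2_def G_def[symmetric] by simp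
  qed
  show "(\<lambda>A. L A B) \<in> hom A.T C.T" if B: "B \<in> carrier B.T" for B
  proof (rule homI)
    obtain v where v: "v \<in> carrier B.Fr" "B = B.cls v" using B unfolding B.carrier_T by blast
    note hv = Gu[of v]
    fix C assume "C \<in> carrier A.T"
    then obtain u where u: "u \<in> carrier A.Fr" "C = A.cls u" unfolding A.carrier_T by blast
    thus "L C B \<in> carrier C.T" using L v hom_in_carrier[OF hv] by simp
    fix D assume "D \<in> carrier A.T"
    then obtain w where w: "w \<in> carrier A.Fr" "D = A.cls w" unfolding A.carrier_T by blast
    have uw: "u \<otimes>\<^bsub>A.Fr\<^esub> w \<in> carrier A.Fr" using u(1) w(1) by (rule A.Fr.m_closed)
    have "C \<otimes>\<^bsub>A.T\<^esub> D = A.cls (u \<otimes>\<^bsub>A.Fr\<^esub> w)" using u w hom_mult[OF A.cls_hom] by simp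
    thus "L (C \<otimes>\<^bsub>A.T\<^esub> D) B = L C B \<otimes>\<^bsub>C.T\<^esub> L D B"
      using L[OF uw v(1)] L[OF u(1) v(1)] L[OF w(1) v(1)] hom_mult[OF hv u(1) w(1)] u v w by simp
  qed
  show "L A \<in> hom B.T C.T" if A: "A \<in> carrier A.T" for A
  proof (rule homI)
    obtain u where u: "u \<in> carrier A.Fr" "A = A.cls u" using A unfolding A.carrier_T by blast
    note hu = Gv[of u]
    fix C assume "C \<in> carrier B.T"
    then obtain v where v: "v \<in> carrier B.Fr" "C = B.cls v" unfolding B.carrier_T by blast
    thus "L A C \<in> carrier C.T" using L u hom_in_carrier[OF hu] by simp
    fix D assume "D \<in> carrier B.T"
    then obtain w where w: "w \<in> carrier B.Fr" "D = B.cls w" unfolding B.carrier_T by blast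
    have vw: "v \<otimes>\<^bsub>B.Fr\<^esub> w \<in> carrier B.Fr" using v(1) w(1) by (rule B.Fr.m_closed)
    have "C \<otimes>\<^bsub>B.T\<^esub> D = B.cls (v \<otimes>\<^bsub>B.Fr\<^esub> w)" using v w hom_mult[OF B.cls_hom] by simp
    thus "L A (C \<otimes>\<^bsub>B.T\<^esub> D) = L A C \<otimes>\<^bsub>C.T\<^esub> L A D"
      using L[OF u(1) vw] L[OF u(1) v(1)] L[OF u(1) w(1)] hom_mult[OF hu v(1) w(1)] u v w by simp
  qed
  show "\<lbrakk>x \<in> carrier X1; y \<in> carrier Y1; x' \<in> carrier X2; y' \<in> carrier Y2\<rbrakk> \<Longrightarrow>
      L (A.pr x y) (B.pr x' y') = C.pr (\<mu> x x') (\<nu> y y')"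
    using L[of "frag_of (x, y)" "frag_of (x', y')"] by (simp add: pure_def G_def)
qed

section \<open>Base change\<close>

locale base_change = k: field k + K: field K + M: right_module k R M
  for k :: "'k ring" and K :: "'c ring" and R :: "('k, 'r) module" and M :: "('r, 'm) module" +
  fixes i :: "'k \<Rightarrow> 'c"
  assumes i: "i \<in> ring_hom k K"
begin

abbreviation "Mk \<equiv> restrict_scalars R M"
abbreviation "E \<equiv> ext_space i K"
abbreviation "RK \<equiv> base_change_algebra k i K R"
abbreviation "MK \<equiv> base_change_module k i K R M"
abbreviation "pR \<equiv> pure k R E"
abbreviation "pM \<equiv> pure k Mk E"

sublocale Mk: vec_space k Mk
  by (rule vec_space_restrict_scalars[OF k.field_axioms M.right_module_axioms])
sublocale E: vec_space k E
  by (rule vec_space_ext[OF k.field_axioms K.field_axioms i])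
sublocale TR: tensor_product k R E by unfold_locales
sublocale TM: tensor_product k Mk E by unfold_locales

lemmas R_closed = M.A.m_closed M.A.one_closed M.ract_closed
lemmas i_closed [simp] = ring_hom_closed[OF i]

text \<open>Tensors form a multiplicative group in \<open>tensor_group\<close> and an additive one
  in the base change. Unfolding these equations carries facts from one notation to the
  other.\<close>

lemma RK_T: "carrier TR.T = carrier RK" "monoid.mult TR.T = ring.add RK" "\<one>\<^bsub>TR.T\<^esub> = \<zero>\<^bsub>RK\<^esub>"
  by (simp_all add: base_change_algebra_def)

lemma MK_T: "carrier TM.T = carrier MK" "monoid.mult TM.T = ring.add MK" "\<one>\<^bsub>TM.T\<^esub> = \<zero>\<^bsub>MK\<^esub>"
  by (simp_all add: base_change_module_def)

sublocale RK: abelian_group RK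
proof (rule abelian_groupI)
  fix x assume "x \<in> carrier RK"
  thus "\<exists>y\<in>carrier RK. y \<oplus>\<^bsub>RK\<^esub> x = \<zero>\<^bsub>RK\<^esub>"
    using TR.T.inv_closed[unfolded RK_T] TR.T.l_inv[unfolded RK_T] by blast
qed (use TR.T.m_closed TR.T.one_closed TR.T.m_assoc TR.T.m_comm TR.T.l_one in \<open>simp_all add: RK_T\<close>)

sublocale MK: abelian_group MK
proof (rule abelian_groupI)
  fix x assume "x \<in> carrier MK"
  thus "\<exists>y\<in>carrier MK. y \<oplus>\<^bsub>MK\<^esub> x = \<zero>\<^bsub>MK\<^esub>"
    using TM.T.inv_closed[unfolded MK_T] TM.T.l_inv[unfolded MK_T] by blast
qed (use TM.T.m_closed TM.T.one_closed TM.T.m_assoc TM.T.m_comm TM.T.l_one in \<open>simp_all add: MK_T\<close>)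

lemmas RK_induct [consumes 1, case_names pure add] = TR.tensor_induct[unfolded RK_T]
lemmas MK_induct [consumes 1, case_names pure add] = TM.tensor_induct[unfolded MK_T]

lemma pR:
  "\<lbrakk>r \<in> carrier R; a \<in> carrier K\<rbrakk> \<Longrightarrow> pR r a \<in> carrier RK"
  "\<lbrakk>r \<in> carrier R; s \<in> carrier R; a \<in> carrier K\<rbrakk> \<Longrightarrow> pR (r \<oplus>\<^bsub>R\<^esub> s) a = pR r a \<oplus>\<^bsub>RK\<^esub> pR s a"
  "\<lbrakk>r \<in> carrier R; a \<in> carrier K; b \<in> carrier K\<rbrakk> \<Longrightarrow> pR r (a \<oplus>\<^bsub>K\<^esub> b) = pR r a \<oplus>\<^bsub>RK\<^esub> pR r b"
  "\<lbrakk>c \<in> carrier k; r \<in> carrier R; a \<in> carrier K\<rbrakk> \<Longrightarrow> pR (c \<odot>\<^bsub>R\<^esub> r) a = pR r (i c \<otimes>\<^bsub>K\<^esub> a)"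
  using TR.balanced_pr[unfolded balanced_def RK_T] by auto

lemma pM:
  "\<lbrakk>x \<in> carrier M; a \<in> carrier K\<rbrakk> \<Longrightarrow> pM x a \<in> carrier MK"
  "\<lbrakk>x \<in> carrier M; y \<in> carrier M; a \<in> carrier K\<rbrakk> \<Longrightarrow> pM (x \<oplus>\<^bsub>M\<^esub> y) a = pM x a \<oplus>\<^bsub>MK\<^esub> pM y a"
  "\<lbrakk>x \<in> carrier M; a \<in> carrier K; b \<in> carrier K\<rbrakk> \<Longrightarrow> pM x (a \<oplus>\<^bsub>K\<^esub> b) = pM x a \<oplus>\<^bsub>MK\<^esub> pM x b"
  "\<lbrakk>c \<in> carrier k; x \<in> carrier M; a \<in> carrier K\<rbrakk> \<Longrightarrow>
    pM ((c \<odot>\<^bsub>R\<^esub> \<one>\<^bsub>R\<^esub>) \<odot>\<^bsub>M\<^esub> x) a = pM x (i c \<otimes>\<^bsub>K\<^esub> a)"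
  using TM.balanced_pr[unfolded balanced_def MK_T] by auto

lemma E_linear: "a \<in> carrier K \<Longrightarrow> linear_map k E E (\<lambda>b. a \<otimes>\<^bsub>K\<^esub> b)" "a \<in> carrier K \<Longrightarrow> linear_map k E E (\<lambda>b. b \<otimes>\<^bsub>K\<^esub> a)"
  by (auto intro!: semilinearI simp: K.r_distr K.l_distr K.m_ac)

lemma id_linear: "linear_map k X X (\<lambda>x. x)"
  by (auto intro!: semilinearI)

lemma RK_one: "\<one>\<^bsub>RK\<^esub> = pR \<one>\<^bsub>R\<^esub> \<one>\<^bsub>K\<^esub>"
  by (simp add: base_change_algebra_def pure_def)

section \<open>Operations on tensors and the laws of \<open>R_K\<close> and
  \<open>M_K\<close>\<close>

lemma RK_smult:
  assumes "c \<in> carrier K"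
  shows "A \<in> carrier RK \<Longrightarrow> c \<odot>\<^bsub>RK\<^esub> A \<in> carrier RK"
    and "\<lbrakk>A \<in> carrier RK; B \<in> carrier RK\<rbrakk> \<Longrightarrow> c \<odot>\<^bsub>RK\<^esub> (A \<oplus>\<^bsub>RK\<^esub> B) = c \<odot>\<^bsub>RK\<^esub> A \<oplus>\<^bsub>RK\<^esub> c \<odot>\<^bsub>RK\<^esub> B"
    and "\<lbrakk>r \<in> carrier R; a \<in> carrier K\<rbrakk> \<Longrightarrow> c \<odot>\<^bsub>RK\<^esub> pR r a = pR r (c \<otimes>\<^bsub>K\<^esub> a)"
proof -
  have s: "(\<odot>\<^bsub>RK\<^esub>) c = tensor_lift1 k R E (\<lambda>(r, a). (r, c \<otimes>\<^bsub>K\<^esub> a))"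
    by (simp add: base_change_algebra_def)
  note L = tensor_lift1_linear[OF TR.tensor_product_axioms TR.tensor_product_axioms id_linear E_linear(1)[OF assms],
      folded s, unfolded hom_def RK_T]
  from L show "A \<in> carrier RK \<Longrightarrow> c \<odot>\<^bsub>RK\<^esub> A \<in> carrier RK"
    and "\<lbrakk>A \<in> carrier RK; B \<in> carrier RK\<rbrakk> \<Longrightarrow> c \<odot>\<^bsub>RK\<^esub> (A \<oplus>\<^bsub>RK\<^esub> B) = c \<odot>\<^bsub>RK\<^esub> A \<oplus>\<^bsub>RK\<^esub> c \<odot>\<^bsub>RK\<^esub> B"
    and "\<lbrakk>r \<in> carrier R; a \<in> carrier K\<rbrakk> \<Longrightarrow> c \<odot>\<^bsub>RK\<^esub> pR r a = pR r (c \<otimes>\<^bsub>K\<^esub> a)"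
    by auto
qed

lemma RK_mult:
  shows "\<lbrakk>A \<in> carrier RK; B \<in> carrier RK\<rbrakk> \<Longrightarrow> A \<otimes>\<^bsub>RK\<^esub> B \<in> carrier RK"
    and "\<lbrakk>A \<in> carrier RK; B \<in> carrier RK; C \<in> carrier RK\<rbrakk> \<Longrightarrow>
      (A \<oplus>\<^bsub>RK\<^esub> B) \<otimes>\<^bsub>RK\<^esub> C = A \<otimes>\<^bsub>RK\<^esub> C \<oplus>\<^bsub>RK\<^esub> B \<otimes>\<^bsub>RK\<^esub> C"
    and "\<lbrakk>A \<in> carrier RK; B \<in> carrier RK; C \<in> carrier RK\<rbrakk> \<Longrightarrow>
      A \<otimes>\<^bsub>RK\<^esub> (B \<oplus>\<^bsub>RK\<^esub> C) = A \<otimes>\<^bsub>RK\<^esub> B \<oplus>\<^bsub>RK\<^esub> A \<otimes>\<^bsub>RK\<^esub> C"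
    and "\<lbrakk>r \<in> carrier R; a \<in> carrier K; s \<in> carrier R; b \<in> carrier K\<rbrakk> \<Longrightarrow>
      pR r a \<otimes>\<^bsub>RK\<^esub> pR s b = pR (r \<otimes>\<^bsub>R\<^esub> s) (a \<otimes>\<^bsub>K\<^esub> b)"
proof -
  have m: "(\<otimes>\<^bsub>RK\<^esub>) = tensor_lift2 k R E (\<lambda>(r, a) (s, b). (r \<otimes>\<^bsub>R\<^esub> s, a \<otimes>\<^bsub>K\<^esub> b))"
    by (simp add: base_change_algebra_def)
  note L = tensor_lift2_bilinear[OF TR.tensor_product_axioms TR.tensor_product_axioms TR.tensor_product_axioms,
      of "(\<otimes>\<^bsub>R\<^esub>)" "(\<otimes>\<^bsub>K\<^esub>)", folded m, unfolded hom_def RK_T ext_space_simps]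
  note ml = mult_linear[OF M.A.nc_algebra_axioms]
  note L' = L(1)[OF ml(1) E_linear(2) ml(2) E_linear(1)] L(2)[OF ml(1) E_linear(2) ml(2) E_linear(1)]
    L(3)[OF ml(1) E_linear(2) ml(2) E_linear(1)]
  from L' show "\<lbrakk>A \<in> carrier RK; B \<in> carrier RK\<rbrakk> \<Longrightarrow> A \<otimes>\<^bsub>RK\<^esub> B \<in> carrier RK"
    and "\<lbrakk>A \<in> carrier RK; B \<in> carrier RK; C \<in> carrier RK\<rbrakk> \<Longrightarrow>
      (A \<oplus>\<^bsub>RK\<^esub> B) \<otimes>\<^bsub>RK\<^esub> C = A \<otimes>\<^bsub>RK\<^esub> C \<oplus>\<^bsub>RK\<^esub> B \<otimes>\<^bsub>RK\<^esub> C"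
    and "\<lbrakk>A \<in> carrier RK; B \<in> carrier RK; C \<in> carrier RK\<rbrakk> \<Longrightarrow>
      A \<otimes>\<^bsub>RK\<^esub> (B \<oplus>\<^bsub>RK\<^esub> C) = A \<otimes>\<^bsub>RK\<^esub> B \<oplus>\<^bsub>RK\<^esub> A \<otimes>\<^bsub>RK\<^esub> C"
    and "\<lbrakk>r \<in> carrier R; a \<in> carrier K; s \<in> carrier R; b \<in> carrier K\<rbrakk> \<Longrightarrow>
      pR r a \<otimes>\<^bsub>RK\<^esub> pR s b = pR (r \<otimes>\<^bsub>R\<^esub> s) (a \<otimes>\<^bsub>K\<^esub> b)"
    by auto
qed

lemma MK_act:
  shows "\<lbrakk>A \<in> carrier RK; C \<in> carrier MK\<rbrakk> \<Longrightarrow> A \<odot>\<^bsub>MK\<^esub> C \<in> carrier MK"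
    and "\<lbrakk>A \<in> carrier RK; B \<in> carrier RK; C \<in> carrier MK\<rbrakk> \<Longrightarrow>
      (A \<oplus>\<^bsub>RK\<^esub> B) \<odot>\<^bsub>MK\<^esub> C = A \<odot>\<^bsub>MK\<^esub> C \<oplus>\<^bsub>MK\<^esub> B \<odot>\<^bsub>MK\<^esub> C"
    and "\<lbrakk>A \<in> carrier RK; C \<in> carrier MK; D \<in> carrier MK\<rbrakk> \<Longrightarrow>
      A \<odot>\<^bsub>MK\<^esub> (C \<oplus>\<^bsub>MK\<^esub> D) = A \<odot>\<^bsub>MK\<^esub> C \<oplus>\<^bsub>MK\<^esub> A \<odot>\<^bsub>MK\<^esub> D"
    and "\<lbrakk>r \<in> carrier R; a \<in> carrier K; x \<in> carrier M; b \<in> carrier K\<rbrakk> \<Longrightarrow>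
      pR r a \<odot>\<^bsub>MK\<^esub> pM x b = pM (r \<odot>\<^bsub>M\<^esub> x) (b \<otimes>\<^bsub>K\<^esub> a)"
proof -
  have m: "(\<odot>\<^bsub>MK\<^esub>) = tensor_lift2 k Mk E (\<lambda>(r, a) (x, b). (r \<odot>\<^bsub>M\<^esub> x, b \<otimes>\<^bsub>K\<^esub> a))"
    by (simp add: base_change_module_def)
  note L = tensor_lift2_bilinear[OF TR.tensor_product_axioms TM.tensor_product_axioms TM.tensor_product_axioms,
      of "(\<odot>\<^bsub>M\<^esub>)" "\<lambda>a b. b \<otimes>\<^bsub>K\<^esub> a", folded m, unfolded hom_def RK_T MK_T ext_space_simps restrict_scalars_simps]
  note ml = act_linear[OF M.right_module_axioms]
  note L' = L(1)[OF ml(1) E_linear(1) ml(2) E_linear(2)] L(2)[OF ml(1) E_linear(1) ml(2) E_linear(2)]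
    L(3)[OF ml(1) E_linear(1) ml(2) E_linear(2)]
  from L' show "\<lbrakk>A \<in> carrier RK; C \<in> carrier MK\<rbrakk> \<Longrightarrow> A \<odot>\<^bsub>MK\<^esub> C \<in> carrier MK"
    and "\<lbrakk>A \<in> carrier RK; B \<in> carrier RK; C \<in> carrier MK\<rbrakk> \<Longrightarrow>
      (A \<oplus>\<^bsub>RK\<^esub> B) \<odot>\<^bsub>MK\<^esub> C = A \<odot>\<^bsub>MK\<^esub> C \<oplus>\<^bsub>MK\<^esub> B \<odot>\<^bsub>MK\<^esub> C"
    and "\<lbrakk>A \<in> carrier RK; C \<in> carrier MK; D \<in> carrier MK\<rbrakk> \<Longrightarrow>
      A \<odot>\<^bsub>MK\<^esub> (C \<oplus>\<^bsub>MK\<^esub> D) = A \<odot>\<^bsub>MK\<^esub> C \<oplus>\<^bsub>MK\<^esub> A \<odot>\<^bsub>MK\<^esub> D"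
    and "\<lbrakk>r \<in> carrier R; a \<in> carrier K; x \<in> carrier M; b \<in> carrier K\<rbrakk> \<Longrightarrow>
      pR r a \<odot>\<^bsub>MK\<^esub> pM x b = pM (r \<odot>\<^bsub>M\<^esub> x) (b \<otimes>\<^bsub>K\<^esub> a)"
    by auto
qed

lemma RK_one_closed: "\<one>\<^bsub>RK\<^esub> \<in> carrier RK"
  unfolding RK_one by (rule pR(1)[OF M.A.one_closed K.one_closed])

text \<open>Both sides are additive in each argument, so three nested inductions reduce the law to
  pure tensors. The algebra and module laws below are reduced in the same way.\<close>

lemma RK_assoc:
  assumes "A \<in> carrier RK" "B \<in> carrier RK" "C \<in> carrier RK"
  shows "A \<otimes>\<^bsub>RK\<^esub> B \<otimes>\<^bsub>RK\<^esub> C = A \<otimes>\<^bsub>RK\<^esub> (B \<otimes>\<^bsub>RK\<^esub> C)"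
  using assms(1)
proof (induction A rule: RK_induct)
  case (pure r a)
  show ?case using assms(2)
  proof (induction B rule: RK_induct)
    case (pure s b)
    show ?case using assms(3)
      by (induction C rule: RK_induct)
        (use pure \<open>r \<in> _\<close> \<open>a \<in> _\<close> in \<open>simp_all add: RK_mult pR(1) R_closed M.A.m_assoc K.m_assoc\<close>)
  qed (use pure assms(3) in \<open>simp add: RK_mult pR(1)\<close>)
qed (use assms in \<open>simp add: RK_mult\<close>)

lemma nc_algebra_RK: "nc_algebra K RK"
proof -
  have mod: "module K RK"
  proof (rule moduleI)
    fix c d A assume c: "c \<in> carrier K" "d \<in> carrier K" and A: "A \<in> carrier RK"
    show "(c \<oplus>\<^bsub>K\<^esub> d) \<odot>\<^bsub>RK\<^esub> A = c \<odot>\<^bsub>RK\<^esub> A \<oplus>\<^bsub>RK\<^esub> d \<odot>\<^bsub>RK\<^esub> A"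
      using A by (induction A rule: RK_induct) (use c in \<open>simp_all add: RK_smult pR K.l_distr RK.a_ac\<close>)
    show "(c \<otimes>\<^bsub>K\<^esub> d) \<odot>\<^bsub>RK\<^esub> A = c \<odot>\<^bsub>RK\<^esub> (d \<odot>\<^bsub>RK\<^esub> A)"
      using A by (induction A rule: RK_induct) (use c in \<open>simp_all add: RK_smult pR K.m_assoc\<close>)
  next
    fix A assume A: "A \<in> carrier RK"
    show "\<one>\<^bsub>K\<^esub> \<odot>\<^bsub>RK\<^esub> A = A"
      using A by (induction A rule: RK_induct) (simp_all add: RK_smult pR)
  qed (simp_all add: RK_smult K.is_cring RK.abelian_group_axioms)
  have l1: "\<one>\<^bsub>RK\<^esub> \<otimes>\<^bsub>RK\<^esub> A = A" and r1: "A \<otimes>\<^bsub>RK\<^esub> \<one>\<^bsub>RK\<^esub> = A" if A: "A \<in> carrier RK" for A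
  proof -
    show "\<one>\<^bsub>RK\<^esub> \<otimes>\<^bsub>RK\<^esub> A = A" using A
      by (induction A rule: RK_induct) (simp_all add: RK_one RK_mult pR(1) R_closed)
    show "A \<otimes>\<^bsub>RK\<^esub> \<one>\<^bsub>RK\<^esub> = A" using A
      by (induction A rule: RK_induct) (simp_all add: RK_one RK_mult pR(1) R_closed)
  qed
  have ring: "ring RK"
  proof (rule ringI)
    show "monoid RK" by (rule monoidI) (simp_all add: RK_mult RK_one_closed l1 r1 RK_assoc)
  qed (simp_all add: RK.abelian_group_axioms RK_mult)
  have "nc_algebra_axioms K RK"
  proof
    fix c A B assume c: "c \<in> carrier K" and A: "A \<in> carrier RK" and B: "B \<in> carrier RK"
    show "c \<odot>\<^bsub>RK\<^esub> A \<otimes>\<^bsub>RK\<^esub> B = c \<odot>\<^bsub>RK\<^esub> (A \<otimes>\<^bsub>RK\<^esub> B)"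
      using A
    proof (induction A rule: RK_induct)
      case (pure r a)
      show ?case using B
        by (induction B rule: RK_induct)
          (use pure c in \<open>simp_all add: RK_smult RK_mult pR(1) R_closed K.m_assoc\<close>)
    qed (use c B in \<open>simp add: RK_smult RK_mult\<close>)
    show "A \<otimes>\<^bsub>RK\<^esub> (c \<odot>\<^bsub>RK\<^esub> B) = c \<odot>\<^bsub>RK\<^esub> (A \<otimes>\<^bsub>RK\<^esub> B)"
      using A
    proof (induction A rule: RK_induct)
      case (pure r a)
      show ?case using B
        by (induction B rule: RK_induct)
          (use pure c in \<open>simp_all add: RK_smult RK_mult pR(1) R_closed K.m_lcomm\<close>)
    qed (use c B in \<open>simp add: RK_smult RK_mult\<close>)
  qed
  with mod ring show ?thesis by (simp add: nc_algebra_def)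
qed

lemma right_module_MK: "right_module K RK MK"
proof -
  have "right_module_axioms RK MK"
  proof
    fix A B C assume A: "A \<in> carrier RK" and B: "B \<in> carrier RK" and C: "C \<in> carrier MK"
    show "(A \<otimes>\<^bsub>RK\<^esub> B) \<odot>\<^bsub>MK\<^esub> C = B \<odot>\<^bsub>MK\<^esub> (A \<odot>\<^bsub>MK\<^esub> C)"
      using A
    proof (induction A rule: RK_induct)
      case (pure r a)
      show ?case using B
      proof (induction B rule: RK_induct)
        case (pure s b)
        show ?case using C
          by (induction C rule: MK_induct)
            (use pure \<open>r \<in> _\<close> \<open>a \<in> _\<close> in
              \<open>simp_all add: RK_mult MK_act pR(1) pM(1) R_closed M.ract_assoc K.m_assoc\<close>)
      qed (use pure C in \<open>simp add: RK_mult MK_act pR(1)\<close>)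
    qed (use B C in \<open>simp add: RK_mult MK_act\<close>)
  next
    fix C assume "C \<in> carrier MK"
    thus "\<one>\<^bsub>RK\<^esub> \<odot>\<^bsub>MK\<^esub> C = C"
      by (induction C rule: MK_induct)
        (simp_all add: RK_one MK_act pR(1) R_closed M.ract_one)
  qed (simp_all add: MK_act)
  thus ?thesis using nc_algebra_RK MK.abelian_group_axioms by (simp add: right_module_def)
qed

text \<open>On the vector space underlying \<open>M_K\<close> the scalar \<open>c\<close> acts
  through \<open>c \<odot> 1 = 1 \<otimes> c\<close>, that is, on the coefficient.\<close>

lemma smult_pM:
  assumes "c \<in> carrier K" "x \<in> carrier M" "a \<in> carrier K"
  shows "c \<odot>\<^bsub>restrict_scalars RK MK\<^esub> pM x a = pM x (c \<otimes>\<^bsub>K\<^esub> a)"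
  using assms by (simp add: RK_one RK_smult(3) MK_act(4) R_closed M.ract_one K.m_comm)

section \<open>The canonical maps into \<open>R_K\<close> and \<open>M_K\<close>\<close>

definition "jR r = pR r \<one>\<^bsub>K\<^esub>"
definition "jM x = pM x \<one>\<^bsub>K\<^esub>"

lemma jR_semilinear: "semilinear i k R RK jR"
  by (rule semilinearI) (simp_all add: jR_def pR RK_smult)

lemma jM_semilinear: "semilinear i k Mk (restrict_scalars RK MK) jM"
proof (rule semilinearI)
  fix c x assume "c \<in> carrier k" "x \<in> carrier Mk"
  thus "jM (c \<odot>\<^bsub>Mk\<^esub> x) = i c \<odot>\<^bsub>restrict_scalars RK MK\<^esub> jM x"
    unfolding jM_def by (subst smult_pM) (simp_all add: pM)
qed (simp_all add: jM_def pM)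

sublocale SE: scalar_extension k K R M RK MK i jR
proof -
  interpret MK': right_module K RK MK by (rule right_module_MK)
  show "scalar_extension k K R M RK MK i jR"
    by unfold_locales (simp_all add: i jR_semilinear, simp_all add: jR_def RK_mult R_closed RK_one)
qed

text \<open>\<open>r \<otimes> a\<close> is \<open>a\<close> times
  \<open>r \<otimes> 1\<close>.\<close>

lemma RK_generated: "carrier RK \<subseteq> lin_span K RK (jR ` carrier R)"
proof
  have c: "jR ` carrier R \<subseteq> carrier RK" by (auto simp: jR_def pR)
  note sm = SE.RK.span_submodule[OF c]
  fix A assume "A \<in> carrier RK"
  thus "A \<in> lin_span K RK (jR ` carrier R)"
  proof (induction A rule: RK_induct)
    case (pure r a)
    have "jR r \<in> lin_span K RK (jR ` carrier R)" using SE.RK.span_superset pure by blast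
    from SE.RK.sub_smult[OF sm pure(2)[simplified] this] show ?case
      using pure by (simp add: jR_def RK_smult)
  qed (rule SE.RK.sub_add[OF sm])
qed

lemma MK_generated: "carrier MK \<subseteq> lin_span K (restrict_scalars RK MK) (jM ` carrier M)"
proof
  have c: "jM ` carrier M \<subseteq> carrier (restrict_scalars RK MK)" by (auto simp: jM_def pM)
  note sm = SE.MK.span_submodule[OF c]
  fix A assume "A \<in> carrier MK"
  thus "A \<in> lin_span K (restrict_scalars RK MK) (jM ` carrier M)"
  proof (induction A rule: MK_induct)
    case (pure x a)
    hence x: "x \<in> carrier M" "a \<in> carrier K" by simp_all
    have "jM x \<in> lin_span K (restrict_scalars RK MK) (jM ` carrier M)" using SE.MK.span_superset x by blast
    from SE.MK.sub_smult[OF sm x(2) this] have "a \<odot>\<^bsub>restrict_scalars RK MK\<^esub> pM x \<one>\<^bsub>K\<^esub> \<in> lin_span K (restrict_scalars RK MK) (jM ` carrier M)"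
      by (simp only: jM_def)
    thus ?case using smult_pM[of a x "\<one>\<^bsub>K\<^esub>"] x by simp
  next
    case (add A B)
    from SE.MK.sub_add[OF sm add(3,4)] show ?case by simp
  qed
qed

section \<open>Functionals on \<open>M_K\<close> induced from \<open>M\<close>\<close>

abbreviation "KK \<equiv> ext_space (\<lambda>c. c) K"
abbreviation "MKv \<equiv> restrict_scalars RK MK"

text \<open>\<open>f\<close> is the base change of \<open>\<mu>\<close>: sending
  \<open>(x, a)\<close> to \<open>i (\<mu> x) a\<close> is balanced, and \<open>K\<close>-linearity
  is checked on pure tensors.\<close>

lemma extend_functional:
  assumes \<mu>: "linear_map k Mk (ext_space (\<lambda>c. c) k) \<mu>"
  obtains f where "linear_map K MKv KK f"
    "\<And>x a. \<lbrakk>x \<in> carrier M; a \<in> carrier K\<rbrakk> \<Longrightarrow> f (pM x a) = i (\<mu> x) \<otimes>\<^bsub>K\<^esub> a"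
proof -
  note D = semilinearD[OF \<mu>, simplified]
  \<comment> \<open>The additive group of \<open>K\<close>, rewritten multiplicatively as
    \<open>tensor_universal\<close> expects.\<close>
  define G where "G = \<lparr>carrier = carrier K, monoid.mult = ring.add K, one = ring.zero K\<rparr>"
  have G: "comm_group G"
    unfolding G_def by (rule comm_groupI) (auto simp: K.a_ac intro: bexI[of _ "\<ominus>\<^bsub>K\<^esub> _"] K.l_neg)
  have "balanced k Mk E G (\<lambda>x a. i (\<mu> x) \<otimes>\<^bsub>K\<^esub> a)"
    unfolding balanced_def G_def
    using D by (auto simp: ring_hom_add[OF i] ring_hom_mult[OF i] K.l_distr K.r_distr K.m_ac)
  then obtain f where f: "f \<in> hom TM.T G"
    "\<And>x a. \<lbrakk>x \<in> carrier M; a \<in> carrier K\<rbrakk> \<Longrightarrow> f (pM x a) = i (\<mu> x) \<otimes>\<^bsub>K\<^esub> a"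
    using TM.tensor_universal[OF G] by (metis ext_space_simps(1) restrict_scalars_simps(1))
  have fc: "f A \<in> carrier K" if "A \<in> carrier MK" for A
    using hom_in_carrier[OF f(1)] that by (simp add: MK_T G_def)
  have fa: "f (A \<oplus>\<^bsub>MK\<^esub> B) = f A \<oplus>\<^bsub>K\<^esub> f B" if "A \<in> carrier MK" "B \<in> carrier MK" for A B
    using hom_mult[OF f(1)] that by (simp add: MK_T G_def)
  have "linear_map K MKv KK f"
  proof (rule semilinearI)
    fix c A assume c: "c \<in> carrier K" and "A \<in> carrier MKv"
    hence "A \<in> carrier MK" by simp
    thus "f (c \<odot>\<^bsub>MKv\<^esub> A) = c \<odot>\<^bsub>KK\<^esub> f A"
    proof (induction A rule: MK_induct)
      case (pure x a)
      thus ?case using smult_pM[OF c, of x a] f(2)[of x] c D(1)[of x] by (simp add: K.m_lcomm)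
    next
      case (add A B)
      have "c \<odot>\<^bsub>MKv\<^esub> (A \<oplus>\<^bsub>MK\<^esub> B) = c \<odot>\<^bsub>MKv\<^esub> A \<oplus>\<^bsub>MK\<^esub> c \<odot>\<^bsub>MKv\<^esub> B"
        using SE.MK.smult_r_distr[OF c, of A B] add(1,2) by simp
      moreover have "c \<odot>\<^bsub>MKv\<^esub> A \<in> carrier MK" "c \<odot>\<^bsub>MKv\<^esub> B \<in> carrier MK"
        using SE.MK.smult_closed[OF c] add(1,2) by simp_all
      ultimately show ?case using add c fa fc by (simp add: K.r_distr)
    qed
  qed (simp_all add: fc fa)
  with that f(2) show ?thesis by blast
qed

text \<open>Not the full dual of \<open>M_K\<close>: a functional induced from \<open>M\<close> maps
  \<open>M \<otimes> A\<close> into \<open>A\<close> for every \<open>k\<close>-subspace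
  \<open>A\<close> of \<open>K\<close>, which an arbitrary \<open>K\<close>-linear functional need
  not do.\<close>

definition functionals :: "(('m \<times> 'c \<Rightarrow>\<^sub>0 int) set \<Rightarrow> 'c) set" where
  "functionals = {f. linear_map K MKv KK f \<and>
     (\<exists>\<mu>. linear_map k Mk (ext_space (\<lambda>c. c) k) \<mu> \<and>
       (\<forall>x\<in>carrier M. \<forall>a\<in>carrier K. f (pM x a) = i (\<mu> x) \<otimes>\<^bsub>K\<^esub> a))}"

text \<open>Write \<open>y\<close> as \<open>c (b \<otimes> 1)\<close> plus a combination of the
  other elements. A functional on \<open>M\<close> that is 1 at \<open>b\<close> and 0 on the others
  induces one that takes the value \<open>c\<close> at \<open>y\<close>; so the coefficients vanish
  one after another.\<close>

lemma functionals_separate_span: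
  assumes "finite B" "Mk.indep B" "y \<in> lin_span K MKv (jM ` B)" "\<forall>f\<in>functionals. f y = \<zero>\<^bsub>K\<^esub>"
  shows "y = \<zero>\<^bsub>MK\<^esub>"
  using assms
proof (induction B arbitrary: y rule: finite_induct)
  case empty
  thus ?case using SE.MK.span_empty by simp
next
  case (insert b B)
  have B: "Mk.indep B" using Mk.indep_subset insert.prems(1) by blast
  have bB: "b \<in> carrier M" "B \<subseteq> carrier M" "b \<notin> lin_span k Mk B"
    using insert.prems(1) insert.hyps(2) by (auto simp: Mk.indep_def)
  have jB: "jM ` B \<subseteq> carrier MKv" "jM b \<in> carrier MKv"
    using bB semilinearD(1)[OF jM_semilinear] by auto
  obtain c y' where c: "c \<in> carrier K" and y': "y' \<in> lin_span K MKv (jM ` B)"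
    and y: "y = c \<odot>\<^bsub>MKv\<^esub> jM b \<oplus>\<^bsub>MKv\<^esub> y'"
    using SE.MK.span_insertE[OF jB] insert.prems(2) by auto
  have y'c: "y' \<in> carrier MKv" using SE.MK.span_carrier[OF jB(1)] y' by blast
  have Bk: "B \<subseteq> carrier Mk" "b \<in> carrier Mk" using bB by simp_all
  obtain \<mu> where \<mu>: "linear_map k Mk (ext_space (\<lambda>c. c) k) \<mu>" "\<mu> b = \<one>\<^bsub>k\<^esub>"
    "\<And>h. h \<in> lin_span k Mk B \<Longrightarrow> \<mu> h = \<zero>\<^bsub>k\<^esub>"
    using Mk.separating_functional[OF Mk.span_submodule[OF Bk(1)] Bk(2) bB(3)] by blast
  obtain f where f: "linear_map K MKv KK f"
    "\<And>x a. \<lbrakk>x \<in> carrier M; a \<in> carrier K\<rbrakk> \<Longrightarrow> f (pM x a) = i (\<mu> x) \<otimes>\<^bsub>K\<^esub> a"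
    using extend_functional[OF \<mu>(1)] by blast
  interpret KK: vec_space K KK by (rule vec_space_ext_self[OF K.field_axioms])
  have i01: "i \<zero>\<^bsub>k\<^esub> = \<zero>\<^bsub>K\<^esub>" "i \<one>\<^bsub>k\<^esub> = \<one>\<^bsub>K\<^esub>"
    using ring_hom_zero[OF i k.ring_axioms K.ring_axioms] ring_hom_one[OF i] by simp_all
  have "f (jM b') = \<zero>\<^bsub>K\<^esub>" if "b' \<in> B" for b'
  proof -
    have "b' \<in> carrier M" "\<mu> b' = \<zero>\<^bsub>k\<^esub>" using \<mu>(3) Mk.span_superset[of B] that bB(2) by blast+
    thus ?thesis using f(2)[of b' "\<one>\<^bsub>K\<^esub>"] i01 by (simp add: jM_def)
  qed
  hence "f ` lin_span K MKv (jM ` B) \<subseteq> {\<zero>\<^bsub>K\<^esub>}"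
    using KK.span_empty KK.span_submodule[of "{}"]
    by (intro semilinear_span[OF SE.MK.vec_space_axioms KK.vec_space_axioms _ f(1) jB(1)]) auto
  hence "f y' = \<zero>\<^bsub>K\<^esub>" using y' by blast
  moreover have "f (jM b) = \<one>\<^bsub>K\<^esub>" using f(2)[of b "\<one>\<^bsub>K\<^esub>"] \<mu>(2) bB i01 by (simp add: jM_def)
  ultimately have "f y = c"
    using semilinearD(2)[OF f(1) SE.MK.smult_closed[OF c jB(2)] y'c] semilinearD(3)[OF f(1) c jB(2)] c
    unfolding y by simp
  moreover have "f \<in> functionals" using f \<mu>(1) unfolding functionals_def by blast
  ultimately have c0: "c = \<zero>\<^bsub>K\<^esub>" using insert.prems(3) by auto
  hence "y = y'" using y SE.MK.smult_l_null[OF jB(2)] SE.MK.M.l_zero[OF y'c] by simp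
  thus ?case using insert.IH[OF B] y' insert.prems(3) by simp
qed

text \<open>An element of \<open>M_K\<close> involves only finitely many elements of
  \<open>M\<close>; a \<open>k\<close>-basis of their span provides the set \<open>B\<close> for
  \<open>functionals_separate_span\<close>.\<close>

lemma functionals_separate:
  assumes "y \<in> carrier MK" "y \<noteq> \<zero>\<^bsub>MK\<^esub>"
  shows "\<exists>f\<in>functionals. f y \<noteq> \<zero>\<^bsub>K\<^esub>"
proof -
  have jc: "jM ` U \<subseteq> carrier MKv" if "U \<subseteq> carrier M" for U
    using semilinearD(1)[OF jM_semilinear] that by auto
  have "{y} \<subseteq> lin_span K MKv (jM ` carrier M)" using MK_generated assms(1) by blast
  from SE.MK.span_finite_subset[OF jc[OF order_refl] _ this] obtain S1 where
    S1: "finite S1" "S1 \<subseteq> jM ` carrier M" "{y} \<subseteq> lin_span K MKv S1" by auto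
  then obtain S where S: "S \<subseteq> carrier M" "finite S" "S1 = jM ` S" using finite_subset_image by meson
  have Sk: "S \<subseteq> carrier Mk" using S by simp
  note sm = Mk.span_submodule[OF Sk]
  obtain B where B: "finite B" "is_basis k Mk (lin_span k Mk S) B"
    using Mk.basis_exists[OF sm S(2) Sk order_refl] by blast
  note ind = Mk.is_basis_indep[OF sm B(2)]
  have Bc: "B \<subseteq> carrier Mk" using ind by (simp add: Mk.indep_def)
  have "jM ` lin_span k Mk B \<subseteq> lin_span K MKv (jM ` B)"
    using jc[of B] Bc
    by (intro semilinear_span[OF Mk.vec_space_axioms SE.MK.vec_space_axioms SE.ic jM_semilinear Bc
          SE.MK.span_superset] SE.MK.span_submodule) auto
  moreover have "S \<subseteq> lin_span k Mk B" using Mk.span_superset[of S] B(2) by (simp add: is_basis_def)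
  ultimately have "jM ` S \<subseteq> lin_span K MKv (jM ` B)" by blast
  from SE.MK.span_subset[OF _ this] jc[of B] Bc S S1
  have "y \<in> lin_span K MKv (jM ` B)" by auto
  from functionals_separate_span[OF B(1) ind this] assms(2) show ?thesis by blast
qed

text \<open>The contraction \<open>id \<otimes> l\<close> from \<open>M \<otimes> K\<close> to
  \<open>M \<otimes> k = M\<close>.\<close>

lemma functional_on_coefficients:
  assumes l: "linear_map k E (ext_space (\<lambda>c. c) k) l"
  obtains p where "p \<in> carrier MK \<rightarrow> carrier M"
    "\<And>A B. \<lbrakk>A \<in> carrier MK; B \<in> carrier MK\<rbrakk> \<Longrightarrow> p (A \<oplus>\<^bsub>MK\<^esub> B) = p A \<oplus>\<^bsub>M\<^esub> p B"
    "\<And>x a. \<lbrakk>x \<in> carrier M; a \<in> carrier K\<rbrakk> \<Longrightarrow> p (pM x a) = l a \<odot>\<^bsub>Mk\<^esub> x"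
proof -
  note D = semilinearD[OF l, simplified]
  define G where "G = \<lparr>carrier = carrier M, monoid.mult = ring.add M, one = ring.zero M\<rparr>"
  have G: "comm_group G"
    unfolding G_def by (rule comm_groupI) (auto simp: M.M.a_ac intro: bexI[of _ "\<ominus>\<^bsub>M\<^esub> _"] M.M.l_neg)
  have "balanced k Mk E G (\<lambda>x a. l a \<odot>\<^bsub>Mk\<^esub> x)"
    unfolding balanced_def
  proof (intro conjI ballI)
    fix c x a assume "c \<in> carrier k" "x \<in> carrier Mk" "a \<in> carrier E"
    thus "l a \<odot>\<^bsub>Mk\<^esub> (c \<odot>\<^bsub>Mk\<^esub> x) = l (c \<odot>\<^bsub>E\<^esub> a) \<odot>\<^bsub>Mk\<^esub> x"
      using D(1)[of a] D(3)[of c a] Mk.smult_assoc1[of "l a" c x] by (simp del: restrict_scalars_simps(4) add: k.m_comm)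
  qed (use D in \<open>simp_all add: G_def Mk.smult_r_distr[simplified] Mk.smult_l_distr[simplified] Mk.smult_closed[simplified]\<close>)
  then obtain p where p: "p \<in> hom TM.T G"
    "\<And>x a. \<lbrakk>x \<in> carrier M; a \<in> carrier K\<rbrakk> \<Longrightarrow> p (pM x a) = l a \<odot>\<^bsub>Mk\<^esub> x"
    using TM.tensor_universal[OF G] by (metis ext_space_simps(1) restrict_scalars_simps(1))
  show ?thesis
  proof (rule that)
    show "p \<in> carrier MK \<rightarrow> carrier M" using p(1) by (auto simp: hom_def MK_T G_def)
    show "p (A \<oplus>\<^bsub>MK\<^esub> B) = p A \<oplus>\<^bsub>M\<^esub> p B" if "A \<in> carrier MK" "B \<in> carrier MK" for A B
      using hom_mult[OF p(1)] that by (simp add: MK_T G_def)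
  qed (rule p(2))
qed

text \<open>If \<open>z\<close> is the sum of the \<open>x_j \<otimes> a_j\<close>, then
  \<open>f (z r)\<close> is the sum of the \<open>\<mu> (x_j r) a_j\<close>, a
  \<open>k\<close>-combination of the \<open>a_j\<close>, which depend on neither \<open>f\<close>
  nor \<open>r\<close>.\<close>

lemma functional_values:
  assumes "z \<in> carrier MK"
  shows "\<exists>A. finite A \<and> A \<subseteq> carrier K \<and>
    (\<forall>f\<in>functionals. \<forall>r\<in>carrier R. f (jR r \<odot>\<^bsub>MK\<^esub> z) \<in> lin_span k E A)"
  using assms
proof (induction z rule: MK_induct)
  case (pure x a)
  have "f (jR r \<odot>\<^bsub>MK\<^esub> pM x a) \<in> lin_span k E {a}" if f: "f \<in> functionals" and r: "r \<in> carrier R" for f r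
  proof -
    obtain \<mu> where \<mu>: "linear_map k Mk (ext_space (\<lambda>c. c) k) \<mu>"
      "\<forall>x\<in>carrier M. \<forall>a\<in>carrier K. f (pM x a) = i (\<mu> x) \<otimes>\<^bsub>K\<^esub> a"
      using f unfolding functionals_def by blast
    have rx: "r \<odot>\<^bsub>M\<^esub> x \<in> carrier M" using pure r by (simp add: M.ract_closed)
    have "jR r \<odot>\<^bsub>MK\<^esub> pM x a = pM (r \<odot>\<^bsub>M\<^esub> x) a" using pure r by (simp add: jR_def MK_act)
    hence "f (jR r \<odot>\<^bsub>MK\<^esub> pM x a) = \<mu> (r \<odot>\<^bsub>M\<^esub> x) \<odot>\<^bsub>E\<^esub> a"
      using \<mu>(2) rx pure by simp
    moreover have "\<mu> (r \<odot>\<^bsub>M\<^esub> x) \<in> carrier k" using semilinearD(1)[OF \<mu>(1)] rx by simp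
    moreover have "submodule (lin_span k E {a}) k E" using E.span_submodule[of "{a}"] pure by simp
    moreover have "a \<in> lin_span k E {a}" using E.span_superset[of "{a}"] by simp
    ultimately show ?thesis using E.sub_smult by metis
  qed
  thus ?case using pure by (intro exI[of _ "{a}"]) simp
next
  case (add A B)
  obtain SA where SA: "finite SA" "SA \<subseteq> carrier K"
    "\<forall>f\<in>functionals. \<forall>r\<in>carrier R. f (jR r \<odot>\<^bsub>MK\<^esub> A) \<in> lin_span k E SA" using add.IH(1) by blast
  obtain SB where SB: "finite SB" "SB \<subseteq> carrier K"
    "\<forall>f\<in>functionals. \<forall>r\<in>carrier R. f (jR r \<odot>\<^bsub>MK\<^esub> B) \<in> lin_span k E SB" using add.IH(2) by blast
  have sm: "submodule (lin_span k E (SA \<union> SB)) k E" using E.span_submodule[of "SA \<union> SB"] SA SB by simp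
  have "f (jR r \<odot>\<^bsub>MK\<^esub> (A \<oplus>\<^bsub>MK\<^esub> B)) \<in> lin_span k E (SA \<union> SB)"
    if f: "f \<in> functionals" and r: "r \<in> carrier R" for f r
  proof -
    have jr: "jR r \<in> carrier RK" using r by (simp add: jR_def pR)
    have lf: "linear_map K MKv KK f" using f by (simp add: functionals_def)
    have "f (jR r \<odot>\<^bsub>MK\<^esub> (A \<oplus>\<^bsub>MK\<^esub> B)) = f (jR r \<odot>\<^bsub>MK\<^esub> A) \<oplus>\<^bsub>E\<^esub> f (jR r \<odot>\<^bsub>MK\<^esub> B)"
      using semilinearD(2)[OF lf] jr add.hyps by (simp add: MK_act)
    moreover have "f (jR r \<odot>\<^bsub>MK\<^esub> A) \<in> lin_span k E (SA \<union> SB)" "f (jR r \<odot>\<^bsub>MK\<^esub> B) \<in> lin_span k E (SA \<union> SB)"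
      using SA(3) SB(3) f r E.span_mono[of SA "SA \<union> SB"] E.span_mono[of SB "SA \<union> SB"] by blast+
    ultimately show ?thesis using E.sub_add[OF sm] by simp
  qed
  thus ?case using SA SB by (intro exI[of _ "SA \<union> SB"]) simp
qed

lemma submodule_lower_bound:
  assumes N: "submodule N RK MK" "N \<noteq> {\<zero>\<^bsub>MK\<^esub>}"
  obtains N0 where "submodule N0 R M" "N0 \<noteq> {\<zero>\<^bsub>M\<^esub>}"
    "gkdim k R (M\<lparr>carrier := N0\<rparr>) \<le> gkdim K RK (MK\<lparr>carrier := N\<rparr>)"
proof -
  obtain z where z: "z \<in> N" "z \<noteq> \<zero>\<^bsub>MK\<^esub>" using N submodule_facts(2)[OF N(1)] by blast
  have zc: "z \<in> carrier MK" using z submodule_facts(1)[OF N(1)] by blast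
  obtain f where f: "f \<in> functionals" "f z \<noteq> \<zero>\<^bsub>K\<^esub>" using functionals_separate[OF zc z(2)] by blast
  obtain \<mu> where \<mu>: "linear_map k Mk (ext_space (\<lambda>c. c) k) \<mu>"
    "\<forall>x\<in>carrier M. \<forall>a\<in>carrier K. f (pM x a) = i (\<mu> x) \<otimes>\<^bsub>K\<^esub> a" and lf: "linear_map K MKv KK f"
    using f unfolding functionals_def by blast
  have "submodule {\<zero>\<^bsub>K\<^esub>} k E" using E.span_empty E.span_submodule[of "{}"] by simp
  \<comment> \<open>Normalising \<open>l\<close> at the nonzero element \<open>f z\<close> of
    \<open>K\<close> will force \<open>p z\<close> to be nonzero.\<close>
  from E.separating_functional[OF this, of "f z"] obtain l where
    l: "linear_map k E (ext_space (\<lambda>c. c) k) l" "l (f z) = \<one>\<^bsub>k\<^esub>"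
    using f(2) semilinearD(1)[OF lf, of z] zc by auto
  obtain p where p: "p \<in> carrier MK \<rightarrow> carrier M"
    "\<And>A B. \<lbrakk>A \<in> carrier MK; B \<in> carrier MK\<rbrakk> \<Longrightarrow> p (A \<oplus>\<^bsub>MK\<^esub> B) = p A \<oplus>\<^bsub>M\<^esub> p B"
    "\<And>x a. \<lbrakk>x \<in> carrier M; a \<in> carrier K\<rbrakk> \<Longrightarrow> p (pM x a) = l a \<odot>\<^bsub>Mk\<^esub> x"
    using functional_on_coefficients[OF l(1)] by blast
  note Dl = semilinearD[OF l(1), simplified] and D\<mu> = semilinearD[OF \<mu>(1)] and Df = semilinearD[OF lf, simplified]
  have pc: "p A \<in> carrier M" if "A \<in> carrier MK" for A using p(1) that by blast
  have p0: "p \<zero>\<^bsub>MK\<^esub> = \<zero>\<^bsub>M\<^esub>"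
    using p(2)[of "\<zero>\<^bsub>MK\<^esub>" "\<zero>\<^bsub>MK\<^esub>"] pc[of "\<zero>\<^bsub>MK\<^esub>"] M.M.add.r_cancel_one' by simp
  have pj: "p (jR r \<odot>\<^bsub>MK\<^esub> A) = r \<odot>\<^bsub>M\<^esub> p A" if r: "r \<in> carrier R" and A: "A \<in> carrier MK" for r A
    using A
  proof (induction A rule: MK_induct)
    case (pure x a)
    hence xa: "x \<in> carrier M" "a \<in> carrier K" by simp_all
    have "p (jR r \<odot>\<^bsub>MK\<^esub> pM x a) = l a \<odot>\<^bsub>Mk\<^esub> (r \<odot>\<^bsub>M\<^esub> x)"
      using xa r p(3)[of "r \<odot>\<^bsub>M\<^esub> x" a] by (simp add: jR_def MK_act M.ract_closed)
    also have "\<dots> = r \<odot>\<^bsub>M\<^esub> (l a \<odot>\<^bsub>Mk\<^esub> x)"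
      using M.restrict_scalars_act(1)[OF Dl(1)[OF xa(2)] r xa(1)] by simp
    finally show ?case using p(3)[OF xa] by simp
  next
    case (add A B)
    thus ?case using r p(2) pc by (simp add: MK_act jR_def pR M.ract_add)
  qed
  \<comment> \<open>Both sides send \<open>x \<otimes> a\<close> to \<open>l a\<close> times
    \<open>\<mu> x\<close>, by \<open>k\<close>-linearity of \<open>\<mu>\<close> and of
    \<open>l\<close>.\<close>
  have \<mu>p: "\<mu> (p A) = l (f A)" if "A \<in> carrier MK" for A
    using that
  proof (induction A rule: MK_induct)
    case (pure x a)
    hence xa: "x \<in> carrier M" "a \<in> carrier K" by simp_all
    have mx: "\<mu> x \<in> carrier k" using D\<mu>(1)[of x] xa by simp
    have "\<mu> (p (pM x a)) = l a \<otimes>\<^bsub>k\<^esub> \<mu> x"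
      using D\<mu>(3)[of "l a" x] xa Dl(1)[of a] p(3)[OF xa] by simp
    also have "\<dots> = l (f (pM x a))"
      using \<mu>(2) xa Dl(1)[of a] Dl(3)[of "\<mu> x" a] mx by (simp add: k.m_comm)
    finally show ?case .
  next
    case (add A B)
    thus ?case using p(2) pc D\<mu>(2)[of "p A" "p B"] Df(1,2) Dl(2) by simp
  qed
  have "p z \<noteq> \<zero>\<^bsub>M\<^esub>"
  proof
    assume "p z = \<zero>\<^bsub>M\<^esub>"
    moreover have "\<mu> \<zero>\<^bsub>M\<^esub> = \<zero>\<^bsub>k\<^esub>"
      using semilinear_zero[OF Mk.vec_space_axioms vec_space_ext_self[OF k.field_axioms] \<mu>(1)] by simp
    ultimately show False using \<mu>p[OF zc] l(2) by simp
  qed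
  moreover obtain A where A: "finite A" "A \<subseteq> carrier K"
    "\<And>f r. \<lbrakk>f \<in> functionals; r \<in> carrier R\<rbrakk> \<Longrightarrow> f (jR r \<odot>\<^bsub>MK\<^esub> z) \<in> lin_span k E A"
    using functional_values[OF zc] by blast
  moreover have "linear_map K MKv KK f" if "f \<in> functionals" for f using that by (simp add: functionals_def)
  ultimately show ?thesis
    using SE.le_gkdim[of N z p functionals A, OF N(1) z(1) p(1) p0 _ pj _ functionals_separate A(1,2)] that by blast
qed

text \<open>A nonzero \<open>x\<close> has a functional with \<open>\<mu> x = 1\<close>, whose
  extension takes the value 1 at \<open>x \<otimes> 1\<close>. The equivalence governs the value
  \<open>- 1\<close> that \<open>gkdim\<close> assigns to zero modules.\<close>

lemma MK_trivial_iff: "carrier MK = {\<zero>\<^bsub>MK\<^esub>} \<longleftrightarrow> carrier M = {\<zero>\<^bsub>M\<^esub>}"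
proof
  assume M0: "carrier M = {\<zero>\<^bsub>M\<^esub>}"
  have "A = \<zero>\<^bsub>MK\<^esub>" if "A \<in> carrier MK" for A
    using that
  proof (induction A rule: MK_induct)
    case (pure x a)
    thus ?case using M0 TM.pr_zero[of a] by (simp add: MK_T)
  qed simp
  thus "carrier MK = {\<zero>\<^bsub>MK\<^esub>}" using MK.zero_closed by blast
next
  assume MK0: "carrier MK = {\<zero>\<^bsub>MK\<^esub>}"
  have "x = \<zero>\<^bsub>M\<^esub>" if x: "x \<in> carrier M" for x
  proof (rule ccontr)
    assume x0: "x \<noteq> \<zero>\<^bsub>M\<^esub>"
    have "submodule {\<zero>\<^bsub>M\<^esub>} k Mk" using Mk.span_empty Mk.span_submodule[of "{}"] by simp
    from Mk.separating_functional[OF this, of x] x x0 obtain \<mu> where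
      \<mu>: "linear_map k Mk (ext_space (\<lambda>c. c) k) \<mu>" "\<mu> x = \<one>\<^bsub>k\<^esub>" by auto
    obtain f where f: "linear_map K MKv KK f"
      "\<And>x a. \<lbrakk>x \<in> carrier M; a \<in> carrier K\<rbrakk> \<Longrightarrow> f (pM x a) = i (\<mu> x) \<otimes>\<^bsub>K\<^esub> a"
      using extend_functional[OF \<mu>(1)] by blast
    have "f (jM x) = \<one>\<^bsub>K\<^esub>" using f(2)[OF x, of "\<one>\<^bsub>K\<^esub>"] \<mu>(2) ring_hom_one[OF i] by (simp add: jM_def)
    moreover have "jM x = \<zero>\<^bsub>MK\<^esub>" using MK0 pM(1)[OF x K.one_closed] by (simp add: jM_def)
    moreover have "f \<zero>\<^bsub>MK\<^esub> = \<zero>\<^bsub>K\<^esub>"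
      using semilinear_zero[OF SE.MK.vec_space_axioms vec_space_ext_self[OF K.field_axioms] f(1)] by simp
    ultimately show False by simp
  qed
  thus "carrier M = {\<zero>\<^bsub>M\<^esub>}" using M.M.zero_closed by blast
qed

lemma gk_homogeneous_base_change:
  assumes "gk_homogeneous k R M d" shows "gk_homogeneous K RK MK d"
proof -
  have dM: "gkdim k R M = ereal d"
    and hom: "\<And>N. \<lbrakk>submodule N R M; N \<noteq> {\<zero>\<^bsub>M\<^esub>}\<rbrakk> \<Longrightarrow> gkdim k R (M\<lparr>carrier := N\<rparr>) = ereal d"
    using assms by (auto simp: gk_homogeneous_def)
  have eq: "gkdim K RK (MK\<lparr>carrier := N\<rparr>) = ereal d" if N: "submodule N RK MK" "N \<noteq> {\<zero>\<^bsub>MK\<^esub>}" for N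
  proof (rule antisym)
    have "carrier MK \<noteq> {\<zero>\<^bsub>MK\<^esub>}" using N submodule_facts(1,2)[OF N(1)] by blast
    hence M0: "carrier M \<noteq> {\<zero>\<^bsub>M\<^esub>}" by (simp add: MK_trivial_iff)
    have act: "jM (r \<odot>\<^bsub>M\<^esub> x) = jR r \<odot>\<^bsub>MK\<^esub> jM x" if "r \<in> carrier R" "x \<in> carrier M" for r x
      using that by (simp add: jM_def jR_def MK_act)
    show "gkdim K RK (MK\<lparr>carrier := N\<rparr>) \<le> ereal d"
      using SE.gkdim_le[OF jM_semilinear act RK_generated MK_generated N M0] dM by simp
    obtain N0 where "submodule N0 R M" "N0 \<noteq> {\<zero>\<^bsub>M\<^esub>}"
      "gkdim k R (M\<lparr>carrier := N0\<rparr>) \<le> gkdim K RK (MK\<lparr>carrier := N\<rparr>)"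
      using submodule_lower_bound[OF N] by blast
    thus "ereal d \<le> gkdim K RK (MK\<lparr>carrier := N\<rparr>)" using hom by simp
  qed
  have "gkdim K RK MK = ereal d"
  proof (cases "carrier MK = {\<zero>\<^bsub>MK\<^esub>}")
    \<comment> \<open>Both modules are zero, and both dimensions are \<open>- 1\<close> by
      convention.\<close>
    case True
    thus ?thesis using dM MK_trivial_iff by (simp add: gkdim_def)
  next
    case False
    have "submodule (carrier MK) RK MK"
      by (rule SE.M'.submoduleI) (simp_all add: MK_act)
    from eq[OF this False] show ?thesis by simp
  qed
  thus ?thesis using eq right_module_MK by (simp add: gk_homogeneous_def)
qed

end

theorem proposition2p4:
  fixes k :: "'k ring" and K :: "'c ring" and i :: "'k \<Rightarrow> 'c"
    and R :: "('k, 'r) module" and M :: "('r, 'm) module" and d :: real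
  assumes "field k"
    and "nc_algebra k R"
    and "gkdim_exact k R"
    and "right_module k R M"
    and "field K" and "i \<in> ring_hom k K"
    and "gk_homogeneous k R M d"
  shows "gk_homogeneous K (base_change_algebra k i K R) (base_change_module k i K R M) d"
proof -
  interpret base_change k K R M i
    using assms by (intro base_change.intro base_change_axioms.intro)
  show ?thesis by (rule gk_homogeneous_base_change[OF assms(7)])
qed

end
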